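(* Let $G$ be a finitely generated word hyperbolic group and let $S$ be a finite generating set of $G$. Then the Cayley graph of $G$ with respect to $S$ (i.e. $G$ with the word metric $d_S$) admits a bilipschitz embedding into every nonsuperreflexive Banach space $X$.
   Context: A Banach space is superreflexive if it admits an equivalent uniformly convex norm; otherwise it is nonsuperreflexive. Word hyperbolic is in the sense of Gromov. The Cayley graph is regarded as the metric space whose points are the elements of $G$ with the shortest path (word) distance. A map $f:(A,d_A)\to (B,d_B)$ is a bilipschitz embedding if there are constants $0<c\le C<\infty$ with $c\,d_A(u,v)\le d_B(f(u),f(v))\le C\,d_A(u,v)$ for all $u,v$. *)

theory Defs
  imports "HOL-Analysis.Analysis" "HOL-Algebra.Algebra"
begin

definition word_prod :: "('a, 'b) monoid_scheme \<Rightarrow> 'a list \<Rightarrow> 'a" where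
  "word_prod G w = foldr (\<lambda>x y. x \<otimes>\<^bsub>G\<^esub> y) w \<one>\<^bsub>G\<^esub>"

definition word_length :: "('a, 'b) monoid_scheme \<Rightarrow> 'a set \<Rightarrow> 'a \<Rightarrow> nat" where
  "word_length G S g =
     (LEAST n. \<exists>w. length w = n \<and> set w \<subseteq> S \<union> m_inv G ` S \<and> word_prod G w = g)"

text \<open>Word metric d_S (= path metric of the Cayley graph on its vertex set).\<close>
definition word_dist :: "('a, 'b) monoid_scheme \<Rightarrow> 'a set \<Rightarrow> 'a \<Rightarrow> 'a \<Rightarrow> real" where
  "word_dist G S g h = real (word_length G S (inv\<^bsub>G\<^esub> g \<otimes>\<^bsub>G\<^esub> h))"

definition finite_generating_set :: "('a, 'b) monoid_scheme \<Rightarrow> 'a set \<Rightarrow> bool" where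
  "finite_generating_set G S \<longleftrightarrow> finite S \<and> S \<subseteq> carrier G \<and> generate G S = carrier G"

definition gromov_product :: "('p \<Rightarrow> 'p \<Rightarrow> real) \<Rightarrow> 'p \<Rightarrow> 'p \<Rightarrow> 'p \<Rightarrow> real" where
  "gromov_product d w x y = (d x w + d y w - d x y) / 2"

definition gromov_hyperbolic :: "'p set \<Rightarrow> ('p \<Rightarrow> 'p \<Rightarrow> real) \<Rightarrow> bool" where
  "gromov_hyperbolic A d \<longleftrightarrow> (\<exists>\<delta>\<ge>0. \<forall>x\<in>A. \<forall>y\<in>A. \<forall>z\<in>A. \<forall>w\<in>A.
      gromov_product d w x z \<ge> min (gromov_product d w x y) (gromov_product d w y z) - \<delta>)"

definition word_hyperbolic :: "('a, 'b) monoid_scheme \<Rightarrow> bool" where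
  "word_hyperbolic G \<longleftrightarrow> group G \<and>
     (\<exists>T. finite_generating_set G T \<and> gromov_hyperbolic (carrier G) (word_dist G T))"

definition equivalent_norm :: "('v::real_normed_vector \<Rightarrow> real) \<Rightarrow> bool" where
  "equivalent_norm N \<longleftrightarrow>
     (\<forall>x y. N (x + y) \<le> N x + N y) \<and> (\<forall>r x. N (r *\<^sub>R x) = \<bar>r\<bar> * N x) \<and>
     (\<exists>c C. 0 < c \<and> c \<le> C \<and> (\<forall>x. c * norm x \<le> N x \<and> N x \<le> C * norm x))"

definition uniformly_convex :: "('v::real_normed_vector \<Rightarrow> real) \<Rightarrow> bool" where
  "uniformly_convex N \<longleftrightarrow>
     (\<forall>\<epsilon>>0. \<exists>\<delta>>0. \<forall>x y. N x \<le> 1 \<and> N y \<le> 1 \<and> N (x - y) \<ge> \<epsilon> \<longrightarrow>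
        N ((1/2) *\<^sub>R (x + y)) \<le> 1 - \<delta>)"

definition superreflexive :: "'v::real_normed_vector itself \<Rightarrow> bool" where
  "superreflexive (_ :: 'v itself) \<longleftrightarrow>
     (\<exists>N :: 'v \<Rightarrow> real. equivalent_norm N \<and> uniformly_convex N)"

definition bilipschitz_embedding ::
    "'p set \<Rightarrow> ('p \<Rightarrow> 'p \<Rightarrow> real) \<Rightarrow> ('p \<Rightarrow> 'v::metric_space) \<Rightarrow> bool" where
  "bilipschitz_embedding A d f \<longleftrightarrow> (\<exists>c C. 0 < c \<and> c \<le> C \<and>
     (\<forall>u\<in>A. \<forall>v\<in>A. c * d u v \<le> dist (f u) (f v) \<and> dist (f u) (f v) \<le> C * d u v))"

end

theory Submission
  imports Defs "HOL-Probability.Probability"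
begin

text \<open>
  If \<open>X\<close> has no equivalent uniformly convex norm, then for some \<open>\<epsilon>\<close> its unit ball contains bounded
  martingales of any length whose steps are \<open>\<epsilon>\<close>-spread: otherwise averaging the distances to the
  successive derived sets would produce a uniformly convex norm. Along a typical path of a long
  martingale, at suitably sparse times, one finds vectors \<open>x\<^sub>1, \<dots>, x\<^sub>m\<close> and functionals \<open>g\<^sub>j\<close> that almost
  vanish on \<open>x\<^sub>1, \<dots>, x\<^sub>j\<^sub>-\<^sub>1\<close> and are almost constant on the later \<open>x\<^sub>i\<close>, so the norm of a linear
  combination dominates all its partial sums over intervals.

  It therefore suffices to map the group Lipschitz-continuously into an \<open>\<ell>\<^sub>1\<close> space so that any two
  images are told apart by a set of a laminar family, on which one image has large mass and the other
  vanishes: a finite laminar family consists of intervals of a suitable linear order. Balls of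
  radius \<open>2\<^sup>n\<close> are treated in almost independent blocks of \<open>X\<close>, glued by weights that are Lipschitz in
  \<open>log \<bar>x\<bar>\<close>; the vanishing of the second image makes the gluing compatible with the lower bound.

  The \<open>\<ell>\<^sub>1\<close> map sends \<open>x\<close> to the occupation measure of a random walk from \<open>x\<close> towards the identity.
  Hyperbolicity makes the walks from neighbouring points couple at a geometric rate. Colouring the
  points of each sphere so that close points differ, and letting for each colour the points of this
  colour capture as many descendants as possible, gives finitely many trees; any shadow is captured
  whole in one of them, and the sets of descendants in a tree are laminar.
\<close>

section \<open>The Hahn-Banach theorem\<close>

text \<open>A single geodesic to the identity does not depend on its starting point in a Lipschitz
  way: geodesics from adjacent points may run side by side without meeting, which costs their whole
  length in l1. Spreading every step uniformly over all almost geodesic predecessors cures this,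
  because two uniform laws with a common atom overlap by a fixed amount.

  Laminar families appear because the space offers functionals of one kind only, tails along a
  linear order and hence intervals, with norms bounded independently of the length of the system.
  These systems are finite and hold only up to an error, which forces the division into scales. The
  errors are harmless because distinct group elements have distance at least 1, so a small additive
  loss is a small fraction of the distance.

  Superreflexivity is defined by renorming, so the long martingales come from contraposition, and
  only their existence for each length is known: the length must be fixed in advance, uniformly over
  all martingales. This is why the quotient norm is regularised and why the choice of times is an
  induction on their number.\<close>

definition sublinear :: "('v::real_vector \<Rightarrow> real) \<Rightarrow> bool" where
  "sublinear p \<longleftrightarrow> (\<forall>x y. p (x + y) \<le> p x + p y) \<and> (\<forall>t x. 0 \<le> t \<longrightarrow> p (t *\<^sub>R x) = t * p x)"

lemma sublinearD:
  assumes "sublinear p"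
  shows "p (x + y) \<le> p x + p y" "0 \<le> t \<Longrightarrow> p (t *\<^sub>R x) = t * p x" "p 0 = 0" "- p (- x) \<le> p x"
proof -
  show add: "p (x + y) \<le> p x + p y" for x y using assms by (auto simp: sublinear_def)
  show sc: "0 \<le> t \<Longrightarrow> p (t *\<^sub>R x) = t * p x" for t x using assms by (auto simp: sublinear_def)
  show z: "p 0 = 0" using sc[of 0 0] by simp
  show "- p (- x) \<le> p x" using add[of x "- x"] z by simp
qed

text \<open>For sublinear \<open>p\<close>, the largest sublinear minorant whose value at
  \<open>- a\<close> is \<open>- p a\<close>. A functional that no shrinking lowers is odd in every
  direction, hence linear.\<close>

definition shrink :: "('v::real_vector \<Rightarrow> real) \<Rightarrow> 'v \<Rightarrow> 'v \<Rightarrow> real" where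
  "shrink p a x = (INF t\<in>{0..}. p (x + t *\<^sub>R a) - t * p a)"

lemma shrink_bdd:
  assumes "sublinear p" shows "bdd_below ((\<lambda>t. p (x + t *\<^sub>R a) - t * p a) ` {0..})"
proof (rule bdd_belowI2)
  fix t :: real assume "t \<in> {0..}"
  then have "t * p a \<le> p (x + t *\<^sub>R a) + p (- x)"
    using sublinearD(1)[OF assms, of "x + t *\<^sub>R a" "- x"] sublinearD(2)[OF assms, of t a] by simp
  then show "- p (- x) \<le> p (x + t *\<^sub>R a) - t * p a" by simp
qed

lemma shrink_le:
  assumes "sublinear p" "0 \<le> t" shows "shrink p a x \<le> p (x + t *\<^sub>R a) - t * p a"
  unfolding shrink_def by (rule cINF_lower[OF shrink_bdd[OF assms(1)]]) (use assms in auto)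

lemma shrink_greatest:
  assumes "\<And>t. 0 \<le> t \<Longrightarrow> m \<le> p (x + t *\<^sub>R a) - t * p a" shows "m \<le> shrink p a x"
  unfolding shrink_def by (rule cINF_greatest) (use assms in auto)

lemma sublinear_shrink:
  assumes p: "sublinear p" shows "sublinear (shrink p a)"
proof -
  have scale_le: "shrink p a (s *\<^sub>R x) \<le> s * shrink p a x" if s: "0 < s" for s x
  proof -
    have "shrink p a (s *\<^sub>R x) / s \<le> shrink p a x"
    proof (rule shrink_greatest)
      fix t :: real assume t: "0 \<le> t"
      have "shrink p a (s *\<^sub>R x) \<le> p (s *\<^sub>R x + (s * t) *\<^sub>R a) - (s * t) * p a"
        by (rule shrink_le[OF p]) (use s t in auto)
      also have "\<dots> = s * (p (x + t *\<^sub>R a) - t * p a)"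
        using sublinearD(2)[OF p, of s "x + t *\<^sub>R a"] s by (simp add: algebra_simps)
      finally show "shrink p a (s *\<^sub>R x) / s \<le> p (x + t *\<^sub>R a) - t * p a"
        using s by (simp add: field_simps)
    qed
    then show ?thesis using s by (simp add: field_simps)
  qed
  have zero: "shrink p a 0 = 0"
  proof (rule antisym)
    show "shrink p a 0 \<le> 0" using shrink_le[OF p, of 0 a 0] sublinearD(3)[OF p] by simp
    show "0 \<le> shrink p a 0" by (rule shrink_greatest) (simp add: sublinearD(2)[OF p])
  qed
  have scale: "shrink p a (s *\<^sub>R x) = s * shrink p a x" if "0 \<le> s" for s x
  proof (cases "s = 0")
    case False
    then have s: "0 < s" using that by simp
    have "shrink p a x \<le> inverse s * shrink p a (s *\<^sub>R x)"
      using scale_le[of "inverse s" "s *\<^sub>R x"] s by simp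
    then have "s * shrink p a x \<le> shrink p a (s *\<^sub>R x)" using s by (simp add: field_simps)
    then show ?thesis using scale_le[OF s, of x] by simp
  qed (simp add: zero)
  have "shrink p a (x + y) \<le> shrink p a x + shrink p a y" for x y
  proof -
    have "shrink p a (x + y) - shrink p a y \<le> shrink p a x"
    proof (rule shrink_greatest)
      fix t :: real assume t: "0 \<le> t"
      have "shrink p a (x + y) - (p (x + t *\<^sub>R a) - t * p a) \<le> shrink p a y"
      proof (rule shrink_greatest)
        fix u :: real assume u: "0 \<le> u"
        have "shrink p a (x + y) \<le> p ((x + y) + (t + u) *\<^sub>R a) - (t + u) * p a"
          by (rule shrink_le[OF p]) (use t u in auto)
        also have "(x + y) + (t + u) *\<^sub>R a = (x + t *\<^sub>R a) + (y + u *\<^sub>R a)" by (simp add: algebra_simps)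
        finally show "shrink p a (x + y) - (p (x + t *\<^sub>R a) - t * p a) \<le> p (y + u *\<^sub>R a) - u * p a"
          using sublinearD(1)[OF p, of "x + t *\<^sub>R a" "y + u *\<^sub>R a"] by (simp add: algebra_simps)
      qed
      then show "shrink p a (x + y) - shrink p a y \<le> p (x + t *\<^sub>R a) - t * p a" by simp
    qed
    then show ?thesis by simp
  qed
  then show ?thesis using scale by (auto simp: sublinear_def)
qed

lemma shrink_le_self: "sublinear p \<Longrightarrow> shrink p a x \<le> p x"
  using shrink_le[of p 0 a x] by simp

lemma shrink_uminus: "sublinear p \<Longrightarrow> shrink p a (- a) \<le> - p a"
  using shrink_le[of p 1 a "- a"] by (simp add: sublinearD(3))

text \<open>Zorn's lemma for the reversed pointwise order. A chain has its pointwise infimum as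
  lower bound, finite because every sublinear minorant of \<open>p\<close> is at least
  \<open>- p (- x)\<close> at \<open>x\<close>.\<close>

lemma minimal_sublinear:
  fixes p :: "'v::real_vector \<Rightarrow> real"
  assumes p: "sublinear p"
  obtains q where "sublinear q" "q \<le> p" "\<And>q'. sublinear q' \<Longrightarrow> q' \<le> q \<Longrightarrow> q' = q"
proof -
  define A where "A = {q. sublinear q \<and> q \<le> p}"
  have "\<exists>m\<in>A. \<forall>a\<in>A. a \<le> m \<longrightarrow> a = m"
  proof (rule predicate_Zorn)
    show "partial_order_on A (relation_of (\<ge>) A)"
      by (rule partial_order_on_relation_ofI) auto
    fix C assume C: "C \<in> Chains (relation_of (\<ge>) A)"
    have CA: "C \<subseteq> A" using C by (rule Chains_relation_of)
    have cmp: "q \<le> q' \<or> q' \<le> q" if "q \<in> C" "q' \<in> C" for q q'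
      using C that by (auto simp: Chains_def relation_of_def)
    show "\<exists>u\<in>A. \<forall>a\<in>C. u \<le> a"
    proof (cases "C = {}")
      case True
      then show ?thesis using p by (auto simp: A_def)
    next
      case False
      define u where "u x = (INF q\<in>C. q x)" for x
      have bdd: "bdd_below ((\<lambda>q. q x) ` C)" for x
      proof (rule bdd_belowI2)
        fix q assume "q \<in> C"
        then have "sublinear q" "q \<le> p" using CA by (auto simp: A_def)
        then show "- p (- x) \<le> q x" using sublinearD(4)[of q x] le_funD[of q p "- x"] by linarith
      qed
      have low: "u x \<le> q x" if "q \<in> C" for q x
        unfolding u_def by (rule cINF_lower[OF bdd that])
      have gr: "m \<le> u x" if "\<And>q. q \<in> C \<Longrightarrow> m \<le> q x" for m x
        unfolding u_def by (rule cINF_greatest[OF False]) (rule that)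
      have sub: "sublinear q" if "q \<in> C" for q using that CA by (auto simp: A_def)
      have "u (x + y) \<le> u x + u y" for x y
      proof -
        have "u (x + y) - u y \<le> u x"
        proof (rule gr)
          fix q assume q: "q \<in> C"
          have "u (x + y) - q x \<le> u y"
          proof (rule gr)
            fix q' assume q': "q' \<in> C"
            \<comment> \<open>The chain condition enters here: one member below both
              \<open>q\<close> and \<open>q'\<close> makes the infimum subadditive.\<close>
            obtain r where r: "r \<in> C" "r \<le> q" "r \<le> q'" using cmp[OF q q'] q q' by auto
            have "u (x + y) \<le> r x + r y"
              using low[OF r(1), of "x + y"] sublinearD(1)[OF sub[OF r(1)], of x y] by linarith
            also have "\<dots> \<le> q x + q' y" using r by (intro add_mono) (auto simp: le_fun_def)
            finally show "u (x + y) - q x \<le> q' y" by simp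
          qed
          then show "u (x + y) - u y \<le> q x" by simp
        qed
        then show ?thesis by simp
      qed
      moreover have "u (t *\<^sub>R x) = t * u x" if t: "0 \<le> t" for t x
      proof (cases "t = 0")
        case True
        have "(\<lambda>q. q 0) ` C = (\<lambda>q. 0) ` C" by (rule image_cong) (auto simp: sublinearD(3)[OF sub])
        then show ?thesis using True False by (simp add: u_def image_constant_conv)
      next
        case F: False
        then have t: "0 < t" using t by simp
        have "u (t *\<^sub>R x) / t \<le> u x"
          by (rule gr) (use low[of _ "t *\<^sub>R x"] sublinearD(2)[OF sub, of _ t x] t in \<open>simp add: field_simps\<close>)
        moreover have "t * u x \<le> u (t *\<^sub>R x)"
        proof (rule gr)
          fix q assume q: "q \<in> C"
          have "t * u x \<le> t * q x" by (rule mult_left_mono[OF low[OF q]]) (use t in simp)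
          then show "t * u x \<le> q (t *\<^sub>R x)" using sublinearD(2)[OF sub[OF q], of t x] t by simp
        qed
        ultimately show ?thesis using t by (simp add: field_simps)
      qed
      ultimately have "sublinear u" by (auto simp: sublinear_def)
      moreover have "u \<le> p"
      proof (rule le_funI)
        fix x
        obtain q where q: "q \<in> C" using False by auto
        then have "q \<le> p" using CA by (auto simp: A_def)
        then show "u x \<le> p x" using low[OF q, of x] le_funD[of q p x] by linarith
      qed
      ultimately show ?thesis using low by (auto simp: A_def le_fun_def)
    qed
  qed
  then obtain m where "m \<in> A" and m: "\<And>a. a \<in> A \<Longrightarrow> a \<le> m \<Longrightarrow> a = m" by auto
  show thesis
  proof
    show "sublinear m" "m \<le> p" using \<open>m \<in> A\<close> by (auto simp: A_def)
    fix q' assume "sublinear q'" "q' \<le> m"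
    then show "q' = m" using m[of q'] \<open>m \<le> p\<close> by (auto simp: A_def)
  qed
qed

theorem Hahn_Banach_sublinear:
  fixes p :: "'v::real_vector \<Rightarrow> real"
  assumes p: "sublinear p"
  obtains g where "linear g" "\<And>x. g x \<le> p x" "g a = p a"
proof -
  \<comment> \<open>Minimising below \<open>shrink p a\<close> rather than below \<open>p\<close>
    yields the prescribed value: \<open>q (- a) \<le> - p a\<close>, and once \<open>q\<close> is
    odd, \<open>q a \<ge> p a\<close>.\<close>
  obtain q where q: "sublinear q" "q \<le> shrink p a" and
    min: "\<And>q'. sublinear q' \<Longrightarrow> q' \<le> q \<Longrightarrow> q' = q"
    using minimal_sublinear[OF sublinear_shrink[OF p]] by blast
  have shrink_eq: "shrink q b = q" for b
    by (rule min) (auto simp: le_fun_def sublinear_shrink q shrink_le_self)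
  then have "q (- b) \<le> - q b" for b using shrink_uminus[OF q(1), of b] by (simp add: shrink_eq)
  then have neg: "q (- b) = - q b" for b using sublinearD(4)[OF q(1), of b] by (simp add: order_antisym)
  have "linear q"
  proof (rule linearI)
    show "q (x + y) = q x + q y" for x y
    proof (rule antisym)
      show "q (x + y) \<le> q x + q y" by (rule sublinearD(1)[OF q(1)])
      show "q x + q y \<le> q (x + y)"
        using sublinearD(1)[OF q(1), of "- x" "- y"] neg[of "x + y"] by (simp add: neg)
    qed
    show "q (r *\<^sub>R x) = r *\<^sub>R q x" for r x
    proof (cases "0 \<le> r")
      case True
      then show ?thesis using sublinearD(2)[OF q(1)] by simp
    next
      case False
      then show ?thesis using sublinearD(2)[OF q(1), of "- r" x] neg[of "r *\<^sub>R x"] by simp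
    qed
  qed
  moreover have le: "q x \<le> p x" for x
    using le_funD[OF q(2), of x] shrink_le_self[OF p, of a x] by linarith
  moreover have "q a = p a"
    using shrink_uminus[OF p, of a] le_funD[OF q(2), of "- a"] neg[of a] le[of a] by linarith
  ultimately show thesis using that by blast
qed

lemma norming_functional:
  fixes a :: "'v::real_normed_vector"
  obtains g where "linear g" "\<And>x. \<bar>g x\<bar> \<le> norm x" "g a = norm a"
proof -
  have "sublinear (norm :: 'v \<Rightarrow> real)" by (auto simp: sublinear_def norm_triangle_ineq)
  then obtain g where g: "linear g" "\<And>x. g x \<le> norm x" "g a = norm a"
    using Hahn_Banach_sublinear[of norm a] by blast
  have "\<bar>g x\<bar> \<le> norm x" for x
    using g(2)[of x] g(2)[of "- x"] linear_neg[OF g(1), of x] by simp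
  then show thesis using that g by blast
qed

section \<open>Renorming spaces without long spread martingales\<close>

text \<open>The new norm is the Minkowski gauge of the sublevel set \<open>\<Theta> \<le> 1\<close>.
  This spares \<Theta> from being homogeneous, which sums of distances to convex sets need not
  be.\<close>

lemma superreflexive_from_convex_function:
  fixes \<Theta> :: "'v::real_normed_vector \<Rightarrow> real"
  assumes convex: "convex_on UNIV \<Theta>"
    and even: "\<And>x. \<Theta> (- x) = \<Theta> x"
    and low: "\<And>x. norm x \<le> \<Theta> x" and up: "\<And>x. \<Theta> x \<le> 2 * norm x"
    and lip: "\<And>x y. \<Theta> x \<le> \<Theta> y + 2 * norm (x - y)"
    and uc: "\<And>\<epsilon>. 0 < \<epsilon> \<Longrightarrow> \<exists>\<delta>>0. \<forall>x y. \<Theta> x \<le> 1 \<and> \<Theta> y \<le> 1 \<and> \<epsilon> \<le> norm (x - y) \<longrightarrow>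
                \<Theta> ((1/2) *\<^sub>R (x + y)) \<le> 1 - \<delta>"
  shows "superreflexive TYPE('v)"
proof -
  define S where "S x = {t. 0 < t \<and> \<Theta> (x /\<^sub>R t) \<le> 1}" for x
  define N where "N x = Inf (S x)" for x
  have \<Theta>0: "\<Theta> 0 = 0" using low[of 0] up[of 0] by simp
  have S_pos: "0 < t" if "t \<in> S x" for t x using that by (simp add: S_def)
  have bdd: "bdd_below (S x)" for x using S_pos by (intro bdd_belowI[of _ 0]) (simp add: less_imp_le)
  have N_le: "N x \<le> t" if "t \<in> S x" for x t
    unfolding N_def by (rule cInf_lower[OF that bdd])
  have S_large: "t \<in> S x" if "0 < t" "2 * norm x \<le> t" for x t
  proof -
    have "\<Theta> (x /\<^sub>R t) \<le> 2 * norm x / t" using up[of "x /\<^sub>R t"] that(1) by (simp add: divide_inverse mult_ac)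
    also have "\<dots> \<le> 1" using that by simp
    finally show ?thesis using that(1) by (simp add: S_def)
  qed
  have S_ne: "S x \<noteq> {}" for x using S_large[of "2 * norm x + 1" x] by (auto simp: add_nonneg_pos)
  have S_norm: "norm x \<le> t" if "t \<in> S x" for x t
  proof -
    have "norm x / t \<le> 1" using low[of "x /\<^sub>R t"] that by (simp add: S_def divide_inverse mult_ac)
    then show ?thesis using S_pos[OF that] by simp
  qed
  have S_up: "t' \<in> S x" if t: "t \<in> S x" and "t \<le> t'" for x t t'
  proof -
    have pos: "0 < t" "0 < t'" using S_pos[OF t] that by auto
    have "\<Theta> ((1 - t/t') *\<^sub>R 0 + (t/t') *\<^sub>R (x /\<^sub>R t)) \<le> (1 - t/t') * \<Theta> 0 + (t/t') * \<Theta> (x /\<^sub>R t)"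
      by (rule convex_onD[OF convex]) (use pos that in auto)
    also have "\<dots> \<le> (t/t') * 1"
      unfolding \<Theta>0 using t pos by (simp add: S_def field_simps)
    also have "\<dots> \<le> 1" using pos that by simp
    finally show ?thesis using pos by (simp add: S_def field_simps)
  qed
  have N_less: "t \<in> S x" if "N x < t" for x t
  proof -
    have "\<exists>s\<in>S x. s < t" using that cInf_lessD[OF S_ne, of x t] unfolding N_def by blast
    then obtain s where "s \<in> S x" "s < t" by blast
    then show ?thesis using S_up by auto
  qed
  have N_low: "norm x \<le> N x" for x
    unfolding N_def by (rule cInf_greatest[OF S_ne S_norm])
  have N_up: "N x \<le> 2 * norm x" for x
  proof (rule field_le_epsilon)
    fix e :: real assume "0 < e"
    then show "N x \<le> 2 * norm x + e" by (intro N_le S_large) (auto simp: add_nonneg_pos)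
  qed
  have tri: "N (x + y) \<le> N x + N y" for x y
  proof (rule field_le_epsilon)
    fix e :: real assume e: "0 < e"
    define s t where "s = N x + e/2" and "t = N y + e/2"
    have s: "s \<in> S x" and t: "t \<in> S y" using e by (auto intro!: N_less simp: s_def t_def)
    have pos: "0 < s" "0 < t" using s t S_pos by auto
    have "\<Theta> ((1 - t/(s+t)) *\<^sub>R (x /\<^sub>R s) + (t/(s+t)) *\<^sub>R (y /\<^sub>R t))
        \<le> (1 - t/(s+t)) * \<Theta> (x /\<^sub>R s) + (t/(s+t)) * \<Theta> (y /\<^sub>R t)"
      by (rule convex_onD[OF convex]) (use pos in auto)
    also have "\<dots> \<le> (1 - t/(s+t)) * 1 + (t/(s+t)) * 1"
      using s t pos by (intro add_mono mult_left_mono) (auto simp: S_def)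
    also have "(1 - t/(s+t)) *\<^sub>R (x /\<^sub>R s) + (t/(s+t)) *\<^sub>R (y /\<^sub>R t) = (x + y) /\<^sub>R (s + t)"
    proof -
      have "1 - t/(s+t) = s / (s+t)" using pos by (simp add: field_simps)
      moreover have "s / (s+t) * inverse s = inverse (s+t)" "t / (s+t) * inverse t = inverse (s+t)"
        using pos by (auto simp: field_simps)
      ultimately show ?thesis by (simp add: scaleR_add_right)
    qed
    finally have "s + t \<in> S (x + y)" using pos by (simp add: S_def)
    then show "N (x + y) \<le> N x + N y + e" using N_le by (fastforce simp: s_def t_def)
  qed
  have hom_le: "N (r *\<^sub>R x) \<le> \<bar>r\<bar> * N x" if r: "r \<noteq> 0" for r x
  proof -
    have "N (r *\<^sub>R x) / \<bar>r\<bar> \<le> N x"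
    proof (rule field_le_epsilon)
      fix e :: real assume "0 < e"
      then have t: "N x + e \<in> S x" by (intro N_less) auto
      define T where "T = N x + e"
      have "\<Theta> ((r *\<^sub>R x) /\<^sub>R (\<bar>r\<bar> * T)) = \<Theta> (x /\<^sub>R T)"
      proof (cases "0 < r")
        case True
        then have "inverse (\<bar>r\<bar> * T) * r = inverse T" by simp
        then have "(r *\<^sub>R x) /\<^sub>R (\<bar>r\<bar> * T) = x /\<^sub>R T" by (simp only: scaleR_scaleR)
        then show ?thesis by (simp only:)
      next
        case False
        then have "inverse (\<bar>r\<bar> * T) * r = - inverse T" using r by simp
        then have "(r *\<^sub>R x) /\<^sub>R (\<bar>r\<bar> * T) = - (x /\<^sub>R T)" by (simp only: scaleR_scaleR scaleR_minus_left)
        then show ?thesis using even by (simp only:)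
      qed
      then have "\<bar>r\<bar> * (N x + e) \<in> S (r *\<^sub>R x)" using t r by (simp add: S_def T_def)
      then show "N (r *\<^sub>R x) / \<bar>r\<bar> \<le> N x + e" using N_le r by (simp add: field_simps)
    qed
    then show ?thesis using r by (simp add: field_simps)
  qed
  have hom: "N (r *\<^sub>R x) = \<bar>r\<bar> * N x" for r x
  proof (cases "r = 0")
    case True
    then show ?thesis using N_low[of 0] N_up[of 0] by simp
  next
    case False
    have "N x \<le> \<bar>inverse r\<bar> * N (r *\<^sub>R x)" using hom_le[of "inverse r" "r *\<^sub>R x"] False by simp
    then have "\<bar>r\<bar> * N x \<le> N (r *\<^sub>R x)" using False by (simp add: field_simps)
    then show ?thesis using hom_le[OF False, of x] by simp
  qed
  have equiv: "equivalent_norm N"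
    unfolding equivalent_norm_def using tri hom N_low N_up
    by (intro conjI exI[of _ 1] exI[of _ 2]) auto
  \<comment> \<open>Dividing \<open>x\<close> by any \<open>t\<close> above 1 puts it into the
    sublevel set; the Lipschitz bound lets \<open>t\<close> tend to 1.\<close>
  have N_\<Theta>: "\<Theta> x \<le> 1" if "N x \<le> 1" for x
  proof (rule field_le_epsilon)
    fix e :: real assume e: "0 < e"
    define t where "t = 1 + e / 2"
    have t: "1 < t" using e by (simp add: t_def)
    have "norm x \<le> 1" using N_low[of x] that by simp
    have "\<Theta> (x /\<^sub>R t) \<le> 1" using N_less[of x t] that t by (simp add: S_def)
    then have "\<Theta> x \<le> 1 + 2 * norm (x - x /\<^sub>R t)" using lip[of x "x /\<^sub>R t"] by simp
    also have "x - x /\<^sub>R t = (1 - inverse t) *\<^sub>R x" by (simp add: algebra_simps)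
    also have "norm \<dots> = (1 - inverse t) * norm x" using t by (simp add: inverse_le_1_iff)
    also have "\<dots> \<le> (1 - inverse t) * 1"
      by (rule mult_left_mono) (use t \<open>norm x \<le> 1\<close> in \<open>auto simp: inverse_le_1_iff\<close>)
    also have "1 - inverse t \<le> t - 1"
      using t sum_squares_ge_zero[of "t - 1" 0] by (simp add: field_simps)
    finally show "\<Theta> x \<le> 1 + e" by (simp add: t_def)
  qed
  have "uniformly_convex N"
    unfolding uniformly_convex_def
  proof (intro allI impI)
    fix \<epsilon> :: real assume "0 < \<epsilon>"
    \<comment> \<open>Half of \<epsilon>, because \<open>N\<close> is at most twice the
      norm.\<close>
    then obtain \<delta> where \<delta>: "0 < \<delta>" and
      *: "\<And>x y. \<Theta> x \<le> 1 \<Longrightarrow> \<Theta> y \<le> 1 \<Longrightarrow> \<epsilon> / 2 \<le> norm (x - y) \<Longrightarrow> \<Theta> ((1/2) *\<^sub>R (x + y)) \<le> 1 - \<delta>"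
      using uc[of "\<epsilon> / 2"] by auto
    \<comment> \<open>Stretching \<open>m\<close>, of norm at most 1, by \<open>inverse t\<close>
      moves it by at most \<open>\<delta> / 2\<close>, which raises \<Theta> by at most \<delta>:
      the gain at the midpoint is spent exactly.\<close>
    define t where "t = inverse (1 + \<delta> / 2)"
    have t: "0 < t" "t < 1" "inverse t = 1 + \<delta> / 2" using \<delta> by (auto simp: t_def field_simps)
    have "N ((1/2) *\<^sub>R (x + y)) \<le> t" if "N x \<le> 1" "N y \<le> 1" "\<epsilon> \<le> N (x - y)" for x y
    proof -
      define m where "m = (1/2) *\<^sub>R (x + y)"
      have "norm (x + y) \<le> 2" using N_low[of x] N_low[of y] that norm_triangle_ineq[of x y] by linarith
      then have nm: "norm m \<le> 1" by (simp add: m_def)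
      have "\<Theta> m \<le> 1 - \<delta>" unfolding m_def using that N_up[of "x - y"] by (intro * N_\<Theta>) auto
      then have "\<Theta> (m /\<^sub>R t) \<le> 1 - \<delta> + 2 * norm (m /\<^sub>R t - m)" using lip[of "m /\<^sub>R t" m] by simp
      also have "m /\<^sub>R t - m = (\<delta> / 2) *\<^sub>R m" by (simp add: t algebra_simps)
      also have "1 - \<delta> + 2 * norm ((\<delta> / 2) *\<^sub>R m) \<le> 1"
        using nm \<delta> mult_left_mono[of "norm m" 1 \<delta>] by simp
      finally show ?thesis using t N_le by (simp add: S_def m_def)
    qed
    then show "\<exists>\<delta>>0. \<forall>x y. N x \<le> 1 \<and> N y \<le> 1 \<and> \<epsilon> \<le> N (x - y) \<longrightarrow> N ((1/2) *\<^sub>R (x + y)) \<le> 1 - \<delta>"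
      using t by (intro exI[of _ "1 - t"]) auto
  qed
  then show ?thesis using equiv by (auto simp: superreflexive_def)
qed

section \<open>Spread barycenters and the derived sets of the unit ball\<close>

definition barycenter :: "'v::real_vector pmf \<Rightarrow> 'v" where
  "barycenter \<mu> = (\<Sum>u\<in>set_pmf \<mu>. pmf \<mu> u *\<^sub>R u)"

text \<open>The distance is measured from every point \<open>e\<close>, not only from the
  barycenter. This makes the condition linear in \<mu>, so that mixtures keep it and the set is
  convex, and it later allows centres in the span of the past of a martingale.\<close>

definition spread_means :: "real \<Rightarrow> 'v::real_normed_vector set \<Rightarrow> 'v set" where
  "spread_means \<epsilon> C = {x. \<exists>\<mu>. finite (set_pmf \<mu>) \<and> set_pmf \<mu> \<subseteq> C \<and> x = barycenter \<mu> \<and>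
     (\<forall>e. \<epsilon> \<le> measure_pmf.expectation \<mu> (\<lambda>u. norm (u - e)))}"

lemma barycenter_eq:
  assumes "finite A" "set_pmf \<mu> \<subseteq> A" shows "barycenter \<mu> = (\<Sum>u\<in>A. pmf \<mu> u *\<^sub>R u)"
  unfolding barycenter_def by (rule sum.mono_neutral_left) (use assms in \<open>auto simp: set_pmf_iff\<close>)

lemma expectation_eq_sum:
  fixes f :: "'a \<Rightarrow> real"
  assumes "finite A" "set_pmf \<mu> \<subseteq> A"
  shows "measure_pmf.expectation \<mu> f = (\<Sum>u\<in>A. pmf \<mu> u * f u)"
  by (subst integral_measure_pmf[OF assms(1)]) (use assms in auto)

lemma barycenter_in_convex:
  assumes "convex C" "finite (set_pmf \<mu>)" "set_pmf \<mu> \<subseteq> C"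
  shows "barycenter \<mu> \<in> C"
  unfolding barycenter_def
  by (rule convex_sum) (use assms in \<open>auto simp: sum_pmf_eq_1\<close>)

lemma spread_means_subset: "convex C \<Longrightarrow> spread_means \<epsilon> C \<subseteq> C"
  using barycenter_in_convex by (auto simp: spread_means_def)

lemma convex_spread_means: "convex (spread_means \<epsilon> C)"
proof (rule convexI)
  fix x y and s t :: real
  assume "x \<in> spread_means \<epsilon> C" "y \<in> spread_means \<epsilon> C" and st: "0 \<le> s" "0 \<le> t" "s + t = 1"
  then obtain \<mu> \<nu> where
    \<mu>: "finite (set_pmf \<mu>)" "set_pmf \<mu> \<subseteq> C" "x = barycenter \<mu>" "\<And>e. \<epsilon> \<le> measure_pmf.expectation \<mu> (\<lambda>u. norm (u - e))" and
    \<nu>: "finite (set_pmf \<nu>)" "set_pmf \<nu> \<subseteq> C" "y = barycenter \<nu>" "\<And>e. \<epsilon> \<le> measure_pmf.expectation \<nu> (\<lambda>u. norm (u - e))"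
    by (auto simp: spread_means_def)
  define A where "A = set_pmf \<mu> \<union> set_pmf \<nu>"
  have A: "finite A" "set_pmf \<mu> \<subseteq> A" "set_pmf \<nu> \<subseteq> A" "A \<subseteq> C" using \<mu> \<nu> by (auto simp: A_def)
  define \<kappa> where "\<kappa> = bernoulli_pmf s \<bind> (\<lambda>b. if b then \<mu> else \<nu>)"
  have t: "t = 1 - s" "s \<le> 1" using st by auto
  have pmf: "pmf \<kappa> u = s * pmf \<mu> u + t * pmf \<nu> u" for u
    unfolding \<kappa>_def pmf_bind using st t by simp
  have \<kappa>: "set_pmf \<kappa> \<subseteq> A" by (auto simp: \<kappa>_def A_def split: if_splits)
  have "barycenter \<kappa> = s *\<^sub>R x + t *\<^sub>R y"
    unfolding \<mu>(3) \<nu>(3) barycenter_eq[OF A(1) \<kappa>] barycenter_eq[OF A(1,2)] barycenter_eq[OF A(1,3)] pmf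
    by (simp add: scaleR_add_left sum.distrib scaleR_sum_right)
  moreover have "\<epsilon> \<le> measure_pmf.expectation \<kappa> (\<lambda>u. norm (u - e))" for e
  proof -
    have "\<epsilon> = s * \<epsilon> + t * \<epsilon>" using st by (metis distrib_right mult_1)
    also have "\<dots> \<le> s * measure_pmf.expectation \<mu> (\<lambda>u. norm (u - e)) + t * measure_pmf.expectation \<nu> (\<lambda>u. norm (u - e))"
      using st \<mu>(4) \<nu>(4) by (intro add_mono mult_left_mono) auto
    also have "\<dots> = measure_pmf.expectation \<kappa> (\<lambda>u. norm (u - e))"
      unfolding expectation_eq_sum[OF A(1) \<kappa>] expectation_eq_sum[OF A(1,2)] expectation_eq_sum[OF A(1,3)] pmf
      by (simp add: distrib_right sum.distrib sum_distrib_left mult.assoc)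
    finally show ?thesis .
  qed
  ultimately show "s *\<^sub>R x + t *\<^sub>R y \<in> spread_means \<epsilon> C"
    using A \<kappa> finite_subset[OF \<kappa> A(1)] by (auto simp: spread_means_def intro!: exI[of _ \<kappa>])
qed

lemma spread_means_uminus:
  assumes "\<And>x. x \<in> C \<Longrightarrow> - x \<in> C" "x \<in> spread_means \<epsilon> C" shows "- x \<in> spread_means \<epsilon> C"
proof -
  obtain \<mu> where \<mu>: "finite (set_pmf \<mu>)" "set_pmf \<mu> \<subseteq> C" "x = barycenter \<mu>"
    "\<And>e. \<epsilon> \<le> measure_pmf.expectation \<mu> (\<lambda>u. norm (u - e))"
    using assms by (auto simp: spread_means_def)
  define \<nu> where "\<nu> = map_pmf uminus \<mu>"
  have "barycenter \<nu> = - x"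
  proof -
    have "barycenter \<nu> = (\<Sum>u\<in>set_pmf \<mu>. pmf \<nu> (- u) *\<^sub>R (- u))"
      unfolding barycenter_def \<nu>_def set_map_pmf by (rule sum.reindex_cong[of uminus]) auto
    moreover have "pmf \<nu> (- u) = pmf \<mu> u" for u unfolding \<nu>_def by (rule pmf_map_inj') (auto simp: inj_def)
    ultimately show ?thesis using \<mu>(3) by (simp add: barycenter_def sum_negf)
  qed
  moreover have "\<epsilon> \<le> measure_pmf.expectation \<nu> (\<lambda>u. norm (u - e))" for e
    using \<mu>(4)[of "- e"] by (simp add: \<nu>_def norm_minus_commute add.commute)
  moreover have "finite (set_pmf \<nu>)" "set_pmf \<nu> \<subseteq> C" using \<mu>(1,2) assms(1) by (auto simp: \<nu>_def)
  ultimately show ?thesis unfolding spread_means_def by (intro CollectI exI[of _ \<nu>]) auto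
qed

text \<open>For the uniform measure on two points the mean distance to any \<open>e\<close> is at
  least half their distance, by the triangle inequality. The case \<open>x = y\<close> can only
  occur for nonpositive \<epsilon>.\<close>

lemma midpoint_in_spread_means:
  assumes "x \<in> C" "y \<in> C" "2 * \<epsilon> \<le> norm (x - y)"
  shows "(1/2) *\<^sub>R (x + y) \<in> spread_means \<epsilon> C"
proof (cases "x = y")
  case False
  define \<mu> where "\<mu> = pmf_of_set {x, y}"
  have set: "set_pmf \<mu> = {x, y}" by (simp add: \<mu>_def)
  have p: "pmf \<mu> x = 1/2" "pmf \<mu> y = 1/2" using False by (auto simp: \<mu>_def)
  have "barycenter \<mu> = (1/2) *\<^sub>R (x + y)"
    using False by (simp add: barycenter_def set p scaleR_add_right)
  moreover have "\<epsilon> \<le> measure_pmf.expectation \<mu> (\<lambda>u. norm (u - e))" for e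
  proof -
    have "norm (x - y) \<le> norm (x - e) + norm (y - e)"
      using norm_triangle_ineq4[of "x - e" "y - e"] by simp
    then show ?thesis
      using False assms(3) by (subst expectation_eq_sum[of "{x, y}"]) (auto simp: set p)
  qed
  ultimately show ?thesis using assms set by (auto simp: spread_means_def intro!: exI[of _ \<mu>])
next
  case True
  define \<mu> where "\<mu> = return_pmf x"
  have "\<epsilon> \<le> 0" using assms True by simp
  then have "\<epsilon> \<le> measure_pmf.expectation \<mu> (\<lambda>u. norm (u - e))" for e
    by (simp add: \<mu>_def order_trans[OF _ norm_ge_zero])
  then show ?thesis using assms True
    by (auto simp: spread_means_def \<mu>_def barycenter_def scaleR_2[symmetric] simp del: scaleR_2 intro!: exI[of _ \<mu>])
qed

lemma convex_on_infdist:
  fixes C :: "'v::real_normed_vector set"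
  assumes C: "convex C" "C \<noteq> {}" shows "convex_on UNIV (\<lambda>x. infdist x C)"
proof (rule convex_onI)
  fix t :: real and x y :: 'v assume t: "0 < t" "t < 1"
  show "infdist ((1 - t) *\<^sub>R x + t *\<^sub>R y) C \<le> (1 - t) * infdist x C + t * infdist y C"
  proof (rule field_le_epsilon)
    fix e :: real assume e: "0 < e"
    obtain x' where x': "x' \<in> C" "dist x x' < infdist x C + e"
      using infdist_notempty[OF C(2)] cInf_lessD[of "dist x ` C" "infdist x C + e"] C(2) e by auto
    obtain y' where y': "y' \<in> C" "dist y y' < infdist y C + e"
      using infdist_notempty[OF C(2)] cInf_lessD[of "dist y ` C" "infdist y C + e"] C(2) e by auto
    have "(1 - t) *\<^sub>R x' + t *\<^sub>R y' \<in> C" using C(1) x' y' t by (intro convexD) auto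
    then have "infdist ((1 - t) *\<^sub>R x + t *\<^sub>R y) C \<le> dist ((1 - t) *\<^sub>R x + t *\<^sub>R y) ((1 - t) *\<^sub>R x' + t *\<^sub>R y')"
      by (rule infdist_le)
    also have "\<dots> = norm ((1 - t) *\<^sub>R (x - x') + t *\<^sub>R (y - y'))"
      by (simp add: dist_norm algebra_simps)
    also have "\<dots> \<le> (1 - t) * dist x x' + t * dist y y'"
      using norm_triangle_ineq[of "(1 - t) *\<^sub>R (x - x')" "t *\<^sub>R (y - y')"] t by (simp add: dist_norm)
    also have "\<dots> \<le> (1 - t) * (infdist x C + e) + t * (infdist y C + e)"
      using x' y' t by (intro add_mono mult_left_mono) auto
    finally show "infdist ((1 - t) *\<^sub>R x + t *\<^sub>R y) C \<le> (1 - t) * infdist x C + t * infdist y C + e"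
      by (simp add: algebra_simps)
  qed
qed simp

text \<open>The iterated derived sets: a point of the \<open>n\<close>-th one is the root of an
  \<epsilon>-bush of height \<open>n\<close> in the unit ball, that is, the starting value of a
  spread martingale with \<open>n\<close> steps.\<close>

definition bush_roots :: "real \<Rightarrow> nat \<Rightarrow> 'v::real_normed_vector set" where
  "bush_roots \<epsilon> n = (spread_means \<epsilon> ^^ n) (cball 0 1)"

lemma bush_roots_0: "bush_roots \<epsilon> 0 = cball 0 1"
  and bush_roots_Suc: "bush_roots \<epsilon> (Suc n) = spread_means \<epsilon> (bush_roots \<epsilon> n)"
  by (simp_all add: bush_roots_def)

lemma convex_bush_roots: "convex (bush_roots \<epsilon> n)"
  by (cases n) (auto simp: bush_roots_0 bush_roots_Suc convex_spread_means)

lemma bush_roots_uminus: "x \<in> bush_roots \<epsilon> n \<Longrightarrow> - x \<in> bush_roots \<epsilon> n"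
  by (induction n arbitrary: x) (auto simp: bush_roots_0 bush_roots_Suc intro: spread_means_uminus)

lemma zero_in_bush_roots:
  assumes "bush_roots \<epsilon> n \<noteq> ({} :: 'v::real_normed_vector set)"
  shows "(0 :: 'v) \<in> bush_roots \<epsilon> n"
proof -
  obtain x :: 'v where x: "x \<in> bush_roots \<epsilon> n" using assms by auto
  have "(1/2) *\<^sub>R x + (1/2) *\<^sub>R (- x) \<in> bush_roots \<epsilon> n"
    by (rule convexD[OF convex_bush_roots x bush_roots_uminus[OF x]]) auto
  then show ?thesis by simp
qed

lemma bush_roots_mono: "bush_roots \<epsilon> (Suc n) \<subseteq> bush_roots \<epsilon> n"
  by (simp add: bush_roots_Suc spread_means_subset convex_bush_roots)

text \<open>As long as \<open>x\<close> and \<open>y\<close> are \<open>\<epsilon>\<close>-close to the \<open>i\<close>-th set, their midpoint is as close to the next set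
  as they are on average to the \<open>i\<close>-th one; these gains telescope.\<close>

lemma sum_infdist_midpoint:
  fixes x y :: "'v::real_normed_vector"
  assumes m: "bush_roots \<epsilon> m = ({} :: 'v set)" "\<And>i. i < m \<Longrightarrow> bush_roots \<epsilon> i \<noteq> ({} :: 'v set)"
    and xy: "norm x \<le> 1" "norm y \<le> 1" "4 * \<epsilon> \<le> norm (x - y)" and \<epsilon>: "0 < \<epsilon>"
  shows "(\<Sum>i<m. infdist ((1/2) *\<^sub>R (x + y)) (bush_roots \<epsilon> i)) \<le>
    ((\<Sum>i<m. infdist x (bush_roots \<epsilon> i)) + (\<Sum>i<m. infdist y (bush_roots \<epsilon> i))) / 2 - \<epsilon> / 2"
proof -
  let ?C = "\<lambda>i. bush_roots \<epsilon> i :: 'v set"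
  define d where "d i = infdist ((1/2) *\<^sub>R (x + y)) (?C i)" for i
  define s where "s i = (infdist x (?C i) + infdist y (?C i)) / 2" for i
  define P where "P i \<longleftrightarrow> infdist x (?C i) < \<epsilon> \<and> infdist y (?C i) < \<epsilon>" for i
  have conv: "d i \<le> s i" if "i < m" for i
    using convex_onD[OF convex_on_infdist[OF convex_bush_roots m(2)[OF that]], of "1/2" x y]
    by (simp add: d_def s_def scaleR_add_right field_simps)
  have near: "\<exists>z. z \<in> ?C (Suc i) \<and> dist ((1/2) *\<^sub>R (x + y)) z \<le> s i + e"
    if i: "i < m" "P i" and e: "0 < e" for i e
  proof -
    \<comment> \<open>Small enough to keep the approximants \<open>x'\<close> and \<open>y'\<close>
      within \<epsilon> of \<open>x\<close> and \<open>y\<close>, so that out of the distance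
      \<open>4 * \<epsilon>\<close> at least \<open>2 * \<epsilon>\<close> remains for
      \<open>midpoint_in_spread_means\<close>.\<close>
    define e' where "e' = min e (min (\<epsilon> - infdist x (?C i)) (\<epsilon> - infdist y (?C i)))"
    have e': "0 < e'" "e' \<le> e" using i e by (auto simp: e'_def P_def)
    obtain x' where x': "x' \<in> ?C i" "dist x x' < infdist x (?C i) + e'"
      using infdist_notempty[OF m(2)[OF i(1)]] cInf_lessD[of "dist x ` ?C i" "infdist x (?C i) + e'"] m(2)[OF i(1)] e' by auto
    obtain y' where y': "y' \<in> ?C i" "dist y y' < infdist y (?C i) + e'"
      using infdist_notempty[OF m(2)[OF i(1)]] cInf_lessD[of "dist y ` ?C i" "infdist y (?C i) + e'"] m(2)[OF i(1)] e' by auto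
    have "norm (x - y) \<le> dist x x' + norm (x' - y') + dist y y'"
      using norm_triangle_ineq[of "x - x'" "x' - y"] norm_triangle_ineq[of "x' - y'" "y' - y"]
      by (simp add: dist_norm norm_minus_commute)
    moreover have "dist x x' < \<epsilon>" "dist y y' < \<epsilon>" using x'(2) y'(2) by (auto simp: e'_def)
    ultimately have "(1/2) *\<^sub>R (x' + y') \<in> ?C (Suc i)"
      unfolding bush_roots_Suc using x' y' xy by (intro midpoint_in_spread_means) auto
    moreover have "dist ((1/2) *\<^sub>R (x + y)) ((1/2) *\<^sub>R (x' + y')) \<le> s i + e"
    proof -
      have "dist ((1/2) *\<^sub>R (x + y)) ((1/2) *\<^sub>R (x' + y')) = norm ((1/2) *\<^sub>R ((x - x') + (y - y')))"
        unfolding dist_norm by (simp add: algebra_simps)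
      also have "\<dots> \<le> (dist x x' + dist y y') / 2"
        using norm_triangle_ineq[of "x - x'" "y - y'"] by (simp add: dist_norm)
      finally show ?thesis using x' y' e' by (simp add: s_def field_simps)
    qed
    ultimately show ?thesis by blast
  qed
  have gain: "d (Suc i) \<le> s i" if "i < m" "P i" for i
  proof (rule field_le_epsilon)
    fix e :: real assume "0 < e"
    then show "d (Suc i) \<le> s i + e" using near[OF that] infdist_le2 unfolding d_def by blast
  qed
  have "m \<noteq> 0" using m by (auto simp: bush_roots_0 intro!: gr0I)
  \<comment> \<open>If both points stayed close to every set up to the last nonempty one, their
    midpoint would be close to a point of the empty set \<open>?C m\<close>.\<close>
  have "\<exists>j<m. \<not> P j"
  proof (rule ccontr)
    assume "\<not> ?thesis"
    then have "P (m - 1)" "m - 1 < m" using \<open>m \<noteq> 0\<close> by auto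
    then show False using near[of "m - 1" 1] m(1) \<open>m \<noteq> 0\<close> by simp
  qed
  define j where "j = (LEAST j. j < m \<and> \<not> P j)"
  have j: "j < m" "\<not> P j" using LeastI_ex[OF \<open>\<exists>j<m. \<not> P j\<close>] by (auto simp: j_def)
  have before: "P i" if "i < j" for i
    using not_less_Least[of i "\<lambda>j. j < m \<and> \<not> P j"] that j unfolding j_def[symmetric] by auto
  have "\<epsilon> / 2 \<le> s j" using j(2) infdist_nonneg[of x "?C j"] infdist_nonneg[of y "?C j"] by (auto simp: P_def s_def)
  have "d 0 = 0"
  proof -
    have "norm (x + y) \<le> 2" using xy norm_triangle_ineq[of x y] by linarith
    then show ?thesis by (simp add: d_def bush_roots_0)
  qed
  have split: "sum f {..<m} = sum f {..<j} + f j + sum f {Suc j..<m}" for f :: "nat \<Rightarrow> real"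
  proof -
    have "sum f {0..<m} = sum f {0..<j} + sum f {j..<m}"
      using j by (simp add: sum.atLeastLessThan_concat)
    then show ?thesis using j by (simp add: sum.atLeast_Suc_lessThan lessThan_atLeast0)
  qed
  \<comment> \<open>The shift by one index pays off: \<open>d 0 = 0\<close> and
    \<open>d (Suc i) \<le> s i\<close> bound \<open>j + 1\<close> terms by \<open>j\<close> terms,
    so that \<open>s j\<close>, which is at least \<open>\<epsilon> / 2\<close>, is saved.\<close>
  have "sum d {..<Suc j} \<le> sum s {..<j}"
    unfolding sum.lessThan_Suc_shift \<open>d 0 = 0\<close> using j by simp (intro sum_mono gain before, auto)
  then have "sum d {..<m} \<le> sum s {..<m} - s j"
    using sum_mono[of "{Suc j..<m}" d s] conv by (simp add: split)
  also have "sum s {..<m} = ((\<Sum>i<m. infdist x (?C i)) + (\<Sum>i<m. infdist y (?C i))) / 2"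
    by (simp add: s_def sum.distrib flip: sum_divide_distrib)
  finally show ?thesis using \<open>\<epsilon> / 2 \<le> s j\<close> by (simp add: d_def)
qed

text \<open>One value of \<epsilon> gives convexity at one scale only, so the functions for all
  \<open>(1/2)^k\<close> are added up; each summand is convex, so none destroys the gain of
  another.\<close>

theorem superreflexive_if_no_bushes:
  assumes "\<And>\<epsilon>. 0 < \<epsilon> \<Longrightarrow> \<exists>n. bush_roots \<epsilon> n = ({} :: 'v::real_normed_vector set)"
  shows "superreflexive TYPE('v)"
proof -
  define C where "C k i = (bush_roots ((1/2)^k) i :: 'v set)" for k i
  define m where "m k = (LEAST n. C k n = {})" for k
  have m: "C k (m k) = {}" for k
    unfolding m_def by (rule LeastI_ex) (use assms[of "(1/2)^k"] in \<open>simp add: C_def\<close>)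
  have ne: "C k i \<noteq> {}" if "i < m k" for k i using not_less_Least that unfolding m_def by blast
  have m_pos: "0 < m k" for k using m[of k] by (cases "m k") (auto simp: C_def bush_roots_0)
  have zero: "0 \<in> C k i" if "i < m k" for k i
    using zero_in_bush_roots ne[OF that] by (simp add: C_def)
  \<comment> \<open>A distance function is 1-Lipschitz and there are \<open>m k\<close> of them, so
    these weights make \<open>t k\<close> Lipschitz with constant \<open>(1/2) ^ Suc k\<close>; the
    whole series then adds at most another norm, as \<open>\<Theta> x \<le> 2 * norm x\<close>
    requires.\<close>
  define c where "c k = (1/2) ^ Suc k / real (m k)" for k
  have c: "0 < c k" "c k * real (m k) = (1/2) ^ Suc k" for k using m_pos[of k] by (auto simp: c_def)
  define \<psi> where "\<psi> k x = (\<Sum>i<m k. infdist x (C k i))" for k x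
  define t where "t k x = c k * \<psi> k x" for k x
  have half: "(\<lambda>k. (1/2) ^ Suc k * r) sums r" for r :: real
    using sums_mult2[OF power_half_series, of r] by simp
  have \<psi>_lip: "\<psi> k x \<le> \<psi> k y + real (m k) * norm (x - y)" for k x y
  proof -
    have "\<psi> k x \<le> (\<Sum>i<m k. infdist y (C k i) + norm (x - y))"
      unfolding \<psi>_def by (intro sum_mono) (metis infdist_triangle dist_norm)
    then show ?thesis by (simp add: \<psi>_def sum.distrib)
  qed
  have t_lip: "t k x \<le> t k y + (1/2) ^ Suc k * norm (x - y)" for k x y
  proof -
    have "t k x \<le> c k * (\<psi> k y + real (m k) * norm (x - y))"
      unfolding t_def using \<psi>_lip c(1) by (intro mult_left_mono) (auto simp: less_imp_le)
    also have "\<dots> = t k y + (1/2) ^ Suc k * norm (x - y)"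
      unfolding t_def distrib_left mult.assoc[symmetric] c(2) ..
    finally show ?thesis .
  qed
  have t0: "t k 0 = 0" for k using zero by (simp add: t_def \<psi>_def)
  have t_nonneg: "0 \<le> t k x" for k x
    using c(1)[of k] by (auto simp: t_def \<psi>_def infdist_nonneg intro!: mult_nonneg_nonneg sum_nonneg)
  have t_le: "t k x \<le> (1/2) ^ Suc k * norm x" for k x using t_lip[of k x 0] t0 by simp
  have t_summable: "summable (\<lambda>k. t k x)" for x
    by (rule summable_comparison_test'[OF sums_summable[OF half[of "norm x"]], of 0])
      (use t_nonneg t_le in auto)
  define \<Theta> where "\<Theta> x = norm x + (suminf (\<lambda>k. t k x))" for x
  have \<psi>_convex: "convex_on UNIV (\<psi> k)" for k
  proof (rule convex_onI)
    fix s :: real and x y assume "0 < s" "s < 1"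
    then have "\<psi> k ((1 - s) *\<^sub>R x + s *\<^sub>R y) \<le> (\<Sum>i<m k. (1 - s) * infdist x (C k i) + s * infdist y (C k i))"
      unfolding \<psi>_def
    proof (intro sum_mono)
      fix i assume "i \<in> {..<m k}"
      then have "convex_on UNIV (\<lambda>x. infdist x (C k i))"
        using convex_on_infdist[of "C k i"] ne[of i k] convex_bush_roots[of "(1/2)^k" i]
        unfolding C_def by blast
      then show "infdist ((1 - s) *\<^sub>R x + s *\<^sub>R y) (C k i) \<le> (1 - s) * infdist x (C k i) + s * infdist y (C k i)"
        using \<open>0 < s\<close> \<open>s < 1\<close> by (intro convex_onD) auto
    qed
    then show "\<psi> k ((1 - s) *\<^sub>R x + s *\<^sub>R y) \<le> (1 - s) * \<psi> k x + s * \<psi> k y"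
      by (simp add: \<psi>_def sum.distrib sum_distrib_left)
  qed simp
  have t_convex: "convex_on UNIV (t k)" for k
    unfolding t_def[abs_def] by (rule convex_on_cmul[OF less_imp_le[OF c(1)] \<psi>_convex])
  show ?thesis
  proof (rule superreflexive_from_convex_function[of \<Theta>])
    show "convex_on UNIV \<Theta>"
    proof (rule convex_onI)
      fix s :: real and x y :: 'v assume s: "0 < s" "s < 1"
      have sm: "summable (\<lambda>k. (1 - s) * t k x + s * t k y)"
        by (intro summable_add summable_mult t_summable)
      have "(suminf (\<lambda>k. t k ((1 - s) *\<^sub>R x + s *\<^sub>R y))) \<le> (suminf (\<lambda>k. (1 - s) * t k x + s * t k y))"
        by (rule suminf_le[OF convex_onD[OF t_convex] t_summable sm]) (use s in auto)
      also have "\<dots> = (1 - s) * (suminf (\<lambda>k. t k x)) + s * (suminf (\<lambda>k. t k y))"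
        using t_summable by (simp add: suminf_add[symmetric] suminf_mult summable_mult)
      finally show "\<Theta> ((1 - s) *\<^sub>R x + s *\<^sub>R y) \<le> (1 - s) * \<Theta> x + s * \<Theta> y"
        using norm_triangle_ineq[of "(1 - s) *\<^sub>R x" "s *\<^sub>R y"] s by (simp add: \<Theta>_def distrib_left)
    qed simp
    have inf_even: "infdist (- x) (C k i) \<le> infdist x (C k i)" if "i < m k" for x k i
    proof -
      have "infdist (- x) (C k i) \<le> dist x z" if "z \<in> C k i" for z
        using infdist_le[OF bush_roots_uminus[OF that[unfolded C_def]], of "- x"]
        by (simp add: C_def dist_norm norm_minus_commute)
      then show ?thesis unfolding infdist_notempty[OF ne[OF that]] 
        by (intro cINF_greatest[OF ne[OF \<open>i < m k\<close>]]) (simp add: infdist_notempty[OF ne[OF \<open>i < m k\<close>]])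
    qed
    have "infdist (- x) (C k i) = infdist x (C k i)" if "i < m k" for x k i
      using inf_even[OF that, of x] inf_even[OF that, of "- x"] by simp
    then have "t k (- x) = t k x" for k x by (simp add: t_def \<psi>_def)
    then show "\<Theta> (- x) = \<Theta> x" for x by (simp add: \<Theta>_def)
    show "norm x \<le> \<Theta> x" for x
      unfolding \<Theta>_def using suminf_nonneg[OF t_summable t_nonneg] by simp
    show lip: "\<Theta> x \<le> \<Theta> y + 2 * norm (x - y)" for x y
    proof -
      have "(suminf (\<lambda>k. t k x)) \<le> (suminf (\<lambda>k. t k y + (1/2) ^ Suc k * norm (x - y)))"
        by (rule suminf_le[OF t_lip t_summable]) (intro summable_add t_summable sums_summable[OF half])
      also have "\<dots> = (suminf (\<lambda>k. t k y)) + norm (x - y)"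
        using suminf_add[OF t_summable sums_summable[OF half]] sums_unique[OF half[of "norm (x - y)"]] by metis
      finally show ?thesis using norm_triangle_ineq2[of x y] by (simp add: \<Theta>_def)
    qed
    have "\<Theta> 0 = 0" by (simp add: \<Theta>_def t0)
    then show "\<Theta> x \<le> 2 * norm x" for x using lip[of x 0] by simp
    fix \<epsilon> :: real assume "0 < \<epsilon>"
    \<comment> \<open>The factor 4 is the separation that \<open>sum_infdist_midpoint\<close> asks
      for.\<close>
    then obtain k where k: "(1/2) ^ k < \<epsilon> / 4" using real_arch_pow_inv[of "\<epsilon> / 4" "1/2"] by auto
    define \<delta> where "\<delta> = c k * ((1/2) ^ k / 2)"
    have \<delta>: "0 < \<delta>" using c(1) by (simp add: \<delta>_def)
    have "\<Theta> ((1/2) *\<^sub>R (x + y)) \<le> 1 - \<delta>" if "\<Theta> x \<le> 1" "\<Theta> y \<le> 1" "\<epsilon> \<le> norm (x - y)" for x y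
    proof -
      have n1: "norm x \<le> 1" "norm y \<le> 1"
        using that \<open>\<And>x. norm x \<le> \<Theta> x\<close>[of x] \<open>\<And>x. norm x \<le> \<Theta> x\<close>[of y] by auto
      have "\<psi> k ((1/2) *\<^sub>R (x + y)) \<le> (\<psi> k x + \<psi> k y) / 2 - (1/2) ^ k / 2"
        unfolding \<psi>_def C_def using m ne n1 k that
        by (intro sum_infdist_midpoint) (auto simp: C_def)
      then have "c k * \<psi> k ((1/2) *\<^sub>R (x + y)) \<le> c k * ((\<psi> k x + \<psi> k y) / 2 - (1/2) ^ k / 2)"
        using c(1) by (intro mult_left_mono) (auto simp: less_imp_le)
      then have tk: "t k ((1/2) *\<^sub>R (x + y)) + \<delta> \<le> (1/2) * (t k x + t k y)"
        by (simp add: t_def \<delta>_def algebra_simps)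
      have tj: "t j ((1/2) *\<^sub>R (x + y)) \<le> (1/2) * (t j x + t j y)" for j
        using convex_onD[OF t_convex, of "1/2" x y j] by (simp add: scaleR_add_right algebra_simps)
      have single: "(\<lambda>j. if j = k then \<delta> else 0) sums \<delta>" using sums_single[of k "\<lambda>_. \<delta>"] by simp
      have "(suminf (\<lambda>j. t j ((1/2) *\<^sub>R (x + y)))) + \<delta> = (suminf (\<lambda>j. t j ((1/2) *\<^sub>R (x + y)) + (if j = k then \<delta> else 0)))"
        using suminf_add[OF t_summable sums_summable[OF single]] sums_unique[OF single] by simp
      also have "\<dots> \<le> (suminf (\<lambda>j. (1/2) * (t j x + t j y)))"
        by (rule suminf_le) (use tk tj sums_summable[OF single] t_summable in \<open>auto intro!: summable_add summable_mult\<close>)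
      also have "\<dots> = (1/2) * ((suminf (\<lambda>j. t j x)) + (suminf (\<lambda>j. t j y)))"
        using t_summable by (subst suminf_mult) (auto simp: suminf_add intro!: summable_add)
      finally show ?thesis
        using that norm_triangle_ineq[of x y] unfolding \<Theta>_def by simp
    qed
    then show "\<exists>\<delta>>0. \<forall>x y. \<Theta> x \<le> 1 \<and> \<Theta> y \<le> 1 \<and> \<epsilon> \<le> norm (x - y) \<longrightarrow> \<Theta> ((1/2) *\<^sub>R (x + y)) \<le> 1 - \<delta>"
      using \<delta> by blast
  qed
qed

section \<open>Spread martingales\<close>

abbreviation expect :: "'a pmf \<Rightarrow> ('a \<Rightarrow> real) \<Rightarrow> real" where
  "expect P f \<equiv> measure_pmf.expectation P f"

lemma expect_mono:
  assumes "finite (set_pmf P)" "\<And>w. w \<in> set_pmf P \<Longrightarrow> f w \<le> g w"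
  shows "expect P f \<le> expect P g"
  by (rule integral_mono_AE)
    (use assms in \<open>auto intro: integrable_measure_pmf_finite simp: AE_measure_pmf_iff\<close>)

lemma expect_cong:
  assumes "\<And>w. w \<in> set_pmf P \<Longrightarrow> f w = g w"
  shows "expect P f = expect P g"
  by (rule integral_cong_AE) (use assms in \<open>auto simp: AE_measure_pmf_iff\<close>)

lemma expect_add:
  assumes "finite (set_pmf P)" shows "expect P (\<lambda>w. f w + g w) = expect P f + expect P g"
  by (intro Bochner_Integration.integral_add integrable_measure_pmf_finite assms)

lemma expect_diff:
  assumes "finite (set_pmf P)" shows "expect P (\<lambda>w. f w - g w) = expect P f - expect P g"
  by (intro Bochner_Integration.integral_diff integrable_measure_pmf_finite assms)

lemma expect_sum:
  assumes "finite (set_pmf P)" shows "expect P (\<lambda>w. \<Sum>i\<in>I. f i w) = (\<Sum>i\<in>I. expect P (f i))"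
  by (intro Bochner_Integration.integral_sum integrable_measure_pmf_finite assms)

lemma expect_less_imp_ex:
  assumes "finite (set_pmf P)" "expect P f < c"
  obtains w where "w \<in> set_pmf P" "f w < c"
proof -
  have "\<exists>w\<in>set_pmf P. f w < c"
  proof (rule ccontr)
    assume "\<not> ?thesis"
    then have "expect P (\<lambda>_. c) \<le> expect P f" by (intro expect_mono assms) auto
    then show False using assms by simp
  qed
  then show thesis using that by blast
qed

text \<open>Conditional expectations are avoided. The martingale property is the conditional Jensen
  inequality, tested on convex functions \<open>\<Psi> h\<close> that depend on the history
  \<open>h\<close>; a linear function and its negative give back equality. Spread is tested on
  events \<open>A\<close> and centres \<open>e\<close> that depend on the history.\<close>

definition bush_path :: "real \<Rightarrow> nat \<Rightarrow> 'v::real_normed_vector list pmf \<Rightarrow> bool" where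
  "bush_path \<epsilon> n P \<longleftrightarrow> finite (set_pmf P) \<and>
     (\<forall>w\<in>set_pmf P. length w = Suc n \<and> (\<forall>v\<in>set w. norm v \<le> 1)) \<and>
     (\<forall>i<n. \<forall>\<Psi>. (\<forall>h. convex_on UNIV (\<Psi> h)) \<longrightarrow>
        expect P (\<lambda>w. \<Psi> (take (Suc i) w) (w ! i)) \<le> expect P (\<lambda>w. \<Psi> (take (Suc i) w) (w ! Suc i))) \<and>
     (\<forall>i<n. \<forall>A e. \<epsilon> * expect P (\<lambda>w. of_bool (A (take (Suc i) w))) \<le>
        expect P (\<lambda>w. of_bool (A (take (Suc i) w)) * norm (w ! Suc i - e (take (Suc i) w))))"

lemma bush_roots_norm: "x \<in> bush_roots \<epsilon> n \<Longrightarrow> norm x \<le> 1"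
proof (induction n arbitrary: x)
  case (Suc n)
  then show ?case using bush_roots_mono by blast
qed (simp add: bush_roots_0)

text \<open>The path starts at \<open>x\<close>, draws \<open>u\<close> from the measure witnessing
  that \<open>x\<close> is a spread mean, and continues with a path measure for \<open>u\<close>.
  The conditions at time 0 are Jensen's inequality and the spread of \<mu>; the later ones are
  inherited, with \<open>x\<close> prepended to the history.\<close>

lemma bush_path_exists:
  fixes x :: "'v::real_normed_vector"
  assumes "x \<in> bush_roots \<epsilon> n"
  shows "\<exists>P. bush_path \<epsilon> n P \<and> (\<forall>w\<in>set_pmf P. w ! 0 = x)"
  using assms
proof (induction n arbitrary: x)
  case 0
  then show ?case
    by (intro exI[of _ "return_pmf [x]"]) (simp add: bush_path_def bush_roots_0)
next
  case (Suc n)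
  from Suc.prems obtain \<mu> where \<mu>: "finite (set_pmf \<mu>)" "set_pmf \<mu> \<subseteq> bush_roots \<epsilon> n" "x = barycenter \<mu>"
    "\<And>e. \<epsilon> \<le> expect \<mu> (\<lambda>u. norm (u - e))"
    unfolding bush_roots_Suc spread_means_def by blast
  define A where "A = set_pmf \<mu>"
  have A: "finite A" using \<mu> by (simp add: A_def)
  have "\<forall>u\<in>A. \<exists>P. bush_path \<epsilon> n P \<and> (\<forall>w\<in>set_pmf P. w ! 0 = u)"
    using Suc.IH \<mu>(2) by (auto simp: A_def)
  then obtain Q where Q: "\<And>u. u \<in> A \<Longrightarrow> bush_path \<epsilon> n (Q u)" "\<And>u w. u \<in> A \<Longrightarrow> w \<in> set_pmf (Q u) \<Longrightarrow> w ! 0 = u"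
    by metis
  have Qfin: "finite (set_pmf (Q u))" if "u \<in> A" for u using Q(1)[OF that] by (simp add: bush_path_def)
  define P where "P = \<mu> \<bind> (\<lambda>u. map_pmf ((#) x) (Q u))"
  have setP: "set_pmf P = (\<Union>u\<in>A. (#) x ` set_pmf (Q u))" by (simp add: P_def A_def)
  have E: "expect P \<phi> = (\<Sum>u\<in>A. pmf \<mu> u * expect (Q u) (\<lambda>w. \<phi> (x # w)))" for \<phi>
    unfolding P_def by (subst pmf_expectation_bind[OF A]) (auto simp: A_def[symmetric] Qfin)
  have pmf1: "(\<Sum>u\<in>A. pmf \<mu> u) = 1" unfolding A_def by (rule sum_pmf_eq_1) (use \<mu> in auto)
  have x: "x = (\<Sum>u\<in>A. pmf \<mu> u *\<^sub>R u)" by (simp add: \<mu>(3) barycenter_def A_def)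
  have mart: "expect P (\<lambda>w. \<Psi> (take (Suc i) w) (w ! i)) \<le> expect P (\<lambda>w. \<Psi> (take (Suc i) w) (w ! Suc i))"
    if i: "i < Suc n" and \<Psi>: "\<forall>h. convex_on UNIV (\<Psi> h)" for i \<Psi>
  proof (cases i)
    case 0
    have "expect P (\<lambda>w. \<Psi> (take (Suc i) w) (w ! i)) = (\<Sum>u\<in>A. pmf \<mu> u * \<Psi> [x] x)"
      unfolding E 0 by simp
    also have "\<dots> = \<Psi> [x] (\<Sum>u\<in>A. pmf \<mu> u *\<^sub>R u)"
      unfolding sum_distrib_right[symmetric] pmf1 using x by simp
    also have "\<dots> \<le> (\<Sum>u\<in>A. pmf \<mu> u * \<Psi> [x] u)"
      by (rule convex_on_sum[of _ UNIV]) (use A \<Psi> pmf1 in \<open>auto simp: A_def set_pmf_not_empty\<close>)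
    also have "\<dots> = (\<Sum>u\<in>A. pmf \<mu> u * expect (Q u) (\<lambda>w. \<Psi> [x] (w ! 0)))"
    proof (intro sum.cong refl arg_cong2[where f = "(*)"])
      fix u assume "u \<in> A"
      then have "expect (Q u) (\<lambda>w. \<Psi> [x] (w ! 0)) = expect (Q u) (\<lambda>w. \<Psi> [x] u)"
        by (intro expect_cong) (simp add: Q(2))
      then show "\<Psi> [x] u = expect (Q u) (\<lambda>w. \<Psi> [x] (w ! 0))" by simp
    qed
    also have "\<dots> = expect P (\<lambda>w. \<Psi> (take (Suc i) w) (w ! Suc i))"
      unfolding E 0 by simp
    finally show ?thesis .
  next
    case (Suc i')
    show ?thesis unfolding E Suc
    proof (intro sum_mono mult_left_mono)
      fix u assume "u \<in> A"
      then have "expect (Q u) (\<lambda>w. \<Psi> (x # take (Suc i') w) (w ! i')) \<le> expect (Q u) (\<lambda>w. \<Psi> (x # take (Suc i') w) (w ! Suc i'))"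
        using Q(1)[of u] i \<Psi> Suc unfolding bush_path_def by (auto dest!: spec[of _ "\<lambda>h. \<Psi> (x # h)"])
      then show "expect (Q u) (\<lambda>w. \<Psi> (take (Suc (Suc i')) (x # w)) ((x # w) ! Suc i'))
        \<le> expect (Q u) (\<lambda>w. \<Psi> (take (Suc (Suc i')) (x # w)) ((x # w) ! Suc (Suc i')))" by simp
    qed simp
  qed
  have sep: "\<epsilon> * expect P (\<lambda>w. of_bool (B (take (Suc i) w))) \<le>
        expect P (\<lambda>w. of_bool (B (take (Suc i) w)) * norm (w ! Suc i - e (take (Suc i) w)))"
    if i: "i < Suc n" for i B e
  proof (cases i)
    case 0
    have "expect (Q u) (\<lambda>w. norm (w ! 0 - e [x])) = norm (u - e [x])" if "u \<in> A" for u
    proof -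
      have "expect (Q u) (\<lambda>w. norm (w ! 0 - e [x])) = expect (Q u) (\<lambda>w. norm (u - e [x]))"
        by (intro expect_cong) (simp add: Q(2)[OF that])
      then show ?thesis by simp
    qed
    then have "expect P (\<lambda>w. of_bool (B (take (Suc i) w)) * norm (w ! Suc i - e (take (Suc i) w)))
        = (\<Sum>u\<in>A. pmf \<mu> u * (of_bool (B [x]) * norm (u - e [x])))"
      unfolding E 0 by simp
    also have "\<dots> = of_bool (B [x]) * expect \<mu> (\<lambda>u. norm (u - e [x]))"
      by (subst expectation_eq_sum[OF A]) (auto simp: A_def sum_distrib_left)
    also have "\<dots> \<ge> of_bool (B [x]) * \<epsilon>" by (rule mult_left_mono) (use \<mu>(4) in auto)
    moreover have "expect P (\<lambda>w. of_bool (B (take (Suc i) w))) = of_bool (B [x])"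
      unfolding E 0 by (simp add: pmf1 flip: sum_distrib_right)
    ultimately show ?thesis by (simp add: mult.commute)
  next
    case (Suc i')
    show ?thesis unfolding E Suc sum_distrib_left mult.left_commute[of \<epsilon>]
    proof (intro sum_mono mult_left_mono)
      fix u assume "u \<in> A"
      then have "\<epsilon> * expect (Q u) (\<lambda>w. of_bool (B (x # take (Suc i') w))) \<le>
        expect (Q u) (\<lambda>w. of_bool (B (x # take (Suc i') w)) * norm (w ! Suc i' - e (x # take (Suc i') w)))"
        using Q(1)[of u] i Suc unfolding bush_path_def
        by (auto dest!: spec[of _ "\<lambda>h. B (x # h)"] spec[of _ "\<lambda>h. e (x # h)"])
      then show "\<epsilon> * expect (Q u) (\<lambda>w. of_bool (B (take (Suc (Suc i')) (x # w)))) \<le>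
        expect (Q u) (\<lambda>w. of_bool (B (take (Suc (Suc i')) (x # w))) *
          norm ((x # w) ! Suc (Suc i') - e (take (Suc (Suc i')) (x # w))))" by simp
    qed simp
  qed
  have "norm x \<le> 1" using Suc.prems by (rule bush_roots_norm)
  then have "bush_path \<epsilon> (Suc n) P"
    unfolding bush_path_def using mart sep Qfin Q(1) A by (auto simp: setP bush_path_def)
  then show ?case by (auto simp: setP intro!: exI[of _ P])
qed

text \<open>A regularised quotient norm modulo the span of \<open>xs\<close>. Penalising the coefficients makes the relevant
  part of the span totally bounded, uniformly in \<open>xs\<close>; the price is that functionals dominated by this
  seminorm only almost vanish on \<open>xs\<close>.\<close>

definition coset_norm :: "real \<Rightarrow> 'v::real_normed_vector list \<Rightarrow> 'v \<Rightarrow> real" where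
  "coset_norm \<tau> xs v = (INF c. norm (v - (\<Sum>i<length xs. c i *\<^sub>R xs ! i)) + \<tau> * (\<Sum>i<length xs. \<bar>c i\<bar>))"

context
  fixes \<tau> :: real assumes \<tau>: "0 < \<tau>"
begin

lemma coset_norm_le: "coset_norm \<tau> xs v \<le> norm (v - (\<Sum>i<length xs. c i *\<^sub>R xs ! i)) + \<tau> * (\<Sum>i<length xs. \<bar>c i\<bar>)"
  unfolding coset_norm_def
  by (rule cINF_lower) (use \<tau> in \<open>auto intro!: bdd_belowI[of _ 0] add_nonneg_nonneg mult_nonneg_nonneg sum_nonneg\<close>)

lemma coset_norm_greatest:
  "(\<And>c. m \<le> norm (v - (\<Sum>i<length xs. c i *\<^sub>R xs ! i)) + \<tau> * (\<Sum>i<length xs. \<bar>c i\<bar>)) \<Longrightarrow> m \<le> coset_norm \<tau> xs v"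
  unfolding coset_norm_def by (rule cINF_greatest) auto

lemma coset_norm_nonneg: "0 \<le> coset_norm \<tau> xs v"
  by (rule coset_norm_greatest) (use \<tau> in \<open>auto intro!: add_nonneg_nonneg mult_nonneg_nonneg sum_nonneg\<close>)

lemma coset_norm_le_norm: "coset_norm \<tau> xs v \<le> norm v"
  using coset_norm_le[of xs v "\<lambda>_. 0"] by simp

lemma coset_norm_nth:
  assumes "i < length xs" shows "coset_norm \<tau> xs (xs ! i) \<le> \<tau>"
proof -
  have "(\<Sum>j<length xs. (if j = i then 1 else 0) *\<^sub>R xs ! j) = xs ! i"
    using assms by (simp add: if_distrib[of "\<lambda>r. r *\<^sub>R _"] cong: if_cong)
  moreover have "(\<Sum>j<length xs. \<bar>if j = i then 1 else 0 :: real\<bar>) = 1"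
    using assms by (simp add: if_distrib[of abs] cong: if_cong)
  ultimately show ?thesis using coset_norm_le[of xs "xs ! i" "\<lambda>j. if j = i then 1 else 0"] by simp
qed

lemma coset_norm_lessD:
  assumes "coset_norm \<tau> xs v < \<theta>"
  obtains c where "norm (v - (\<Sum>i<length xs. c i *\<^sub>R xs ! i)) < \<theta>" "\<tau> * (\<Sum>i<length xs. \<bar>c i\<bar>) < \<theta>"
proof -
  have "\<exists>c. norm (v - (\<Sum>i<length xs. c i *\<^sub>R xs ! i)) + \<tau> * (\<Sum>i<length xs. \<bar>c i\<bar>) < \<theta>"
    using assms coset_norm_greatest[of \<theta> v xs] by (meson not_le)
  then obtain c where c: "norm (v - (\<Sum>i<length xs. c i *\<^sub>R xs ! i)) + \<tau> * (\<Sum>i<length xs. \<bar>c i\<bar>) < \<theta>" ..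
  moreover have "0 \<le> \<tau> * (\<Sum>i<length xs. \<bar>c i\<bar>)" using \<tau> by (intro mult_nonneg_nonneg sum_nonneg) auto
  ultimately show thesis using that[of c] norm_ge_zero[of "v - (\<Sum>i<length xs. c i *\<^sub>R xs ! i)"] by linarith
qed

lemma coset_norm_add: "coset_norm \<tau> xs (v + w) \<le> coset_norm \<tau> xs v + coset_norm \<tau> xs w"
proof -
  let ?s = "\<lambda>c. \<Sum>i<length xs. c i *\<^sub>R xs ! i" and ?a = "\<lambda>c. \<tau> * (\<Sum>i<length xs. \<bar>c i\<bar>)"
  have "coset_norm \<tau> xs (v + w) - coset_norm \<tau> xs w \<le> norm (v - ?s c) + ?a c" for c
  proof -
    have "coset_norm \<tau> xs (v + w) - (norm (v - ?s c) + ?a c) \<le> coset_norm \<tau> xs w"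
    proof (rule coset_norm_greatest)
      fix d
      have "coset_norm \<tau> xs (v + w) \<le> norm (v + w - ?s (\<lambda>i. c i + d i)) + ?a (\<lambda>i. c i + d i)"
        by (rule coset_norm_le)
      also have "v + w - ?s (\<lambda>i. c i + d i) = (v - ?s c) + (w - ?s d)"
        by (simp add: scaleR_add_left sum.distrib)
      also have "norm \<dots> \<le> norm (v - ?s c) + norm (w - ?s d)" by (rule norm_triangle_ineq)
      also have "?a (\<lambda>i. c i + d i) \<le> \<tau> * (\<Sum>i<length xs. \<bar>c i\<bar> + \<bar>d i\<bar>)"
        using \<tau> by (intro mult_left_mono sum_mono) auto
      also have "\<dots> = ?a c + ?a d" by (simp add: sum.distrib distrib_left)
      finally show "coset_norm \<tau> xs (v + w) - (norm (v - ?s c) + ?a c) \<le> norm (w - ?s d) + ?a d" by simp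
    qed
    then show ?thesis by simp
  qed
  then have "coset_norm \<tau> xs (v + w) - coset_norm \<tau> xs w \<le> coset_norm \<tau> xs v" by (rule coset_norm_greatest)
  then show ?thesis by simp
qed

lemma coset_norm_scaleR_le:
  assumes "r \<noteq> 0" shows "coset_norm \<tau> xs (r *\<^sub>R v) \<le> \<bar>r\<bar> * coset_norm \<tau> xs v"
proof -
  have "coset_norm \<tau> xs (r *\<^sub>R v) / \<bar>r\<bar> \<le> coset_norm \<tau> xs v"
  proof (rule coset_norm_greatest)
    fix c
    have "coset_norm \<tau> xs (r *\<^sub>R v) \<le> norm (r *\<^sub>R v - (\<Sum>i<length xs. (r * c i) *\<^sub>R xs ! i)) + \<tau> * (\<Sum>i<length xs. \<bar>r * c i\<bar>)"
      by (rule coset_norm_le)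
    also have "r *\<^sub>R v - (\<Sum>i<length xs. (r * c i) *\<^sub>R xs ! i) = r *\<^sub>R (v - (\<Sum>i<length xs. c i *\<^sub>R xs ! i))"
      by (simp add: scaleR_diff_right scaleR_sum_right)
    also have "norm \<dots> + \<tau> * (\<Sum>i<length xs. \<bar>r * c i\<bar>)
        = \<bar>r\<bar> * (norm (v - (\<Sum>i<length xs. c i *\<^sub>R xs ! i)) + \<tau> * (\<Sum>i<length xs. \<bar>c i\<bar>))"
      by (simp only: norm_scaleR abs_mult sum_distrib_left[symmetric]) (simp add: distrib_left mult.left_commute)
    finally show "coset_norm \<tau> xs (r *\<^sub>R v) / \<bar>r\<bar>
      \<le> norm (v - (\<Sum>i<length xs. c i *\<^sub>R xs ! i)) + \<tau> * (\<Sum>i<length xs. \<bar>c i\<bar>)"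
      using assms by (simp add: field_simps)
  qed
  then show ?thesis using assms by (simp add: field_simps)
qed

lemma coset_norm_scaleR: "coset_norm \<tau> xs (r *\<^sub>R v) = \<bar>r\<bar> * coset_norm \<tau> xs v"
proof (cases "r = 0")
  case True
  then show ?thesis using coset_norm_le_norm[of xs 0] coset_norm_nonneg[of xs 0] by simp
next
  case False
  have "coset_norm \<tau> xs v \<le> \<bar>inverse r\<bar> * coset_norm \<tau> xs (r *\<^sub>R v)"
    using coset_norm_scaleR_le[of "inverse r" xs "r *\<^sub>R v"] False by simp
  then have "\<bar>r\<bar> * coset_norm \<tau> xs v \<le> coset_norm \<tau> xs (r *\<^sub>R v)" using False by (simp add: field_simps)
  then show ?thesis using coset_norm_scaleR_le[OF False, of xs v] by simp
qed

lemma sublinear_coset_norm: "sublinear (coset_norm \<tau> xs)"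
  by (auto simp: sublinear_def coset_norm_add coset_norm_scaleR)

lemma convex_on_coset_norm: "convex_on UNIV (coset_norm \<tau> xs)"
proof (rule convex_onI)
  fix t :: real and x y :: 'a assume "0 < t" "t < 1"
  then show "coset_norm \<tau> xs ((1 - t) *\<^sub>R x + t *\<^sub>R y) \<le> (1 - t) * coset_norm \<tau> xs x + t * coset_norm \<tau> xs y"
    using coset_norm_add[of xs "(1 - t) *\<^sub>R x" "t *\<^sub>R y"] by (simp add: coset_norm_scaleR)
qed simp

end

lemma convex_on_power2:
  fixes f :: "'v::real_vector \<Rightarrow> real"
  assumes f: "convex_on UNIV f" "\<And>x. 0 \<le> f x" shows "convex_on UNIV (\<lambda>x. (f x)\<^sup>2)"
proof (rule convex_onI)
  fix t :: real and x y :: 'v assume t: "0 < t" "t < 1"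
  have "(f ((1 - t) *\<^sub>R x + t *\<^sub>R y))\<^sup>2 \<le> ((1 - t) * f x + t * f y)\<^sup>2"
    using convex_onD[OF f(1), of t x y] f(2) t by (intro power_mono) auto
  also have "\<dots> = (1 - t) * (f x)\<^sup>2 + t * (f y)\<^sup>2 - t * (1 - t) * (f x - f y)\<^sup>2"
    by (simp add: power2_eq_square algebra_simps)
  also have "\<dots> \<le> (1 - t) * (f x)\<^sup>2 + t * (f y)\<^sup>2" using t by simp
  finally show "(f ((1 - t) *\<^sub>R x + t *\<^sub>R y))\<^sup>2 \<le> (1 - t) * (f x)\<^sup>2 + t * (f y)\<^sup>2" .
qed simp

text \<open>The penalty bounds the coefficients of a near-optimal combination by
  \<open>\<theta> / \<tau>\<close> in l1, so a finite grid of coefficient vectors suffices. The grid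
  depends on the number \<open>j\<close> of vectors but not on the vectors, which makes the later
  lengths independent of the martingale.\<close>

lemma coset_norm_net:
  fixes j :: nat and \<tau> \<theta> :: real
  assumes \<tau>: "0 < \<tau>" and \<theta>: "0 < \<theta>"
  shows "\<exists>Q W. finite Q \<and> 0 \<le> W \<and> (\<forall>q\<in>Q. (\<Sum>l<j. \<bar>q l\<bar>) \<le> (W :: real)) \<and>
    (\<forall>(xs :: 'v::real_normed_vector list) v. length xs = j \<longrightarrow> (\<forall>x\<in>set xs. norm x \<le> 1) \<longrightarrow>
      coset_norm \<tau> xs v < \<theta> \<longrightarrow> (\<exists>q\<in>Q. norm (v - (\<Sum>l<j. q l *\<^sub>R xs ! l)) < 2 * \<theta>))"
proof -
  \<comment> \<open>Rounding \<open>j\<close> coefficients of vectors from the unit ball to this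
    mesh costs at most \<theta> in norm.\<close>
  define h where "h = \<theta> / (real j + 1)"
  have h: "0 < h" "real j * h \<le> \<theta>" using \<theta> by (auto simp: h_def field_simps)
  define K where "K = \<lceil>\<theta> / (\<tau> * h)\<rceil> + 1"
  have K: "0 \<le> K" proof -
    have "0 \<le> \<theta> / (\<tau> * h)" using \<tau> h \<theta> by simp
    then show ?thesis unfolding K_def by linarith
  qed
  define Z where "Z = PiE {..<j} (\<lambda>_. {-K..K})"
  define Q where "Q = (\<lambda>z l. h * real_of_int (z l)) ` Z"
  define W where "W = real j * (h * real_of_int K)"
  show ?thesis
  proof (intro exI[of _ Q] exI[of _ W] conjI ballI allI impI)
    show "finite Q" unfolding Q_def Z_def by (intro finite_imageI finite_PiE) auto
    show "0 \<le> W" using h K by (simp add: W_def)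
    show "(\<Sum>l<j. \<bar>q l\<bar>) \<le> W" if q: "q \<in> Q" for q
    proof -
      obtain z where z: "z \<in> Z" "q = (\<lambda>l. h * real_of_int (z l))" using q by (auto simp: Q_def)
      have "(\<Sum>l<j. \<bar>q l\<bar>) \<le> (\<Sum>l<j. h * real_of_int K)"
      proof (rule sum_mono)
        fix l assume "l \<in> {..<j}"
        then have "z l \<in> {-K..K}" using z by (auto simp: Z_def)
        then have "\<bar>z l\<bar> \<le> K" by auto
        then have "\<bar>real_of_int (z l)\<bar> \<le> real_of_int K" by linarith
        then show "\<bar>q l\<bar> \<le> h * real_of_int K" using h by (simp add: z abs_mult)
      qed
      then show ?thesis by (simp add: W_def)
    qed
    fix xs :: "'v list" and v
    assume xs: "length xs = j" "\<forall>x\<in>set xs. norm x \<le> 1" and small: "coset_norm \<tau> xs v < \<theta>"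
    obtain c where c: "norm (v - (\<Sum>i<j. c i *\<^sub>R xs ! i)) < \<theta>" "\<tau> * (\<Sum>i<j. \<bar>c i\<bar>) < \<theta>"
      using coset_norm_lessD[OF \<tau> small] xs(1) by blast
    define z where "z = restrict (\<lambda>l. \<lfloor>c l / h\<rfloor>) {..<j}"
    have z: "z \<in> Z" unfolding Z_def
    proof (rule PiE_I)
      fix l assume l: "l \<in> {..<j}"
      have "\<bar>c l\<bar> \<le> (\<Sum>i<j. \<bar>c i\<bar>)" by (rule member_le_sum) (use l in auto)
      then have "\<tau> * \<bar>c l\<bar> < \<theta>" using c(2) \<tau> mult_left_mono[of "\<bar>c l\<bar>" "\<Sum>i<j. \<bar>c i\<bar>" \<tau>] by linarith
      then have "\<bar>c l / h\<bar> < \<theta> / (\<tau> * h)" using \<tau> h by (simp add: abs_divide field_simps)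
      then have "\<lfloor>c l / h\<rfloor> \<le> K" "- K \<le> \<lfloor>c l / h\<rfloor>" unfolding K_def by linarith+
      then show "z l \<in> {-K..K}" using l by (simp add: z_def)
    qed (simp add: z_def)
    define q where "q l = h * real_of_int (z l)" for l
    have "q \<in> Q" using z by (auto simp: Q_def q_def[abs_def])
    moreover have "norm (v - (\<Sum>l<j. q l *\<^sub>R xs ! l)) < 2 * \<theta>"
    proof -
      have cq: "\<bar>c l - q l\<bar> \<le> h" if "l < j" for l
      proof -
        have "real_of_int \<lfloor>c l / h\<rfloor> \<le> c l / h" "c l / h \<le> real_of_int \<lfloor>c l / h\<rfloor> + 1" by linarith+
        then have "h * real_of_int \<lfloor>c l / h\<rfloor> \<le> c l" "c l \<le> h * real_of_int \<lfloor>c l / h\<rfloor> + h"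
          using h mult_left_mono[of "real_of_int \<lfloor>c l / h\<rfloor>" "c l / h" h]
            mult_left_mono[of "c l / h" "real_of_int \<lfloor>c l / h\<rfloor> + 1" h] by (simp_all add: distrib_left)
        then show ?thesis using that by (auto simp: q_def z_def)
      qed
      have "norm ((\<Sum>l<j. c l *\<^sub>R xs ! l) - (\<Sum>l<j. q l *\<^sub>R xs ! l)) = norm (\<Sum>l<j. (c l - q l) *\<^sub>R xs ! l)"
        by (simp add: scaleR_diff_left sum_subtractf)
      also have "\<dots> \<le> (\<Sum>l<j. h * 1)"
      proof (rule sum_norm_le)
        fix l assume "l \<in> {..<j}"
        then show "norm ((c l - q l) *\<^sub>R xs ! l) \<le> h * 1"
          using cq[of l] xs h unfolding norm_scaleR by (intro mult_mono) auto
      qed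
      also have "\<dots> \<le> \<theta>" using h by simp
      finally show ?thesis
        using c(1) norm_triangle_ineq[of "v - (\<Sum>l<j. c l *\<^sub>R xs ! l)" "(\<Sum>l<j. c l *\<^sub>R xs ! l) - (\<Sum>l<j. q l *\<^sub>R xs ! l)"]
        by simp
    qed
    ultimately show "\<exists>q\<in>Q. norm (v - (\<Sum>l<j. q l *\<^sub>R xs ! l)) < 2 * \<theta>" by blast
  qed
qed

section \<open>Choice of sparse times along a spread martingale\<close>

definition hist :: "nat list \<Rightarrow> 'v list \<Rightarrow> 'v list" where
  "hist ls w = map ((!) w) ls"

lemma length_hist [simp]: "length (hist ls w) = length ls" by (simp add: hist_def)

lemma hist_take: "\<forall>l\<in>set ls. l \<le> i \<Longrightarrow> hist ls (take (Suc i) w) = hist ls w"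
  by (auto simp: hist_def)

context
  fixes \<epsilon> n and P :: "'v::real_normed_vector list pmf"
  assumes P: "bush_path \<epsilon> n P"
begin

lemma bush_path_finite: "finite (set_pmf P)" using P by (simp add: bush_path_def)

lemma bush_path_norm: "w \<in> set_pmf P \<Longrightarrow> i \<le> n \<Longrightarrow> norm (w ! i) \<le> 1"
  using P by (auto simp: bush_path_def)

lemma bush_path_martingale:
  assumes "i < n" "\<And>h. convex_on UNIV (\<Psi> h)"
  shows "expect P (\<lambda>w. \<Psi> (take (Suc i) w) (w ! i)) \<le> expect P (\<lambda>w. \<Psi> (take (Suc i) w) (w ! Suc i))"
  using P assms unfolding bush_path_def by blast

lemma bush_path_spread:
  assumes "i < n"
  shows "\<epsilon> * expect P (\<lambda>w. of_bool (A (take (Suc i) w))) \<le>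
    expect P (\<lambda>w. of_bool (A (take (Suc i) w)) * norm (w ! Suc i - e (take (Suc i) w)))"
  using P assms unfolding bush_path_def by blast

lemma bush_path_mono:
  assumes "a \<le> b" "b \<le> n" "\<forall>l\<in>set ls. l \<le> a" and \<Psi>: "\<And>h. convex_on UNIV (\<Psi> h)"
  shows "expect P (\<lambda>w. \<Psi> (hist ls w) (w ! a)) \<le> expect P (\<lambda>w. \<Psi> (hist ls w) (w ! b))"
  using assms(1,2)
proof (induction b rule: dec_induct)
  case (step b)
  have "expect P (\<lambda>w. \<Psi> (hist ls (take (Suc b) w)) (w ! b)) \<le> expect P (\<lambda>w. \<Psi> (hist ls (take (Suc b) w)) (w ! Suc b))"
    using bush_path_martingale[of b "\<lambda>h. \<Psi> (hist ls h)"] step.prems \<Psi> by simp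
  moreover have "\<forall>l\<in>set ls. l \<le> b" using assms(3) step.hyps by auto
  ultimately show ?case using step by (simp add: hist_take)
qed simp

lemma bush_path_linear:
  assumes "a \<le> b" "b \<le> n" "\<forall>l\<in>set ls. l \<le> a" and \<Psi>: "\<And>h. linear (\<Psi> h :: 'v \<Rightarrow> real)"
  shows "expect P (\<lambda>w. \<Psi> (hist ls w) (w ! a)) = expect P (\<lambda>w. \<Psi> (hist ls w) (w ! b))"
proof (rule antisym)
  show "expect P (\<lambda>w. \<Psi> (hist ls w) (w ! a)) \<le> expect P (\<lambda>w. \<Psi> (hist ls w) (w ! b))"
    by (rule bush_path_mono) (use assms in \<open>auto intro!: convex_onI simp: linear_add linear_scale\<close>)
  have "expect P (\<lambda>w. - \<Psi> (hist ls w) (w ! a)) \<le> expect P (\<lambda>w. - \<Psi> (hist ls w) (w ! b))"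
    by (rule bush_path_mono[of _ _ _ "\<lambda>h v. - \<Psi> h v"])
      (use assms in \<open>auto intro!: convex_onI simp: linear_add linear_scale\<close>)
  then show "expect P (\<lambda>w. \<Psi> (hist ls w) (w ! b)) \<le> expect P (\<lambda>w. \<Psi> (hist ls w) (w ! a))" by simp
qed

text \<open>Away from the centre the mean distance cannot drop, by convexity of the norm; on the
  event of being \<open>r\<close>-close it jumps from below \<open>r\<close> to at least \<epsilon>
  on average.\<close>

lemma bush_path_step:
  assumes i: "i < n" and ls: "\<forall>l\<in>set ls. l \<le> i"
  shows "expect P (\<lambda>w. norm (w ! i - e (hist ls w))) +
      (\<epsilon> - r) * expect P (\<lambda>w. of_bool (norm (w ! i - e (hist ls w)) < r))
    \<le> expect P (\<lambda>w. norm (w ! Suc i - e (hist ls w)))"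
proof -
  let ?e = "\<lambda>w. e (hist ls w)"
  define A where "A h \<longleftrightarrow> norm (last h - e (hist ls h)) < r" for h
  have A: "A (take (Suc i) w) \<longleftrightarrow> norm (w ! i - ?e w) < r" if "w \<in> set_pmf P" for w
  proof -
    have "last (take (Suc i) w) = w ! i" using P i that by (subst last_conv_nth) (auto simp: bush_path_def)
    then show ?thesis by (simp add: A_def hist_take[OF ls])
  qed
  note fin = bush_path_finite
  define \<Psi> where "\<Psi> h v = of_bool (\<not> A h) * norm (v - e (hist ls h))" for h v
  have "convex_on UNIV (\<Psi> h)" for h
  proof -
    have "convex_on UNIV (\<lambda>v. dist (e (hist ls h)) v)" by (rule convex_on_dist) simp
    then show ?thesis unfolding \<Psi>_def[abs_def]
      by (intro convex_on_cmul) (auto simp: dist_norm norm_minus_commute)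
  qed
  then have far: "expect P (\<lambda>w. \<Psi> (take (Suc i) w) (w ! i)) \<le> expect P (\<lambda>w. \<Psi> (take (Suc i) w) (w ! Suc i))"
    by (rule bush_path_martingale[OF i])
  have near: "\<epsilon> * expect P (\<lambda>w. of_bool (A (take (Suc i) w))) \<le>
        expect P (\<lambda>w. of_bool (A (take (Suc i) w)) * norm (w ! Suc i - e (hist ls (take (Suc i) w))))"
    by (rule bush_path_spread[OF i, of A "\<lambda>h. e (hist ls h)"])
  have "expect P (\<lambda>w. norm (w ! i - ?e w)) \<le> expect P (\<lambda>w. r * of_bool (A (take (Suc i) w)) + \<Psi> (take (Suc i) w) (w ! i))"
    by (rule expect_mono[OF fin]) (auto simp: A \<Psi>_def hist_take[OF ls])
  also have "\<dots> = r * expect P (\<lambda>w. of_bool (A (take (Suc i) w))) + expect P (\<lambda>w. \<Psi> (take (Suc i) w) (w ! i))"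
    by (subst expect_add[OF fin]) simp
  finally have 1: "expect P (\<lambda>w. norm (w ! i - ?e w)) \<le> \<dots>" .
  have "expect P (\<lambda>w. norm (w ! Suc i - ?e w)) = expect P (\<lambda>w. of_bool (A (take (Suc i) w)) * norm (w ! Suc i - ?e w)
     + \<Psi> (take (Suc i) w) (w ! Suc i))"
    by (rule expect_cong) (auto simp: \<Psi>_def hist_take[OF ls])
  also have "\<dots> = expect P (\<lambda>w. of_bool (A (take (Suc i) w)) * norm (w ! Suc i - ?e w)) +
     expect P (\<lambda>w. \<Psi> (take (Suc i) w) (w ! Suc i))"
    by (rule expect_add[OF fin])
  finally have 2: "expect P (\<lambda>w. norm (w ! Suc i - ?e w)) = \<dots>" .
  have 3: "expect P (\<lambda>w. of_bool (A (take (Suc i) w))) = expect P (\<lambda>w. of_bool (norm (w ! i - ?e w) < r))"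
    by (rule expect_cong) (simp add: A)
  show ?thesis using 1 2 near far by (simp add: 3 hist_take[OF ls] algebra_simps)
qed

end

text \<open>A potential argument. The sum over the net of the mean distances to the combinations of
  the past is bounded, yet it grows by \<open>2 * \<theta> * \<beta>\<close> at each level where the
  path is \<theta>-close to its past with probability at least \<beta>. Such levels cannot fill a
  window of length \<open>B\<close>.\<close>

lemma good_level:
  assumes \<tau>: "0 < \<tau>" and \<theta>: "0 < \<theta>" and \<beta>: "0 < \<beta>"
  obtains B where "\<And>n (P :: 'v::real_normed_vector list pmf) ls a. bush_path (4 * \<theta>) n P \<Longrightarrow> length ls = j \<Longrightarrow>
      \<forall>l\<in>set ls. l \<le> a \<Longrightarrow> a + B \<le> n \<Longrightarrow>
      \<exists>i\<in>{a..<a + B}. expect P (\<lambda>w. of_bool (coset_norm \<tau> (hist ls w) (w ! i) < \<theta>)) < \<beta>"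
proof -
  obtain Q W where Q: "finite Q" "0 \<le> W" "\<And>q. q \<in> Q \<Longrightarrow> (\<Sum>l<j. \<bar>q l\<bar>) \<le> (W :: real)"
    and net: "\<And>(xs :: 'v list) v. length xs = j \<Longrightarrow> \<forall>x\<in>set xs. norm x \<le> 1 \<Longrightarrow> coset_norm \<tau> xs v < \<theta>
       \<Longrightarrow> \<exists>q\<in>Q. norm (v - (\<Sum>l<j. q l *\<^sub>R xs ! l)) < 2 * \<theta>"
    using coset_norm_net[OF \<tau> \<theta>, where j = j and 'v = 'v] by blast
  \<comment> \<open>A bound for the potential: points of the path have norm at most 1, combinations
    of the past at most \<open>W\<close>, and there are \<open>card Q\<close> centres.\<close>
  define M where "M = real (card Q) * (1 + W)"
  obtain B :: nat where B: "M < real B * (2 * \<theta> * \<beta>)" using reals_Archimedean3[of "2 * \<theta> * \<beta>"] \<theta> \<beta> by auto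
  show thesis
  proof (rule that[of B], rule ccontr)
    fix n P ls a
    assume P: "bush_path (4 * \<theta>) n (P :: 'v list pmf)" and ls: "length ls = j" "\<forall>l\<in>set ls. l \<le> a" and aB: "a + B \<le> n"
      and contra: "\<not> (\<exists>i\<in>{a..<a + B}. expect P (\<lambda>w. of_bool (coset_norm \<tau> (hist ls w) (w ! i) < \<theta>)) < \<beta>)"
    note fin = bush_path_finite[OF P]
    define e where "e q xs = (\<Sum>l<j. q l *\<^sub>R xs ! l)" for q :: "nat \<Rightarrow> real" and xs :: "'v list"
    define g where "g i = (\<Sum>q\<in>Q. expect P (\<lambda>w. norm (w ! i - e q (hist ls w))))" for i
    have hist1: "norm x \<le> 1" if w: "w \<in> set_pmf P" and x: "x \<in> set (hist ls w)" for w x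
    proof -
      obtain l where l: "l \<in> set ls" "x = w ! l" using x by (auto simp: hist_def)
      then have "l \<le> n" using ls(2) aB by fastforce
      then show ?thesis using bush_path_norm[OF P w] l(2) by simp
    qed
    have step: "g i + 2 * \<theta> * \<beta> \<le> g (Suc i)" if i: "a \<le> i" "i < a + B" for i
    proof -
      have "\<beta> \<le> expect P (\<lambda>w. of_bool (coset_norm \<tau> (hist ls w) (w ! i) < \<theta>))"
        using contra i by (auto simp: not_less)
      also have "\<dots> \<le> expect P (\<lambda>w. \<Sum>q\<in>Q. of_bool (norm (w ! i - e q (hist ls w)) < 2 * \<theta>))"
      proof (rule expect_mono[OF fin])
        fix w assume w: "w \<in> set_pmf P"
        show "of_bool (coset_norm \<tau> (hist ls w) (w ! i) < \<theta>)
          \<le> (\<Sum>q\<in>Q. of_bool (norm (w ! i - e q (hist ls w)) < 2 * \<theta>) :: real)"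
        proof (cases "coset_norm \<tau> (hist ls w) (w ! i) < \<theta>")
          case True
          then obtain q where "q \<in> Q" "norm (w ! i - e q (hist ls w)) < 2 * \<theta>"
            using net[of "hist ls w" "w ! i"] hist1[OF w] ls(1) unfolding e_def by auto
          then show ?thesis
            using member_le_sum[of q Q "\<lambda>q. of_bool (norm (w ! i - e q (hist ls w)) < 2 * \<theta>) :: real"] Q(1) True by simp
        qed (simp add: sum_nonneg)
      qed
      also have "\<dots> = (\<Sum>q\<in>Q. expect P (\<lambda>w. of_bool (norm (w ! i - e q (hist ls w)) < 2 * \<theta>)))"
        by (rule expect_sum[OF fin])
      finally have "2 * \<theta> * \<beta> \<le> 2 * \<theta> * (\<Sum>q\<in>Q. expect P (\<lambda>w. of_bool (norm (w ! i - e q (hist ls w)) < 2 * \<theta>)))"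
        using \<theta> by (intro mult_left_mono) auto
      moreover have "g i + 2 * \<theta> * (\<Sum>q\<in>Q. expect P (\<lambda>w. of_bool (norm (w ! i - e q (hist ls w)) < 2 * \<theta>))) \<le> g (Suc i)"
        unfolding g_def sum_distrib_left sum.distrib[symmetric]
      proof (rule sum_mono)
        fix q
        show "expect P (\<lambda>w. norm (w ! i - e q (hist ls w)))
          + 2 * \<theta> * expect P (\<lambda>w. of_bool (norm (w ! i - e q (hist ls w)) < 2 * \<theta>))
          \<le> expect P (\<lambda>w. norm (w ! Suc i - e q (hist ls w)))"
          using bush_path_step[OF P, of i ls "e q" "2 * \<theta>"] i ls aB
          by (simp add: dual_order.trans[OF i(1)])
      qed
      ultimately show ?thesis by simp
    qed
    have lower: "g a + real k * (2 * \<theta> * \<beta>) \<le> g (a + k)" if "k \<le> B" for k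
      using that
    proof (induction k)
      case (Suc k)
      then show ?case using step[of "a + k"] by (simp add: algebra_simps)
    qed simp
    have "0 \<le> g a" unfolding g_def by (intro sum_nonneg integral_nonneg) auto
    moreover have "g (a + B) \<le> M"
    proof -
      have "expect P (\<lambda>w. norm (w ! (a + B) - e q (hist ls w))) \<le> 1 + W" if q: "q \<in> Q" for q
      proof -
        have "norm (w ! (a + B) - e q (hist ls w)) \<le> 1 + W" if w: "w \<in> set_pmf P" for w
        proof -
          have "norm (e q (hist ls w)) \<le> (\<Sum>l<j. \<bar>q l\<bar> * 1)"
            unfolding e_def
          proof (rule sum_norm_le)
            fix l assume "l \<in> {..<j}"
            then have "norm (hist ls w ! l) \<le> 1" using hist1[OF w] ls by simp
            then show "norm (q l *\<^sub>R hist ls w ! l) \<le> \<bar>q l\<bar> * 1" unfolding norm_scaleR by (intro mult_left_mono) auto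
          qed
          then show ?thesis
            using Q(3)[OF q] bush_path_norm[OF P w aB] norm_triangle_ineq4[of "w ! (a + B)" "e q (hist ls w)"] by simp
        qed
        then have "expect P (\<lambda>w. norm (w ! (a + B) - e q (hist ls w))) \<le> expect P (\<lambda>_. 1 + W)"
          by (intro expect_mono[OF fin])
        then show ?thesis by simp
      qed
      then have "g (a + B) \<le> (\<Sum>q\<in>Q. 1 + W)" unfolding g_def by (intro sum_mono)
      then show ?thesis by (simp add: M_def)
    qed
    ultimately show False using B lower[of B] by simp
  qed
qed

lemma slow_block:
  fixes Z :: "nat \<Rightarrow> real"
  assumes mono: "\<And>i j. a \<le> i \<Longrightarrow> i \<le> j \<Longrightarrow> j \<le> a + H * L \<Longrightarrow> Z i \<le> Z j"
    and bounds: "0 \<le> Z a" "Z (a + H * L) \<le> 1" and H: "1 < real H * \<gamma>"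
  obtains h where "h < H" "Z (a + Suc h * L) \<le> Z (a + h * L) + \<gamma>"
proof -
  have "\<exists>h<H. Z (a + Suc h * L) \<le> Z (a + h * L) + \<gamma>"
  proof (rule ccontr)
    assume neg: "\<not> ?thesis"
    have "Z a + real h * \<gamma> \<le> Z (a + h * L)" if "h \<le> H" for h
      using that
    proof (induction h)
      case (Suc h)
      then have "\<not> Z (a + Suc h * L) \<le> Z (a + h * L) + \<gamma>" using neg by (auto simp: Suc_le_eq)
      then show ?case using Suc by (simp add: algebra_simps)
    qed simp
    from this[of H] show False using bounds H by simp
  qed
  then show thesis using that by blast
qed

text \<open>A second moment: its increments control, in mean square, how far a later point departs
  from the value that a functional fixed by the history predicts.\<close>

definition hist_energy :: "real \<Rightarrow> 'v::real_normed_vector list pmf \<Rightarrow> nat list \<Rightarrow> nat \<Rightarrow> real" where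
  "hist_energy \<tau> P ls i = expect P (\<lambda>w. (coset_norm \<tau> (hist ls w) (w ! i))\<^sup>2)"

lemma hist_energy_mono:
  assumes "0 < \<tau>" "bush_path \<epsilon> n P" "a \<le> b" "b \<le> n" "\<forall>l\<in>set ls. l \<le> a"
  shows "hist_energy \<tau> P ls a \<le> hist_energy \<tau> P ls b"
  unfolding hist_energy_def
  by (rule bush_path_mono[OF assms(2-5), of "\<lambda>h v. (coset_norm \<tau> h v)\<^sup>2"])
    (intro convex_on_power2 convex_on_coset_norm coset_norm_nonneg assms(1))

lemma hist_energy_le_1:
  assumes \<tau>: "0 < \<tau>" and P: "bush_path \<epsilon> n P" and "i \<le> n" shows "hist_energy \<tau> P ls i \<le> 1"
proof -
  have "expect P (\<lambda>w. (coset_norm \<tau> (hist ls w) (w ! i))\<^sup>2) \<le> expect P (\<lambda>_. 1)"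
  proof (rule expect_mono[OF bush_path_finite[OF P]])
    fix w assume "w \<in> set_pmf P"
    then have "coset_norm \<tau> (hist ls w) (w ! i) \<le> 1"
      using coset_norm_le_norm[OF \<tau>, of "hist ls w" "w ! i"] bush_path_norm[OF P _ \<open>i \<le> n\<close>, of w] by simp
    then show "(coset_norm \<tau> (hist ls w) (w ! i))\<^sup>2 \<le> 1"
      using coset_norm_nonneg[OF \<tau>] by (intro power_le_one) auto
  qed
  then show ?thesis by (simp add: hist_energy_def)
qed

text \<open>The prefix \<open>ls\<close> is there for the recursion, in which every chosen time
  joins the past of the following ones; in the final use it is empty.\<close>

definition good_levels :: "real \<Rightarrow> real \<Rightarrow> real \<Rightarrow> real \<Rightarrow> 'v::real_normed_vector list pmf \<Rightarrow> nat list \<Rightarrow> nat list \<Rightarrow> bool" where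
  "good_levels \<tau> \<theta> \<beta> \<gamma> P ls ms \<longleftrightarrow> (\<forall>i<length ms.
     expect P (\<lambda>w. of_bool (coset_norm \<tau> (hist (ls @ take i ms) w) (w ! (ms ! i)) < \<theta>)) < \<beta> \<and>
     (\<forall>i'<length ms. i \<le> i' \<longrightarrow>
        hist_energy \<tau> P (ls @ take i ms) (ms ! i') \<le> hist_energy \<tau> P (ls @ take i ms) (ms ! i) + \<gamma>))"

text \<open>A block on which the energy relative to the current past is almost constant is found
  before the next time is chosen; that time comes from the first \<open>B\<close> levels of the
  block and all further ones from the rest of it. The length of a block thus depends on how many
  times are still to come, hence the induction on \<open>k\<close> with \<open>j\<close>
  arbitrary.\<close>

lemma good_levels_exist:
  assumes \<tau>: "0 < \<tau>" and \<theta>: "0 < \<theta>" and \<beta>: "0 < \<beta>" and \<gamma>: "0 < \<gamma>"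
  shows "\<exists>len. \<forall>n (P :: 'v::real_normed_vector list pmf) ls a. bush_path (4 * \<theta>) n P \<longrightarrow> length ls = j \<longrightarrow>
    (\<forall>l\<in>set ls. l \<le> a) \<longrightarrow> a + len \<le> n \<longrightarrow>
    (\<exists>ms. length ms = k \<and> sorted ms \<and> set ms \<subseteq> {a..a + len} \<and> good_levels \<tau> \<theta> \<beta> \<gamma> P ls ms)"
proof (induction k arbitrary: j)
  case 0
  show ?case by (auto simp: good_levels_def)
next
  case (Suc k)
  obtain len where len: "\<And>n (P :: 'v list pmf) ls a. bush_path (4 * \<theta>) n P \<Longrightarrow> length ls = Suc j \<Longrightarrow>
    \<forall>l\<in>set ls. l \<le> a \<Longrightarrow> a + len \<le> n \<Longrightarrow>
    \<exists>ms. length ms = k \<and> sorted ms \<and> set ms \<subseteq> {a..a + len} \<and> good_levels \<tau> \<theta> \<beta> \<gamma> P ls ms"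
    using Suc.IH[of "Suc j"] by blast
  obtain B where B: "\<And>n (P :: 'v list pmf) ls a. bush_path (4 * \<theta>) n P \<Longrightarrow> length ls = j \<Longrightarrow>
      \<forall>l\<in>set ls. l \<le> a \<Longrightarrow> a + B \<le> n \<Longrightarrow>
      \<exists>i\<in>{a..<a + B}. expect P (\<lambda>w. of_bool (coset_norm \<tau> (hist ls w) (w ! i) < \<theta>)) < \<beta>"
    using good_level[OF \<tau> \<theta> \<beta>, where j = j and 'v = 'v] by blast
  define L where "L = B + len"
  obtain H :: nat where H: "1 < real H * \<gamma>" using reals_Archimedean3[OF \<gamma>] by blast
  show ?case
  proof (intro exI[of _ "H * L"] allI impI)
    fix n ls a and P :: "'v list pmf"
    assume P: "bush_path (4 * \<theta>) n P" and ls: "length ls = j" "\<forall>l\<in>set ls. l \<le> a" and n: "a + H * L \<le> n"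
    let ?Z = "hist_energy \<tau> P ls"
    have Zmono: "?Z i \<le> ?Z i'" if "a \<le> i" "i \<le> i'" "i' \<le> n" for i i'
      using ls(2) that by (intro hist_energy_mono[OF \<tau> P]) auto
    obtain h where h: "h < H" "?Z (a + Suc h * L) \<le> ?Z (a + h * L) + \<gamma>"
    proof (rule slow_block[of a H L ?Z \<gamma>])
      show "0 \<le> ?Z a" by (simp add: hist_energy_def)
      show "?Z (a + H * L) \<le> 1" by (rule hist_energy_le_1[OF \<tau> P n])
      show "?Z i \<le> ?Z i'" if "a \<le> i" "i \<le> i'" "i' \<le> a + H * L" for i i'
        by (rule Zmono[OF that(1,2) order_trans[OF that(3) n]])
    qed (use H in simp)
    define a' where "a' = a + h * L"
    have "Suc h * L \<le> H * L" using h by (intro mult_right_mono) auto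
    then have a': "a \<le> a'" "a' + L \<le> a + H * L" "a' + L \<le> n" "?Z (a' + L) \<le> ?Z a' + \<gamma>"
      using n h(2) by (auto simp: a'_def add_ac)
    have ls': "\<forall>l\<in>set ls. l \<le> a'" using ls(2) a'(1) by auto
    obtain i where i: "a' \<le> i" "i < a' + B" "expect P (\<lambda>w. of_bool (coset_norm \<tau> (hist ls w) (w ! i) < \<theta>)) < \<beta>"
      using B[OF P ls(1) ls'] a'(3) by (auto simp: L_def)
    have "\<forall>l\<in>set (ls @ [i]). l \<le> i" using ls' i by auto
    moreover have "i + len \<le> n" using i a' by (simp add: L_def)
    ultimately obtain ms where ms: "length ms = k" "sorted ms" "set ms \<subseteq> {i..i + len}"
      "good_levels \<tau> \<theta> \<beta> \<gamma> P (ls @ [i]) ms"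
      using len[OF P, of "ls @ [i]" i] ls(1) by auto
    have later: "?Z i' \<le> ?Z i + \<gamma>" if "i' \<in> set (i # ms)" for i'
    proof -
      have i': "i \<le> i'" "i' \<le> a' + L" using that ms(3) i by (auto simp: L_def)
      then have "?Z i' \<le> ?Z (a' + L)" using a' i by (intro Zmono) auto
      moreover have "?Z a' \<le> ?Z i" using a' i by (intro Zmono) (auto simp: L_def)
      ultimately show ?thesis using a'(4) by simp
    qed
    have "good_levels \<tau> \<theta> \<beta> \<gamma> P ls (i # ms)"
      unfolding good_levels_def
    proof (intro allI impI)
      fix r assume r: "r < length (i # ms)"
      show "expect P (\<lambda>w. of_bool (coset_norm \<tau> (hist (ls @ take r (i # ms)) w) (w ! ((i # ms) ! r)) < \<theta>)) < \<beta> \<and>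
        (\<forall>i'<length (i # ms). r \<le> i' \<longrightarrow>
          hist_energy \<tau> P (ls @ take r (i # ms)) ((i # ms) ! i')
          \<le> hist_energy \<tau> P (ls @ take r (i # ms)) ((i # ms) ! r) + \<gamma>)"
      proof (cases r)
        case 0
        have "?Z ((i # ms) ! i') \<le> ?Z i + \<gamma>" if "i' < length (i # ms)" for i'
          by (rule later[OF nth_mem[OF that]])
        then show ?thesis unfolding 0 using i(3) by simp
      next
        case (Suc r')
        have "expect P (\<lambda>w. of_bool (coset_norm \<tau> (hist ((ls @ [i]) @ take r' ms) w) (w ! (ms ! r')) < \<theta>)) < \<beta> \<and>
          (\<forall>i'<length ms. r' \<le> i' \<longrightarrow> hist_energy \<tau> P ((ls @ [i]) @ take r' ms) (ms ! i')
            \<le> hist_energy \<tau> P ((ls @ [i]) @ take r' ms) (ms ! r') + \<gamma>)"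
          using ms(4) r Suc unfolding good_levels_def by auto
        then show ?thesis unfolding Suc by (auto simp: less_Suc_eq_0_disj)
      qed
    qed
    moreover have "sorted (i # ms)" using ms by auto
    moreover have "set (i # ms) \<subseteq> {a..a + H * L}" using ms(3) i a' by (auto simp: L_def)
    ultimately show "\<exists>ms. length ms = Suc k \<and> sorted ms \<and> set ms \<subseteq> {a..a + H * L} \<and> good_levels \<tau> \<theta> \<beta> \<gamma> P ls ms"
      using ms(1) by (intro exI[of _ "i # ms"]) auto
  qed
qed

text \<open>A fixed choice makes the functional depend on the past and the present point alone, so
  that the martingale property applies to it.\<close>

definition supporting :: "real \<Rightarrow> 'v::real_normed_vector list \<Rightarrow> 'v \<Rightarrow> 'v \<Rightarrow> real" where
  "supporting \<tau> xs a = (SOME g. linear g \<and> (\<forall>x. \<bar>g x\<bar> \<le> coset_norm \<tau> xs x) \<and> g a = coset_norm \<tau> xs a)"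

lemma supporting:
  assumes "0 < \<tau>"
  shows "linear (supporting \<tau> xs a)" "\<bar>supporting \<tau> xs a x\<bar> \<le> coset_norm \<tau> xs x"
    "supporting \<tau> xs a a = coset_norm \<tau> xs a"
proof -
  obtain g where g: "linear g" "\<And>x. g x \<le> coset_norm \<tau> xs x" "g a = coset_norm \<tau> xs a"
    using Hahn_Banach_sublinear[OF sublinear_coset_norm[OF assms]] by blast
  have "\<bar>g x\<bar> \<le> coset_norm \<tau> xs x" for x
    using g(2)[of x] g(2)[of "- x"] linear_neg[OF g(1), of x] coset_norm_scaleR[OF assms, of xs "-1" x] by simp
  then have "\<exists>g. linear g \<and> (\<forall>x. \<bar>g x\<bar> \<le> coset_norm \<tau> xs x) \<and> g a = coset_norm \<tau> xs a"
    using g by blast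
  from someI_ex[OF this] show "linear (supporting \<tau> xs a)" "\<bar>supporting \<tau> xs a x\<bar> \<le> coset_norm \<tau> xs x"
    "supporting \<tau> xs a a = coset_norm \<tau> xs a" unfolding supporting_def by blast+
qed

text \<open>Orthogonality of martingale increments and Chebyshev's inequality. At time
  \<open>b\<close> the functional chosen at time \<open>a\<close> still has the coset norm of
  \<open>w ! a\<close> as its conditional mean, while its square is at most the squared coset norm
  of \<open>w ! b\<close>; so its mean square deviation is at most the growth of the energy.\<close>

lemma supporting_variance:
  fixes P :: "'v::real_normed_vector list pmf"
  assumes \<tau>: "0 < \<tau>" and P: "bush_path \<epsilon> n P" and ab: "a \<le> b" "b \<le> n" and ls: "\<forall>l\<in>set ls. l \<le> a"
    and energy: "hist_energy \<tau> P ls b \<le> hist_energy \<tau> P ls a + \<gamma>"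
  shows "expect P (\<lambda>w. of_bool (\<tau> < \<bar>supporting \<tau> (hist ls w) (w ! a) (w ! b) - coset_norm \<tau> (hist ls w) (w ! a)\<bar>)) \<le> \<gamma> / \<tau>\<^sup>2"
proof -
  let ?g = "\<lambda>w. supporting \<tau> (hist ls w) (w ! a)" and ?\<rho> = "\<lambda>w. coset_norm \<tau> (hist ls w) (w ! a)"
  note fin = bush_path_finite[OF P]
  \<comment> \<open>The history is the full initial segment up to time \<open>a\<close>: its last
    entry is \<open>w ! a\<close>, and the times in \<open>ls\<close> can be read off from it. The
    factor in front turns the martingale identity into the mixed term of the square.\<close>
  define \<Psi> where "\<Psi> h v = coset_norm \<tau> (hist ls h) (last h) * supporting \<tau> (hist ls h) (last h) v" for h :: "'v list" and v
  have last: "last (hist [0..<Suc a] w) = w ! a" for w :: "'v list" by (simp add: hist_def)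
  have hist2: "hist ls (hist [0..<Suc a] w) = hist ls w" for w :: "'v list"
    using ls by (auto simp: hist_def nth_append simp del: upt_Suc)
  have lin: "linear (\<Psi> h)" for h
  proof -
    have L: "linear (supporting \<tau> (hist ls h) (last h))" by (rule supporting(1)[OF \<tau>])
    show ?thesis unfolding \<Psi>_def[abs_def]
      by (rule linearI) (simp_all add: linear_add[OF L] linear_scale[OF L] distrib_left)
  qed
  have "expect P (\<lambda>w. \<Psi> (hist [0..<Suc a] w) (w ! a)) = expect P (\<lambda>w. \<Psi> (hist [0..<Suc a] w) (w ! b))"
    by (rule bush_path_linear[OF P ab _ lin]) auto
  then have cross: "expect P (\<lambda>w. ?\<rho> w * ?g w (w ! b)) = hist_energy \<tau> P ls a"
    by (simp add: \<Psi>_def last hist2 supporting(3)[OF \<tau>] hist_energy_def power2_eq_square del: upt_Suc)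
  have "\<tau>\<^sup>2 * expect P (\<lambda>w. of_bool (\<tau> < \<bar>?g w (w ! b) - ?\<rho> w\<bar>)) = expect P (\<lambda>w. \<tau>\<^sup>2 * of_bool (\<tau> < \<bar>?g w (w ! b) - ?\<rho> w\<bar>))"
    by simp
  also have "\<dots> \<le> expect P (\<lambda>w. (coset_norm \<tau> (hist ls w) (w ! b))\<^sup>2 + (?\<rho> w)\<^sup>2 - 2 * (?\<rho> w * ?g w (w ! b)))"
  proof (rule expect_mono[OF fin])
    fix w
    let ?x = "?g w (w ! b)" and ?r = "?\<rho> w"
    have "\<tau>\<^sup>2 * of_bool (\<tau> < \<bar>?x - ?r\<bar>) \<le> (?x - ?r)\<^sup>2"
    proof (cases "\<tau> < \<bar>?x - ?r\<bar>")
      case True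
      then have "\<tau>\<^sup>2 \<le> \<bar>?x - ?r\<bar>\<^sup>2" using \<tau> by (intro power_mono) auto
      then show ?thesis using True by simp
    qed simp
    also have "\<dots> = ?x\<^sup>2 + ?r\<^sup>2 - 2 * (?r * ?x)" by (simp add: power2_eq_square algebra_simps)
    also have "?x\<^sup>2 \<le> (coset_norm \<tau> (hist ls w) (w ! b))\<^sup>2"
      using supporting(2)[OF \<tau>, of "hist ls w" "w ! a" "w ! b"] by (simp add: power2_le_iff_abs_le coset_norm_nonneg[OF \<tau>])
    finally show "\<tau>\<^sup>2 * of_bool (\<tau> < \<bar>?x - ?r\<bar>) \<le> (coset_norm \<tau> (hist ls w) (w ! b))\<^sup>2 + ?r\<^sup>2 - 2 * (?r * ?x)" by simp
  qed
  also have "\<dots> = hist_energy \<tau> P ls b + hist_energy \<tau> P ls a - 2 * hist_energy \<tau> P ls a"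
    unfolding expect_diff[OF fin] expect_add[OF fin] by (simp add: cross hist_energy_def)
  also have "\<dots> \<le> \<gamma>" using energy by simp
  finally show ?thesis using \<tau> by (simp add: field_simps)
qed

lemma expect_union_bound:
  assumes fin: "finite (set_pmf P)" and I: "finite I"
    and "(\<Sum>i\<in>I. expect P (\<lambda>w. of_bool (A i w))) < 1"
  obtains w where "w \<in> set_pmf P" "\<And>i. i \<in> I \<Longrightarrow> \<not> A i w"
proof -
  have "expect P (\<lambda>w. \<Sum>i\<in>I. of_bool (A i w)) < 1" using assms(3) by (simp add: expect_sum[OF fin])
  then obtain w where w: "w \<in> set_pmf P" "(\<Sum>i\<in>I. of_bool (A i w) :: real) < 1"
    using expect_less_imp_ex[OF fin] by blast
  have "\<not> A i w" if "i \<in> I" for i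
  proof
    assume "A i w"
    then show False using member_le_sum[of i I "\<lambda>i. of_bool (A i w) :: real"] that I w(2) by simp
  qed
  then show thesis using that w(1) by blast
qed

text \<open>An approximate form of James's criterion: up to the factor \<open>\<rho> j\<close>, the
  functional \<open>g j\<close> is the tail functional from \<open>j\<close> on. The point is a
  bound \<theta> that serves all \<open>m\<close> and \<tau>.\<close>

definition step_system :: "real \<Rightarrow> nat \<Rightarrow> real \<Rightarrow> (nat \<Rightarrow> 'v::real_normed_vector) \<Rightarrow> (nat \<Rightarrow> 'v \<Rightarrow> real) \<Rightarrow> (nat \<Rightarrow> real) \<Rightarrow> bool" where
  "step_system \<theta> m \<tau> x g \<rho> \<longleftrightarrow> (\<forall>i<m. norm (x i) \<le> 1) \<and>
     (\<forall>j<m. linear (g j) \<and> (\<forall>v. \<bar>g j v\<bar> \<le> norm v) \<and> \<theta> \<le> \<rho> j \<and>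
       (\<forall>i<j. \<bar>g j (x i)\<bar> \<le> \<tau>) \<and> (\<forall>i<m. j \<le> i \<longrightarrow> \<bar>g j (x i) - \<rho> j\<bar> \<le> \<tau>))"

lemma sum_Times: "(\<Sum>p\<in>A \<times> B. f p) = (\<Sum>a\<in>A. \<Sum>b\<in>B. f (a, b))"
  by (subst sum.cartesian_product) (rule sum.cong, auto)

lemma sum_diagonal_corner:
  "(\<Sum>j<m. \<Sum>i\<le>m. if i = m then b else c) = real m * (real m * c + b)" for b c :: real
proof -
  have "{..m} = insert m {..<m}" by auto
  then have "(\<Sum>i\<le>m. if i = m then b else c) = b + (\<Sum>i<m. if i = m then b else c)" by simp
  also have "(\<Sum>i<m. if i = m then b else c) = (\<Sum>i<m. c)" by (rule sum.cong) auto
  finally show ?thesis by simp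
qed

theorem step_system_exists:
  assumes "\<not> superreflexive TYPE('v::real_normed_vector)"
  obtains \<theta> where "0 < \<theta>" "\<And>m \<tau>. 0 < \<tau> \<Longrightarrow> \<exists>(x :: nat \<Rightarrow> 'v) g \<rho>. step_system \<theta> m \<tau> x g \<rho>"
proof -
  obtain \<epsilon> where \<epsilon>: "0 < \<epsilon>" and ne: "\<And>n. bush_roots \<epsilon> n \<noteq> ({} :: 'v set)"
    using superreflexive_if_no_bushes assms by blast
  define \<theta> where "\<theta> = \<epsilon> / 4"
  have \<theta>: "0 < \<theta>" "\<epsilon> = 4 * \<theta>" using \<epsilon> by (auto simp: \<theta>_def)
  have "\<exists>(x :: nat \<Rightarrow> 'v) g \<rho>. step_system \<theta> m \<tau> x g \<rho>" if \<tau>: "0 < \<tau>" for m \<tau>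
  proof -
    \<comment> \<open>Calibrated for a union bound: \<open>m\<close> events of probability below
      \<beta> contribute less than 1/2, and at most \<open>m * m\<close> events of probability at
      most \<open>\<gamma> / \<tau>\<^sup>2\<close> contribute at most 1/2.\<close>
    define \<beta> where "\<beta> = 1 / (2 * (real m + 1))"
    define \<gamma> where "\<gamma> = \<tau>\<^sup>2 / (2 * (real m + 1)\<^sup>2)"
    have pos: "0 < \<beta>" "0 < \<gamma>" using \<tau> by (auto simp: \<beta>_def \<gamma>_def intro!: divide_pos_pos mult_pos_pos)
    obtain len where len: "\<And>n (P :: 'v list pmf) ls a. bush_path (4 * \<theta>) n P \<Longrightarrow> length ls = 0 \<Longrightarrow>
      \<forall>l\<in>set ls. l \<le> a \<Longrightarrow> a + len \<le> n \<Longrightarrow>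
      \<exists>ms. length ms = m \<and> sorted ms \<and> set ms \<subseteq> {a..a + len} \<and> good_levels \<tau> \<theta> \<beta> \<gamma> P ls ms"
      using good_levels_exist[OF \<tau> \<theta>(1) pos, where j = 0 and k = m and 'v = 'v] by blast
    obtain P :: "'v list pmf" where P: "bush_path (4 * \<theta>) len P"
      using bush_path_exists ne[of len] \<theta>(2) by blast
    obtain ms where ms: "length ms = m" "sorted ms" "set ms \<subseteq> {0..len}" "good_levels \<tau> \<theta> \<beta> \<gamma> P [] ms"
      using len[OF P, of "[]" 0] by auto
    note fin = bush_path_finite[OF P]
    let ?h = "\<lambda>j w. hist (take j ms) w"
    let ?\<rho> = "\<lambda>j w. coset_norm \<tau> (?h j w) (w ! (ms ! j))"
    let ?g = "\<lambda>j w. supporting \<tau> (?h j w) (w ! (ms ! j))"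
    have lev: "ms ! i \<le> len" if "i < m" for i using ms(1,3) nth_mem[of i ms] that by fastforce
    have sort: "ms ! j \<le> ms ! i" if "j \<le> i" "i < m" for i j using ms(1,2) that by (auto intro: sorted_nth_mono)
    have past: "\<forall>l\<in>set (take j ms). l \<le> ms ! j" if "j < m" for j
      using that ms(1) sort by (auto simp: in_set_conv_nth)
    \<comment> \<open>The column \<open>i = m\<close> stands for the event that the point at time
      \<open>ms ! j\<close> is too close to its past; the other columns are the deviations bounded
      by \<open>supporting_variance\<close>.\<close>
    define A where "A = (\<lambda>(j, i) (w :: 'v list). if i = m then ?\<rho> j w < \<theta> else j \<le> i \<and> \<tau> < \<bar>?g j w (w ! (ms ! i)) - ?\<rho> j w\<bar>)"
    define I where "I = {..<m} \<times> {..m}"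
    have bound: "expect P (\<lambda>w. of_bool (A (j, i) w)) \<le> (if i = m then \<beta> else \<gamma> / \<tau>\<^sup>2)" if "j < m" "i \<le> m" for i j
    proof (cases "i = m")
      case True
      then have "A (j, i) = (\<lambda>w. ?\<rho> j w < \<theta>)" by (simp add: A_def)
      moreover have "expect P (\<lambda>w. of_bool (?\<rho> j w < \<theta>)) < \<beta>"
        using conjunct1[OF ms(4)[unfolded good_levels_def, rule_format, of j]] that(1) ms(1)
        by (simp only: append_Nil)
      ultimately show ?thesis using True by simp
    next
      case False
      show ?thesis
      proof (cases "j \<le> i")
        case True
        have "i < m" using False that by simp
        then have "hist_energy \<tau> P (take j ms) (ms ! i) \<le> hist_energy \<tau> P (take j ms) (ms ! j) + \<gamma>"
          using conjunct2[OF ms(4)[unfolded good_levels_def, rule_format, of j]] that(1) ms(1) True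
          by (simp only: append_Nil)
        then have "expect P (\<lambda>w. of_bool (\<tau> < \<bar>?g j w (w ! (ms ! i)) - ?\<rho> j w\<bar>)) \<le> \<gamma> / \<tau>\<^sup>2"
          by (intro supporting_variance[OF \<tau> P]) (use sort lev past True that \<open>i < m\<close> in auto)
        then show ?thesis using False True by (simp add: A_def)
      qed (use False pos in \<open>simp add: A_def\<close>)
    qed
    have "(\<Sum>p\<in>I. expect P (\<lambda>w. of_bool (A p w))) \<le> (\<Sum>j<m. \<Sum>i\<le>m. if i = m then \<beta> else \<gamma> / \<tau>\<^sup>2)"
    proof -
      have "(\<Sum>p\<in>I. expect P (\<lambda>w. of_bool (A p w))) = (\<Sum>j<m. \<Sum>i\<le>m. expect P (\<lambda>w. of_bool (A (j, i) w)))"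
        unfolding I_def by (rule sum_Times)
      also have "\<dots> \<le> (\<Sum>j<m. \<Sum>i\<le>m. if i = m then \<beta> else \<gamma> / \<tau>\<^sup>2)"
        by (intro sum_mono bound) auto
      finally show ?thesis .
    qed
    also have "\<dots> = real m * (real m * (\<gamma> / \<tau>\<^sup>2) + \<beta>)"
      by (rule sum_diagonal_corner)
    also have "\<dots> < 1"
    proof -
      have "real m * \<beta> < 1/2" by (simp add: \<beta>_def field_simps)
      moreover have "(real m)\<^sup>2 * (\<gamma> / \<tau>\<^sup>2) \<le> 1/2"
      proof -
        have "\<gamma> / \<tau>\<^sup>2 = 1 / (2 * (real m + 1)\<^sup>2)" using \<tau> by (simp add: \<gamma>_def)
        moreover have "(real m)\<^sup>2 \<le> (real m + 1)\<^sup>2" by (intro power_mono) auto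
        moreover have "0 < (real m + 1)\<^sup>2" by (intro zero_less_power) simp
        ultimately show ?thesis by (simp add: field_simps)
      qed
      moreover have "real m * (real m * (\<gamma> / \<tau>\<^sup>2) + \<beta>) = (real m)\<^sup>2 * (\<gamma> / \<tau>\<^sup>2) + real m * \<beta>"
        by (simp only: power2_eq_square distrib_left mult.assoc)
      ultimately show ?thesis by linarith
    qed
    finally have "(\<Sum>p\<in>I. expect P (\<lambda>w. of_bool (A p w))) < 1" .
    then obtain w where w: "w \<in> set_pmf P" "\<And>p. p \<in> I \<Longrightarrow> \<not> A p w"
      using expect_union_bound[OF fin, of I A] by (auto simp: I_def)
    have "step_system \<theta> m \<tau> (\<lambda>i. w ! (ms ! i)) (\<lambda>j. ?g j w) (\<lambda>j. ?\<rho> j w)"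
      unfolding step_system_def
    proof (intro conjI allI impI)
      show "norm (w ! (ms ! i)) \<le> 1" if "i < m" for i by (rule bush_path_norm[OF P w(1) lev[OF that]])
      fix j assume j: "j < m"
      show "linear (?g j w)" by (rule supporting(1)[OF \<tau>])
      show "\<bar>?g j w v\<bar> \<le> norm v" for v
        using supporting(2)[OF \<tau>, of "?h j w" "w ! (ms ! j)" v] coset_norm_le_norm[OF \<tau>, of "?h j w" v] by simp
      show "\<theta> \<le> ?\<rho> j w" using w(2)[of "(j, m)"] j by (auto simp: I_def A_def)
      show "\<bar>?g j w (w ! (ms ! i))\<bar> \<le> \<tau>" if "i < j" for i
      proof -
        have "?h j w ! i = w ! (ms ! i)" "i < length (?h j w)" using that j ms(1) by (auto simp: hist_def)
        then show ?thesis
          using coset_norm_nth[OF \<tau>, of i "?h j w"] supporting(2)[OF \<tau>, of "?h j w" "w ! (ms ! j)" "w ! (ms ! i)"] by simp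
      qed
      show "\<bar>?g j w (w ! (ms ! i)) - ?\<rho> j w\<bar> \<le> \<tau>" if "i < m" "j \<le> i" for i
        using w(2)[of "(j, i)"] j that by (auto simp: I_def A_def)
    qed
    then show ?thesis by blast
  qed
  then show thesis using that \<theta>(1) by blast
qed

section \<open>Almost biorthogonal systems for laminar families\<close>

text \<open>The set \<Phi> holds functionals that the new vectors must almost annihilate; it will
  express almost independence of the blocks built before.\<close>

definition interval_system ::
    "real \<Rightarrow> nat \<Rightarrow> real \<Rightarrow> ('v::real_normed_vector \<Rightarrow> real) set \<Rightarrow> (nat \<Rightarrow> 'v) \<Rightarrow> bool" where
  "interval_system M N \<tau> \<Phi> y \<longleftrightarrow> (\<forall>i<N. norm (y i) \<le> 2 \<and> (\<forall>\<phi>\<in>\<Phi>. \<bar>\<phi> (y i)\<bar> \<le> \<tau>)) \<and>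
     (\<forall>p q. p \<le> q \<longrightarrow> q \<le> N \<longrightarrow> (\<exists>h. linear h \<and> (\<forall>v. \<bar>h v\<bar> \<le> M * norm v) \<and>
        (\<forall>i<N. \<bar>h (y i) - of_bool (p \<le> i \<and> i < q)\<bar> \<le> \<tau>)))"

text \<open>Differences of vectors on which each functional in \<Phi> takes nearly the same value
  are almost annihilated by \<Phi>; the pigeonhole principle finds such vectors in a long step
  system. An interval functional is the difference of two tail functionals.\<close>

lemma interval_system_exists:
  assumes steps: "\<And>m \<sigma>. 0 < \<sigma> \<Longrightarrow> \<exists>(x :: nat \<Rightarrow> 'v::real_normed_vector) g \<rho>. step_system \<theta> m \<sigma> x g \<rho>"
    and \<theta>: "0 < \<theta>" and \<tau>: "0 < \<tau>" and \<Phi>: "finite \<Phi>"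
    and lin: "\<And>\<phi>. \<phi> \<in> \<Phi> \<Longrightarrow> linear \<phi>" and bdd: "\<And>\<phi> v. \<phi> \<in> \<Phi> \<Longrightarrow> \<bar>\<phi> v\<bar> \<le> norm v"
  shows "\<exists>y :: nat \<Rightarrow> 'v. interval_system (2 / \<theta>) N \<tau> \<Phi> y"
proof -
  \<comment> \<open>A tail functional is tested on a difference of two vectors and divided by at
    least \<theta>, so its error is at most \<open>2 * \<sigma> / \<theta>\<close>, half of \<tau>;
    an interval takes two of them.\<close>
  define \<sigma> where "\<sigma> = \<theta> * \<tau> / 4"
  have \<sigma>: "0 < \<sigma>" using \<theta> \<tau> by (simp add: \<sigma>_def)
  define B where "B = \<lceil>1 / \<tau>\<rceil> + 1"
  define T where "T = PiE \<Phi> (\<lambda>_. {-B..B})"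
  have T: "finite T" unfolding T_def using \<Phi> by (intro finite_PiE) auto
  define m where "m = N * card T + 1"
  obtain x :: "nat \<Rightarrow> 'v" and g \<rho> where "step_system \<theta> m \<sigma> x g \<rho>" using steps[OF \<sigma>] by blast
  then have x: "\<And>i. i < m \<Longrightarrow> norm (x i) \<le> 1"
    and glin: "\<And>j. j < m \<Longrightarrow> linear (g j)" and gbdd: "\<And>j v. j < m \<Longrightarrow> \<bar>g j v\<bar> \<le> norm v"
    and \<rho>: "\<And>j. j < m \<Longrightarrow> \<theta> \<le> \<rho> j"
    and before: "\<And>i j. j < m \<Longrightarrow> i < j \<Longrightarrow> \<bar>g j (x i)\<bar> \<le> \<sigma>"
    and after: "\<And>i j. i < m \<Longrightarrow> j \<le> i \<Longrightarrow> \<bar>g j (x i) - \<rho> j\<bar> \<le> \<sigma>"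
    unfolding step_system_def by auto
  define c where "c i = restrict (\<lambda>\<phi>. \<lfloor>\<phi> (x i) / \<tau>\<rfloor>) \<Phi>" for i
  have c: "c \<in> {..<m} \<rightarrow> T"
  proof
    fix i assume i: "i \<in> {..<m}"
    show "c i \<in> T" unfolding T_def
    proof (rule PiE_I)
      fix \<phi> assume "\<phi> \<in> \<Phi>"
      then have "\<bar>\<phi> (x i)\<bar> \<le> 1" using bdd[of \<phi> "x i"] x[of i] i by simp
      then have "\<bar>\<phi> (x i)\<bar> / \<tau> \<le> 1 / \<tau>" using \<tau> by (simp add: divide_right_mono)
      moreover have "\<bar>\<phi> (x i) / \<tau>\<bar> = \<bar>\<phi> (x i)\<bar> / \<tau>" using \<tau> by simp
      ultimately have "- B \<le> \<lfloor>\<phi> (x i) / \<tau>\<rfloor>" "\<lfloor>\<phi> (x i) / \<tau>\<rfloor> \<le> B" unfolding B_def by linarith+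
      then show "c i \<phi> \<in> {-B..B}" using \<open>\<phi> \<in> \<Phi>\<close> by (simp add: c_def)
    qed (simp add: c_def)
  qed
  have "T \<noteq> {}" using c by (auto simp: m_def)
  then obtain t where t: "t \<in> T" "card {..<m} \<le> card (c -` {t} \<inter> {..<m}) * card T"
    using pigeonhole_card[OF c _ T] by auto
  define I where "I = c -` {t} \<inter> {..<m}"
  have "N < card I"
  proof (rule ccontr)
    assume "\<not> N < card I"
    then have "card I * card T \<le> N * card T" by (intro mult_right_mono) auto
    moreover have "m \<le> card I * card T" using t(2) by (simp add: I_def)
    ultimately show False by (simp only: m_def)
  qed
  have "finite I" by (simp add: I_def)
  obtain s where s: "bij_betw s {..<card I} I" "strict_mono_on {..<card I} s"
    using ex_bij_betw_strict_mono_card[OF \<open>finite I\<close>] by blast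
  have sI: "s r < m" "c (s r) = t" if "r \<le> N" for r
    using bij_betwE[OF s(1), rule_format, of r] that \<open>N < card I\<close> by (auto simp: I_def)
  have smono: "s r < s r'" if "r < r'" "r' \<le> N" for r r'
    using strict_mono_onD[OF s(2), of r r'] that \<open>N < card I\<close> by auto
  have smono': "s r \<le> s r'" if "r \<le> r'" "r' \<le> N" for r r'
    using smono[of r r'] that by (cases "r = r'") auto
  \<comment> \<open>The subtracted vector precedes all others, so every tail functional in use
    almost vanishes on it.\<close>
  define y where "y i = x (s (Suc i)) - x (s 0)" for i
  \<comment> \<open>For \<open>r \<ge> N\<close> no vector is left in the tail, and zero is the
    exact functional.\<close>
  define u where "u r v = (if r < N then g (s (Suc r)) v / \<rho> (s (Suc r)) else 0)" for r v
  have ulin: "linear (u r)" for r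
  proof (cases "r < N")
    case True
    then have L: "linear (g (s (Suc r)))" using glin sI by simp
    show ?thesis
      by (rule linearI) (simp_all add: u_def linear_add[OF L] linear_scale[OF L] add_divide_distrib)
  qed (auto intro!: linearI simp: u_def)
  have ubdd: "\<bar>u r v\<bar> \<le> 1 / \<theta> * norm v" for r v
  proof (cases "r < N")
    case True
    then have j: "s (Suc r) < m" using sI by simp
    have "\<bar>g (s (Suc r)) v\<bar> / \<rho> (s (Suc r)) \<le> norm v / \<theta>"
      using gbdd[OF j] \<rho>[OF j] \<theta> by (intro frac_le) auto
    then show ?thesis using True \<rho>[OF j] \<theta> by (simp add: u_def abs_divide)
  qed (use \<theta> in \<open>simp add: u_def\<close>)
  have u: "\<bar>u r (y i) - of_bool (r \<le> i)\<bar> \<le> \<tau> / 2" if i: "i < N" for r i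
  proof (cases "r < N")
    case True
    define j where "j = s (Suc r)"
    have j: "j < m" and s0: "s 0 < j" using True sI smono by (auto simp: j_def)
    have diff: "g j (y i) = g j (x (s (Suc i))) - g j (x (s 0))"
      unfolding y_def by (rule linear_diff[OF glin[OF j]])
    have "\<bar>g j (y i) - \<rho> j * of_bool (r \<le> i)\<bar> \<le> 2 * \<sigma>"
    proof (cases "r \<le> i")
      case True
      then have "j \<le> s (Suc i)" "s (Suc i) < m" using smono' sI i by (auto simp: j_def)
      then show ?thesis using after[of "s (Suc i)" j] before[OF j s0] True unfolding diff by simp
    next
      case False
      then have "s (Suc i) < j" using smono \<open>r < N\<close> by (simp add: j_def)
      then show ?thesis using before[OF j, of "s (Suc i)"] before[OF j s0] False unfolding diff by simp
    qed
    moreover have "0 < \<rho> j" using \<rho>[OF j] \<theta> by simp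
    moreover have "u r (y i) - of_bool (r \<le> i) = (g j (y i) - \<rho> j * of_bool (r \<le> i)) / \<rho> j"
      using \<open>0 < \<rho> j\<close> \<open>r < N\<close> by (simp add: u_def j_def diff_divide_distrib)
    ultimately have "\<bar>u r (y i) - of_bool (r \<le> i)\<bar> \<le> 2 * \<sigma> / \<rho> j"
      by (simp add: abs_divide divide_right_mono)
    also have "\<dots> \<le> 2 * \<sigma> / \<theta>" using \<rho>[OF j] \<theta> \<sigma> by (intro divide_left_mono) auto
    also have "\<dots> = \<tau> / 2" using \<theta> by (simp add: \<sigma>_def)
    finally show ?thesis .
  qed (use i \<tau> in \<open>simp add: u_def\<close>)
  show ?thesis
    unfolding interval_system_def
  proof (intro exI[of _ y] conjI allI impI ballI)
    show "norm (y i) \<le> 2" if "i < N" for i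
      using x[of "s (Suc i)"] x[of "s 0"] sI[of "Suc i"] sI[of 0] that norm_triangle_ineq4[of "x (s (Suc i))" "x (s 0)"]
      by (simp add: y_def)
    show "\<bar>\<phi> (y i)\<bar> \<le> \<tau>" if "i < N" "\<phi> \<in> \<Phi>" for i \<phi>
    proof -
      have "c (s (Suc i)) \<phi> = c (s 0) \<phi>" using sI[of "Suc i"] sI[of 0] that by simp
      then have "\<lfloor>\<phi> (x (s (Suc i))) / \<tau>\<rfloor> = \<lfloor>\<phi> (x (s 0)) / \<tau>\<rfloor>" using that by (simp add: c_def)
      then have "\<bar>\<phi> (x (s (Suc i))) / \<tau> - \<phi> (x (s 0)) / \<tau>\<bar> \<le> 1" by linarith
      then have "\<bar>(\<phi> (x (s (Suc i))) - \<phi> (x (s 0))) / \<tau>\<bar> \<le> 1" by (simp add: diff_divide_distrib)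
      then show ?thesis using \<tau> linear_diff[OF lin[OF that(2)]] by (simp add: abs_divide y_def)
    qed
    fix p q assume pq: "p \<le> q" "q \<le> N"
    show "\<exists>h. linear h \<and> (\<forall>v. \<bar>h v\<bar> \<le> 2 / \<theta> * norm v) \<and> (\<forall>i<N. \<bar>h (y i) - of_bool (p \<le> i \<and> i < q)\<bar> \<le> \<tau>)"
    proof (intro exI[of _ "\<lambda>v. u p v - u q v"] conjI allI impI)
      show "linear (\<lambda>v. u p v - u q v)"
        by (rule linear_compose_sub[OF ulin ulin])
      show "\<bar>u p v - u q v\<bar> \<le> 2 / \<theta> * norm v" for v using ubdd[of p v] ubdd[of q v] by (simp add: abs_le_iff)
      fix i assume i: "i < N"
      have "of_bool (p \<le> i \<and> i < q) = (of_bool (p \<le> i) - of_bool (q \<le> i) :: real)" using pq by auto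
      then show "\<bar>u p (y i) - u q (y i) - of_bool (p \<le> i \<and> i < q)\<bar> \<le> \<tau>"
        using u[OF i, of p] u[OF i, of q] by linarith
    qed
  qed
qed

section \<open>Linear orders that turn laminar sets into intervals\<close>

definition laminar :: "'i set set \<Rightarrow> bool" where
  "laminar \<L> \<longleftrightarrow> (\<forall>A\<in>\<L>. \<forall>B\<in>\<L>. A \<inter> B = {} \<or> A \<subseteq> B \<or> B \<subseteq> A)"

text \<open>Split \<open>V\<close> along a member \<open>L\<close> whose trace is largest among the
  traces that are neither empty nor all of \<open>V\<close>, and enumerate
  \<open>V \<inter> L\<close> before the rest. A member disjoint from \<open>L\<close> or inside it
  lives in one half, where induction applies; one that contains \<open>L\<close> but not
  \<open>V\<close> has the same trace by maximality.\<close>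

lemma laminar_enumeration:
  assumes "laminar \<L>" "finite V"
  shows "\<exists>\<sigma>. bij_betw \<sigma> V {..<card V} \<and>
    (\<forall>L\<in>\<L>. \<exists>p q. p \<le> q \<and> q \<le> card V \<and> (\<forall>v\<in>V. v \<in> L \<longleftrightarrow> p \<le> \<sigma> v \<and> \<sigma> v < q))"
  using assms(2)
proof (induction "card V" arbitrary: V rule: less_induct)
  case less
  define \<P> where "\<P> = {L \<in> \<L>. L \<inter> V \<noteq> {} \<and> \<not> V \<subseteq> L}"
  show ?case
  proof (cases "\<P> = {}")
    case True
    obtain \<sigma> where \<sigma>: "bij_betw \<sigma> V {..<card V}"
      using ex_bij_betw_finite_nat[OF less.prems] by (auto simp: atLeast0LessThan)
    have "\<exists>p q. p \<le> q \<and> q \<le> card V \<and> (\<forall>v\<in>V. v \<in> L \<longleftrightarrow> p \<le> \<sigma> v \<and> \<sigma> v < q)" if "L \<in> \<L>" for L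
    proof (cases "V \<subseteq> L")
      case True
      then show ?thesis using bij_betwE[OF \<sigma>] by (intro exI[of _ 0] exI[of _ "card V"]) auto
    next
      case False
      then have "L \<inter> V = {}" using that \<open>\<P> = {}\<close> by (auto simp: \<P>_def)
      then show ?thesis by (intro exI[of _ 0] exI[of _ 0]) auto
    qed
    then show ?thesis using \<sigma> by blast
  next
    case False
    then obtain L0 where L0: "L0 \<in> \<P>" by blast
    have bound: "\<forall>L. L \<in> \<P> \<longrightarrow> card (L \<inter> V) < Suc (card V)"
      using less.prems by (auto simp: less_Suc_eq_le intro: card_mono)
    obtain L where L: "L \<in> \<P>" and max: "\<And>M. M \<in> \<P> \<Longrightarrow> card (M \<inter> V) \<le> card (L \<inter> V)"
      using Lattices_Big.ex_has_greatest_nat[OF L0 bound] by blast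
    define V1 V2 where "V1 = V \<inter> L" and "V2 = V - L"
    have fin: "finite V1" "finite V2" using less.prems by (auto simp: V1_def V2_def)
    have V: "V = V1 \<union> V2" "V1 \<inter> V2 = {}" by (auto simp: V1_def V2_def)
    have ne: "V1 \<noteq> {}" "V2 \<noteq> {}" using L by (auto simp: \<P>_def V1_def V2_def)
    have card: "card V = card V1 + card V2" using V fin by (simp add: card_Un_disjoint)
    moreover have "0 < card V1" "0 < card V2" using ne fin by (auto simp: card_gt_0_iff)
    ultimately have less': "card V1 < card V" "card V2 < card V" by auto
    obtain \<sigma>1 where \<sigma>1: "bij_betw \<sigma>1 V1 {..<card V1}"
      "\<And>M. M \<in> \<L> \<Longrightarrow> \<exists>p q. p \<le> q \<and> q \<le> card V1 \<and> (\<forall>v\<in>V1. v \<in> M \<longleftrightarrow> p \<le> \<sigma>1 v \<and> \<sigma>1 v < q)"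
      using less.hyps[OF less'(1) fin(1)] by (elim exE conjE) simp
    obtain \<sigma>2 where \<sigma>2: "bij_betw \<sigma>2 V2 {..<card V2}"
      "\<And>M. M \<in> \<L> \<Longrightarrow> \<exists>p q. p \<le> q \<and> q \<le> card V2 \<and> (\<forall>v\<in>V2. v \<in> M \<longleftrightarrow> p \<le> \<sigma>2 v \<and> \<sigma>2 v < q)"
      using less.hyps[OF less'(2) fin(2)] by (elim exE conjE) simp
    define \<sigma> where "\<sigma> v = (if v \<in> L then \<sigma>1 v else card V1 + \<sigma>2 v)" for v
    have s1: "\<sigma> v = \<sigma>1 v" "\<sigma>1 v < card V1" if "v \<in> V1" for v
      using that bij_betwE[OF \<sigma>1(1)] by (auto simp: \<sigma>_def V1_def)
    have s2: "\<sigma> v = card V1 + \<sigma>2 v" "\<sigma>2 v < card V2" if "v \<in> V2" for v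
      using that bij_betwE[OF \<sigma>2(1)] by (auto simp: \<sigma>_def V2_def)
    have "inj_on \<sigma> V"
    proof (rule inj_onI)
      fix v w assume vw: "v \<in> V" "w \<in> V" "\<sigma> v = \<sigma> w"
      then consider "v \<in> V1" "w \<in> V1" | "v \<in> V1" "w \<in> V2" | "v \<in> V2" "w \<in> V1" | "v \<in> V2" "w \<in> V2"
        using V by auto
      then show "v = w"
      proof cases
        case 1
        then show ?thesis using vw(3) s1 inj_onD[OF bij_betw_imp_inj_on[OF \<sigma>1(1)]] by simp
      next
        case 4
        then show ?thesis using vw(3) s2 inj_onD[OF bij_betw_imp_inj_on[OF \<sigma>2(1)]] by simp
      qed (use vw(3) s1 s2 in \<open>fastforce+\<close>)
    qed
    moreover have "\<sigma> ` V \<subseteq> {..<card V}" using s1 s2 V card by fastforce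
    ultimately have bij: "bij_betw \<sigma> V {..<card V}"
      by (simp add: bij_betw_def card_image card_subset_eq)
    have "\<exists>p q. p \<le> q \<and> q \<le> card V \<and> (\<forall>v\<in>V. v \<in> M \<longleftrightarrow> p \<le> \<sigma> v \<and> \<sigma> v < q)" if M: "M \<in> \<L>" for M
    proof -
      consider "V \<subseteq> M" | "M \<inter> V = {}" | "M \<in> \<P>" using M by (auto simp: \<P>_def)
      then show ?thesis
      proof cases
        case 1
        then show ?thesis using bij_betwE[OF bij] by (intro exI[of _ 0] exI[of _ "card V"]) auto
      next
        case 2
        then show ?thesis by (intro exI[of _ 0] exI[of _ 0]) auto
      next
        case 3
        have "L \<inter> M = {} \<or> M \<subseteq> L \<or> L \<subseteq> M"
          using assms(1) M L by (auto simp: laminar_def \<P>_def)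
        then show ?thesis
        proof (elim disjE)
          assume LM: "L \<inter> M = {}"
          obtain p q where pq: "p \<le> q" "q \<le> card V2" "\<And>v. v \<in> V2 \<Longrightarrow> v \<in> M \<longleftrightarrow> p \<le> \<sigma>2 v \<and> \<sigma>2 v < q"
            using \<sigma>2(2)[OF M] by blast
          have "v \<in> M \<longleftrightarrow> card V1 + p \<le> \<sigma> v \<and> \<sigma> v < card V1 + q" if "v \<in> V" for v
          proof (cases "v \<in> V1")
            case True
            then show ?thesis using s1 LM by (fastforce simp: V1_def)
          next
            case False
            then show ?thesis using s2 pq(3) V that by fastforce
          qed
          then have "\<forall>v\<in>V. v \<in> M \<longleftrightarrow> card V1 + p \<le> \<sigma> v \<and> \<sigma> v < card V1 + q" by blast
          moreover have "card V1 + p \<le> card V1 + q" "card V1 + q \<le> card V" using pq(1,2) card by simp_all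
          ultimately show ?thesis by blast
        next
          assume sub: "M \<subseteq> L"
          obtain p q where pq: "p \<le> q" "q \<le> card V1" "\<And>v. v \<in> V1 \<Longrightarrow> v \<in> M \<longleftrightarrow> p \<le> \<sigma>1 v \<and> \<sigma>1 v < q"
            using \<sigma>1(2)[OF M] by blast
          have "v \<in> M \<longleftrightarrow> p \<le> \<sigma> v \<and> \<sigma> v < q" if "v \<in> V" for v
          proof (cases "v \<in> V1")
            case True
            then show ?thesis using s1 pq by simp
          next
            case False
            then have "v \<in> V2" using that V by auto
            then show ?thesis using s2[of v] sub pq(2) by (auto simp: V2_def)
          qed
          then have "\<forall>v\<in>V. v \<in> M \<longleftrightarrow> p \<le> \<sigma> v \<and> \<sigma> v < q" by blast
          moreover have "p \<le> q" "q \<le> card V" using pq(1,2) card by simp_all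
          ultimately show ?thesis by blast
        next
          assume LM: "L \<subseteq> M"
          have "L \<inter> V = M \<inter> V"
            using LM less.prems max[OF 3] by (intro card_seteq) auto
          have "v \<in> M \<longleftrightarrow> 0 \<le> \<sigma> v \<and> \<sigma> v < card V1" if "v \<in> V" for v
          proof (cases "v \<in> L")
            case True
            then have "v \<in> V1" using \<open>v \<in> V\<close> by (simp add: V1_def)
            then show ?thesis using s1 True LM by auto
          next
            case False
            then have "v \<in> V2" "v \<notin> M" using \<open>v \<in> V\<close> \<open>L \<inter> V = M \<inter> V\<close> by (auto simp: V2_def)
            then show ?thesis using s2 by simp
          qed
          then have "\<forall>v\<in>V. v \<in> M \<longleftrightarrow> 0 \<le> \<sigma> v \<and> \<sigma> v < card V1" by blast
          moreover have "0 \<le> card V1" "card V1 \<le> card V" using card by simp_all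
          ultimately show ?thesis by blast
        qed
      qed
    qed
    then show ?thesis using bij by blast
  qed
qed

definition laminar_system ::
    "real \<Rightarrow> 'i set \<Rightarrow> 'i set set \<Rightarrow> real \<Rightarrow> ('v::real_normed_vector \<Rightarrow> real) set \<Rightarrow> ('i \<Rightarrow> 'v) \<Rightarrow> bool" where
  "laminar_system M V \<L> \<tau> \<Phi> y \<longleftrightarrow> (\<forall>i\<in>V. norm (y i) \<le> 2 \<and> (\<forall>\<phi>\<in>\<Phi>. \<bar>\<phi> (y i)\<bar> \<le> \<tau>)) \<and>
     (\<forall>L\<in>\<L>. \<exists>h. linear h \<and> (\<forall>v. \<bar>h v\<bar> \<le> M * norm v) \<and>
        (\<forall>i\<in>V. \<bar>h (y i) - of_bool (i \<in> L)\<bar> \<le> \<tau>))"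

lemma laminar_system_exists:
  assumes "\<not> superreflexive TYPE('v::real_normed_vector)"
  shows "\<exists>M>0. \<forall>(V :: 'i set) \<L> \<tau> \<Phi>. finite V \<longrightarrow> laminar \<L> \<longrightarrow> 0 < \<tau> \<longrightarrow> finite \<Phi> \<longrightarrow>
    (\<forall>\<phi>\<in>\<Phi>. linear \<phi> \<and> (\<forall>v. \<bar>\<phi> v\<bar> \<le> norm v)) \<longrightarrow> (\<exists>y :: 'i \<Rightarrow> 'v. laminar_system M V \<L> \<tau> \<Phi> y)"
proof -
  obtain \<theta> where \<theta>: "0 < \<theta>" "\<And>m \<tau>. 0 < \<tau> \<Longrightarrow> \<exists>(x :: nat \<Rightarrow> 'v) g \<rho>. step_system \<theta> m \<tau> x g \<rho>"
    using step_system_exists[OF assms] by blast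
  have "\<exists>y :: 'i \<Rightarrow> 'v. laminar_system (2 / \<theta>) V \<L> \<tau> \<Phi> y"
    if V: "finite V" and lam: "laminar \<L>" and "0 < \<tau>" "finite \<Phi>" "\<forall>\<phi>\<in>\<Phi>. linear \<phi> \<and> (\<forall>v. \<bar>\<phi> v\<bar> \<le> norm v)"
    for V :: "'i set" and \<L> \<tau> \<Phi>
  proof -
    have "\<exists>y :: nat \<Rightarrow> 'v. interval_system (2 / \<theta>) (card V) \<tau> \<Phi> y"
      by (rule interval_system_exists) (use \<theta> that in auto)
    then obtain y :: "nat \<Rightarrow> 'v" where y: "interval_system (2 / \<theta>) (card V) \<tau> \<Phi> y" ..
    obtain \<sigma> where \<sigma>: "bij_betw \<sigma> V {..<card V}"
      "\<And>L. L \<in> \<L> \<Longrightarrow> \<exists>p q. p \<le> q \<and> q \<le> card V \<and> (\<forall>v\<in>V. v \<in> L \<longleftrightarrow> p \<le> \<sigma> v \<and> \<sigma> v < q)"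
      using laminar_enumeration[OF lam V] by blast
    have \<sigma>V: "\<sigma> i < card V" if "i \<in> V" for i using bij_betwE[OF \<sigma>(1)] that by auto
    have "laminar_system (2 / \<theta>) V \<L> \<tau> \<Phi> (y \<circ> \<sigma>)"
      unfolding laminar_system_def
    proof (intro conjI ballI)
      fix i assume "i \<in> V"
      then show "norm ((y \<circ> \<sigma>) i) \<le> 2" "\<And>\<phi>. \<phi> \<in> \<Phi> \<Longrightarrow> \<bar>\<phi> ((y \<circ> \<sigma>) i)\<bar> \<le> \<tau>"
        using y \<sigma>V by (auto simp: interval_system_def)
    next
      fix L assume "L \<in> \<L>"
      then obtain p q where pq: "p \<le> q" "q \<le> card V" "\<And>v. v \<in> V \<Longrightarrow> v \<in> L \<longleftrightarrow> p \<le> \<sigma> v \<and> \<sigma> v < q"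
        using \<sigma>(2) by blast
      then obtain h where h: "linear h" "\<forall>v. \<bar>h v\<bar> \<le> 2 / \<theta> * norm v"
        "\<forall>i<card V. \<bar>h (y i) - of_bool (p \<le> i \<and> i < q)\<bar> \<le> \<tau>"
        using y unfolding interval_system_def by blast
      have "\<bar>h ((y \<circ> \<sigma>) i) - of_bool (i \<in> L)\<bar> \<le> \<tau>" if "i \<in> V" for i
        using h(3) \<sigma>V[OF that] pq(3)[OF that] by simp
      then show "\<exists>h. linear h \<and> (\<forall>v. \<bar>h v\<bar> \<le> 2 / \<theta> * norm v) \<and> (\<forall>i\<in>V. \<bar>h ((y \<circ> \<sigma>) i) - of_bool (i \<in> L)\<bar> \<le> \<tau>)"
        using h by blast
    qed
    then show ?thesis by blast
  qed
  moreover have "0 < 2 / \<theta>" using \<theta> by simp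
  ultimately show ?thesis by blast
qed

section \<open>Gluing the scales\<close>

text \<open>Tents centred at the integers of a logarithmic scale: at each \<open>s\<close> at most
  two of them are nonzero and one is at least 1/2. The \<open>1 +\<close> puts length 0 at scale
  0.\<close>

definition scale_weight :: "nat \<Rightarrow> nat \<Rightarrow> real" where
  "scale_weight n s = max 0 (1 - \<bar>log 2 (1 + real s) - real n\<bar>)"

lemma scale_weight_nonneg: "0 \<le> scale_weight n s" and scale_weight_le_1: "scale_weight n s \<le> 1"
  by (simp_all add: scale_weight_def)

lemma scale_weight_less_power:
  assumes "scale_weight n s \<noteq> 0" shows "s < 2 ^ (n + 1)"
proof -
  have "log 2 (1 + real s) < real (n + 1)" using assms by (simp add: scale_weight_def max_def split: if_splits)
  then have "1 + real s < 2 powr real (n + 1)" using log_less_iff[of 2 "1 + real s" "real (n + 1)"] by linarith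
  also have "2 powr real (n + 1) = 2 ^ (n + 1)" by (rule powr_realpow) simp
  finally have "real s < real (2 ^ (n + 1))" by simp
  then show ?thesis by (simp only: of_nat_less_iff)
qed

text \<open>From \<open>1 + s \<le> 2 ^ s\<close>. It makes the sum over all scales finite at each
  point, with the length itself as a cutoff.\<close>

lemma scale_weight_le_index:
  assumes "scale_weight n s \<noteq> 0" shows "n \<le> s"
proof (rule ccontr)
  assume "\<not> n \<le> s"
  then have n: "real s + 1 \<le> real n" by linarith
  have "1 + s \<le> 2 ^ s" using less_exp[of s] by linarith
  then have "real (1 + s) \<le> real (2 ^ s)" by (rule of_nat_mono)
  then have "log 2 (1 + real s) \<le> log 2 (2 ^ s)" by (intro log_mono) auto
  also have "\<dots> = real s" by (simp add: log_nat_power)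
  finally show False using assms n by (simp add: scale_weight_def max_def split: if_splits)
qed

lemma scale_weight_large: "\<exists>n. 1 / 2 \<le> scale_weight n s"
proof -
  define l where "l = log 2 (1 + real s)"
  have l: "0 \<le> l" by (simp add: l_def)
  define n where "n = nat \<lfloor>l + 1/2\<rfloor>"
  have "real n = of_int \<lfloor>l + 1/2\<rfloor>" using l by (simp add: n_def)
  then have "\<bar>l - real n\<bar> \<le> 1/2" by linarith
  then show ?thesis by (intro exI[of _ n]) (simp add: scale_weight_def l_def)
qed

lemma scale_weight_support:
  "{n. scale_weight n s \<noteq> 0} \<subseteq> {nat \<lfloor>log 2 (1 + real s)\<rfloor>, nat \<lfloor>log 2 (1 + real s)\<rfloor> + 1}"
proof
  fix n assume "n \<in> {n. scale_weight n s \<noteq> 0}"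
  then have "\<bar>log 2 (1 + real s) - real n\<bar> < 1" by (simp add: scale_weight_def max_def split: if_splits)
  moreover have "0 \<le> log 2 (1 + real s)" by simp
  ultimately have "int n = \<lfloor>log 2 (1 + real s)\<rfloor> \<or> int n = \<lfloor>log 2 (1 + real s)\<rfloor> + 1" by linarith
  then show "n \<in> {nat \<lfloor>log 2 (1 + real s)\<rfloor>, nat \<lfloor>log 2 (1 + real s)\<rfloor> + 1}" by auto
qed

lemma sum_le_small_support:
  fixes g :: "'i \<Rightarrow> real"
  assumes "finite N" "finite K" "\<And>n. n \<in> N \<Longrightarrow> n \<notin> K \<Longrightarrow> g n = 0" "\<And>n. g n \<le> b" "0 \<le> b" "card K \<le> k"
  shows "sum g N \<le> real k * b"
proof -
  have "sum g N = sum g (N \<inter> K)" by (rule sum.mono_neutral_right) (use assms in auto)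
  also have "\<dots> \<le> real (card (N \<inter> K)) * b" using sum_bounded_above[of "N \<inter> K" g b] assms(4) by simp
  also have "\<dots> \<le> real k * b"
    using card_mono[OF assms(2), of "N \<inter> K"] assms(5,6) by (intro mult_right_mono) auto
  finally show ?thesis .
qed

lemma sum_scale_weight: "finite N \<Longrightarrow> (\<Sum>n\<in>N. scale_weight n s) \<le> 2"
  using sum_le_small_support[of N "{nat \<lfloor>log 2 (1 + real s)\<rfloor>, nat \<lfloor>log 2 (1 + real s)\<rfloor> + 1}" "\<lambda>n. scale_weight n s" 1 2]
    scale_weight_support[of s] scale_weight_le_1 by auto

text \<open>The derivative of the logarithm: passing from \<open>s'\<close> to \<open>s\<close>
  changes a weight by order \<open>(s - s') / (s' + 1)\<close>, and at most four weights are
  concerned. The factor on the left is the size of the mass that the weights multiply.\<close>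

lemma sum_scale_weight_diff:
  assumes "finite N" "s' \<le> s"
  shows "(\<Sum>n\<in>N. \<bar>scale_weight n s - scale_weight n s'\<bar>) * (real s' + 1) \<le> 8 * (real s - real s')"
proof -
  let ?K = "\<lambda>s. {nat \<lfloor>log 2 (1 + real s)\<rfloor>, nat \<lfloor>log 2 (1 + real s)\<rfloor> + 1}"
  define l where "l = log 2 (1 + real s) - log 2 (1 + real s')"
  have l0: "0 \<le> l" using assms by (simp add: l_def)
  have diff: "\<bar>scale_weight n s - scale_weight n s'\<bar> \<le> l" for n
  proof -
    have "\<bar>max 0 (1 - \<bar>a - k\<bar>) - max 0 (1 - \<bar>b - k\<bar>)\<bar> \<le> a - b" if "b \<le> a" for a b k :: real
      using that by (auto simp: max_def abs_if split: if_splits)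
    then show ?thesis using l0 unfolding scale_weight_def l_def by (simp only: diff_ge_0_iff_ge)
  qed
  have "(\<Sum>n\<in>N. \<bar>scale_weight n s - scale_weight n s'\<bar>) \<le> real 4 * l"
  proof (rule sum_le_small_support[OF assms(1), of "?K s \<union> ?K s'"])
    fix n assume "n \<notin> ?K s \<union> ?K s'"
    then show "\<bar>scale_weight n s - scale_weight n s'\<bar> = 0"
    proof -
      have "scale_weight n s = 0" using \<open>n \<notin> _\<close> scale_weight_support[of s] by blast
      moreover have "scale_weight n s' = 0" using \<open>n \<notin> _\<close> scale_weight_support[of s'] by blast
      ultimately show ?thesis by simp
    qed
  next
    have "card (?K s \<union> ?K s') \<le> card (?K s) + card (?K s')" by (rule card_Un_le)
    also have "\<dots> \<le> 4" by (simp add: card_insert_if)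
    finally show "card (?K s \<union> ?K s') \<le> 4" .
  qed (use diff l0 in auto)
  moreover have "l * (real s' + 1) \<le> 2 * (real s - real s')"
  proof -
    define u where "u = (real s - real s') / (1 + real s')"
    have u: "0 \<le> u" using assms by (simp add: u_def)
    have "1 + u = (1 + real s) / (1 + real s')" by (simp add: u_def field_simps)
    then have "l = ln (1 + u) / ln 2" by (simp add: l_def log_def ln_div diff_divide_distrib)
    also have "\<dots> \<le> u / ln 2" using ln_add_one_self_le_self[OF u] by (intro divide_right_mono) auto
    also have "\<dots> \<le> u / (1/2)" using u ln2_ge_two_thirds by (intro divide_left_mono) auto
    finally have "l * (1 + real s') \<le> 2 * u * (1 + real s')" by (intro mult_right_mono) auto
    also have "\<dots> = 2 * (real s - real s')" by (simp add: u_def)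
    finally show ?thesis by (simp add: add.commute)
  qed
  ultimately have "(\<Sum>n\<in>N. \<bar>scale_weight n s - scale_weight n s'\<bar>) * (real s' + 1) \<le> real 4 * l * (real s' + 1)"
    by (intro mult_right_mono) auto
  also have "\<dots> = 4 * (l * (real s' + 1))" by simp
  also have "\<dots> \<le> 4 * (2 * (real s - real s'))"
    using \<open>l * (real s' + 1) \<le> 2 * (real s - real s')\<close> by (rule mult_left_mono) simp
  finally show ?thesis by simp
qed

text \<open>The interface between the group and the Banach space. The mass on \<open>L\<close> is a
  sum over any finite \<open>V\<close> containing the support, which avoids infinite sums; detection
  is asked only for the point farther out, as the two can be exchanged.\<close>

locale interval_coordinates =
  fixes A :: "'a set" and len :: "'a \<Rightarrow> nat" and d :: "'a \<Rightarrow> 'a \<Rightarrow> real"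
    and F :: "'a \<Rightarrow> 'i \<Rightarrow> real" and U :: "nat \<Rightarrow> 'i set" and \<L> :: "'i set set" and C c :: real
  assumes finite_U: "finite (U R)"
    and support: "x \<in> A \<Longrightarrow> len x \<le> R \<Longrightarrow> i \<notin> U R \<Longrightarrow> F x i = 0"
    and finite_ball: "finite {x \<in> A. len x \<le> R}"
    and C_pos: "0 < C" and c_pos: "0 < c"
    and lipschitz: "x \<in> A \<Longrightarrow> y \<in> A \<Longrightarrow> finite V \<Longrightarrow> (\<Sum>i\<in>V. \<bar>F x i - F y i\<bar>) \<le> C * d x y"
    and mass: "x \<in> A \<Longrightarrow> finite V \<Longrightarrow> (\<Sum>i\<in>V. \<bar>F x i\<bar>) \<le> C * (real (len x) + 1)"
    and len_lipschitz: "x \<in> A \<Longrightarrow> y \<in> A \<Longrightarrow> \<bar>real (len x) - real (len y)\<bar> \<le> d x y"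
    and d_sym: "x \<in> A \<Longrightarrow> y \<in> A \<Longrightarrow> d x y = d y x"
    and d_refl: "x \<in> A \<Longrightarrow> d x x = 0"
    and d_discrete: "x \<in> A \<Longrightarrow> y \<in> A \<Longrightarrow> x \<noteq> y \<Longrightarrow> 1 \<le> d x y"
    and laminar: "laminar \<L>"
    and detect: "x \<in> A \<Longrightarrow> y \<in> A \<Longrightarrow> x \<noteq> y \<Longrightarrow> len y \<le> len x \<Longrightarrow>
      \<exists>L\<in>\<L>. (\<forall>i\<in>L. F y i = 0) \<and>
        (\<forall>V. finite V \<longrightarrow> (\<forall>i. i \<notin> V \<longrightarrow> F x i = 0) \<longrightarrow> c * d x y \<le> (\<Sum>i\<in>V \<inter> L. F x i))"
begin

text \<open>Points of nonzero weight at scale \<open>n\<close> have length below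
  \<open>2 ^ (n + 1)\<close>, so their coordinates are supported here.\<close>

definition V :: "nat \<Rightarrow> 'i set" where "V n = U (2 ^ (n + 1))"

definition block :: "(nat \<Rightarrow> 'i \<Rightarrow> 'v::real_normed_vector) \<Rightarrow> nat \<Rightarrow> 'a \<Rightarrow> 'v" where
  "block e n x = (\<Sum>i\<in>V n. (scale_weight n (len x) * F x i) *\<^sub>R e n i)"

definition partial :: "(nat \<Rightarrow> 'i \<Rightarrow> 'v::real_normed_vector) \<Rightarrow> nat \<Rightarrow> 'a \<Rightarrow> 'v" where
  "partial e m x = (\<Sum>n\<le>m. block e n x)"

definition coeff :: "nat \<Rightarrow> 'a \<Rightarrow> 'a \<Rightarrow> 'i \<Rightarrow> real" where
  "coeff n x y i = scale_weight n (len x) * F x i - scale_weight n (len y) * F y i"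

lemma finite_V: "finite (V n)" by (simp add: V_def finite_U)

lemma block_diff: "block e n x - block e n y = (\<Sum>i\<in>V n. coeff n x y i *\<^sub>R e n i)"
  by (simp add: block_def coeff_def scaleR_diff_left sum_subtractf)

lemma block_eq_0: "scale_weight n (len x) = 0 \<Longrightarrow> block e n x = 0"
  by (simp add: block_def)

lemma partial_eq:
  assumes "len x \<le> m" shows "partial e m x = partial e (len x) x"
  unfolding partial_def
  by (rule sum.mono_neutral_right) (use assms scale_weight_le_index in \<open>fastforce intro: block_eq_0\<close>)+

lemma weighted_mass:
  assumes "x \<in> A" shows "(\<Sum>i\<in>V n. \<bar>scale_weight n (len x) * F x i\<bar>) \<le> C * 2 ^ (n + 1)"
proof (cases "scale_weight n (len x) = 0")
  case False
  then have "Suc (len x) \<le> 2 ^ (n + 1)" using scale_weight_less_power by (simp add: Suc_le_eq)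
  then have "real (Suc (len x)) \<le> real (2 ^ (n + 1))" by (rule of_nat_mono)
  then have len: "real (len x) + 1 \<le> 2 ^ (n + 1)" by simp
  have "(\<Sum>i\<in>V n. \<bar>scale_weight n (len x) * F x i\<bar>) \<le> (\<Sum>i\<in>V n. \<bar>F x i\<bar>)"
  proof (rule sum_mono)
    fix i show "\<bar>scale_weight n (len x) * F x i\<bar> \<le> \<bar>F x i\<bar>"
      using scale_weight_le_1[of n "len x"] scale_weight_nonneg[of n "len x"]
      by (simp add: abs_mult mult_left_le_one_le)
  qed
  also have "\<dots> \<le> C * (real (len x) + 1)" by (rule mass[OF assms finite_V])
  also have "\<dots> \<le> C * 2 ^ (n + 1)" using C_pos len by (intro mult_left_mono) auto
  finally show ?thesis .
qed (use C_pos in simp)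

lemma sum_coeff_le:
  assumes "x \<in> A" "y \<in> A" shows "(\<Sum>i\<in>V n. \<bar>coeff n x y i\<bar>) \<le> C * 2 ^ (n + 2)"
proof -
  have "(\<Sum>i\<in>V n. \<bar>coeff n x y i\<bar>) \<le> (\<Sum>i\<in>V n. \<bar>scale_weight n (len x) * F x i\<bar> + \<bar>scale_weight n (len y) * F y i\<bar>)"
    unfolding coeff_def by (intro sum_mono abs_triangle_ineq4)
  also have "\<dots> \<le> C * 2 ^ (n + 1) + C * 2 ^ (n + 1)"
    unfolding sum.distrib by (intro add_mono weighted_mass assms)
  finally show ?thesis by simp
qed

text \<open>A product rule. The change of the weights is charged to the mass of \<open>y\<close>,
  the shorter point, which is what \<open>sum_scale_weight_diff\<close> can pay for; the two parts
  contribute 2 and 8 to the constant.\<close>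

lemma sum_coeff_lipschitz:
  assumes xy: "x \<in> A" "y \<in> A" "len y \<le> len x" and N: "finite N"
  shows "(\<Sum>n\<in>N. \<Sum>i\<in>V n. \<bar>coeff n x y i\<bar>) \<le> 10 * C * d x y"
proof -
  have "(\<Sum>i\<in>V n. \<bar>coeff n x y i\<bar>) \<le> scale_weight n (len x) * (C * d x y) +
      \<bar>scale_weight n (len x) - scale_weight n (len y)\<bar> * (C * (real (len y) + 1))" for n
  proof -
    have "(\<Sum>i\<in>V n. \<bar>coeff n x y i\<bar>) \<le> (\<Sum>i\<in>V n. scale_weight n (len x) * \<bar>F x i - F y i\<bar> +
        \<bar>scale_weight n (len x) - scale_weight n (len y)\<bar> * \<bar>F y i\<bar>)"
    proof (rule sum_mono)
      fix i
      have "coeff n x y i = scale_weight n (len x) * (F x i - F y i) + (scale_weight n (len x) - scale_weight n (len y)) * F y i"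
        by (simp add: coeff_def algebra_simps)
      then show "\<bar>coeff n x y i\<bar> \<le> scale_weight n (len x) * \<bar>F x i - F y i\<bar> +
        \<bar>scale_weight n (len x) - scale_weight n (len y)\<bar> * \<bar>F y i\<bar>"
        using abs_triangle_ineq[of "scale_weight n (len x) * (F x i - F y i)" "(scale_weight n (len x) - scale_weight n (len y)) * F y i"]
        by (simp add: abs_mult scale_weight_nonneg)
    qed
    also have "\<dots> = scale_weight n (len x) * (\<Sum>i\<in>V n. \<bar>F x i - F y i\<bar>) +
        \<bar>scale_weight n (len x) - scale_weight n (len y)\<bar> * (\<Sum>i\<in>V n. \<bar>F y i\<bar>)"
      by (simp add: sum.distrib sum_distrib_left)
    also have "\<dots> \<le> scale_weight n (len x) * (C * d x y) +
        \<bar>scale_weight n (len x) - scale_weight n (len y)\<bar> * (C * (real (len y) + 1))"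
      by (intro add_mono mult_left_mono lipschitz mass finite_V xy scale_weight_nonneg abs_ge_zero)
    finally show ?thesis .
  qed
  then have "(\<Sum>n\<in>N. \<Sum>i\<in>V n. \<bar>coeff n x y i\<bar>) \<le> (\<Sum>n\<in>N. scale_weight n (len x) * (C * d x y) +
      \<bar>scale_weight n (len x) - scale_weight n (len y)\<bar> * (C * (real (len y) + 1)))"
    by (rule sum_mono)
  also have "\<dots> = (\<Sum>n\<in>N. scale_weight n (len x)) * (C * d x y) +
      C * ((\<Sum>n\<in>N. \<bar>scale_weight n (len x) - scale_weight n (len y)\<bar>) * (real (len y) + 1))"
    by (simp add: sum.distrib sum_distrib_right sum_distrib_left mult_ac)
  also have "\<dots> \<le> 2 * (C * d x y) + C * (8 * (real (len x) - real (len y)))"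
  proof (intro add_mono mult_right_mono mult_left_mono)
    show "0 \<le> C * d x y" using C_pos len_lipschitz[OF xy(1,2)] by simp
  qed (use C_pos sum_scale_weight[OF N] sum_scale_weight_diff[OF N xy(3)] in auto)
  also have "\<dots> \<le> 2 * (C * d x y) + C * (8 * d x y)"
    using C_pos len_lipschitz[OF xy(1,2)] by (intro add_left_mono mult_left_mono) auto
  finally show ?thesis by simp
qed

lemma norming_functional_choice:
  obtains nf :: "'v::real_normed_vector \<Rightarrow> 'v \<Rightarrow> real" where
    "\<And>a. linear (nf a)" "\<And>a v. \<bar>nf a v\<bar> \<le> norm v" "\<And>a. nf a a = norm a"
proof -
  have "\<forall>a :: 'v. \<exists>g. linear g \<and> (\<forall>v. \<bar>g v\<bar> \<le> norm v) \<and> g a = norm a"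
    using norming_functional by blast
  then obtain nf where "\<forall>a :: 'v. linear (nf a) \<and> (\<forall>v. \<bar>nf a v\<bar> \<le> norm v) \<and> nf a a = norm a"
    by (rule choice[THEN exE])
  then show thesis using that by blast
qed

text \<open>The vectors of each scale are chosen so that the functionals norming everything built
  before almost vanish on them. The prefixes over the scales are then dominated by the whole sum, as
  for a monotone basis; so a single block can be recovered at bounded cost, and the functional of a
  detecting set is applied to that block.\<close>

theorem embedding:
  assumes "\<not> superreflexive TYPE('v::real_normed_vector)"
  obtains f :: "'a \<Rightarrow> 'v::real_normed_vector" and c' C' where "0 < c'"
    "\<And>x y. x \<in> A \<Longrightarrow> y \<in> A \<Longrightarrow> c' * d x y \<le> norm (f x - f y)"
    "\<And>x y. x \<in> A \<Longrightarrow> y \<in> A \<Longrightarrow> norm (f x - f y) \<le> C' * d x y"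
proof -
  obtain M where M: "0 < M" and system: "\<forall>(V :: 'i set) \<L> \<tau> \<Phi>. finite V \<longrightarrow> laminar \<L> \<longrightarrow> 0 < \<tau> \<longrightarrow> finite \<Phi> \<longrightarrow>
    (\<forall>\<phi>\<in>\<Phi>. linear \<phi> \<and> (\<forall>v. \<bar>\<phi> v\<bar> \<le> norm v)) \<longrightarrow> (\<exists>y :: 'i \<Rightarrow> 'v. laminar_system M V \<L> \<tau> \<Phi> y)"
    using laminar_system_exists[OF assms, where 'i = 'i] by blast
  obtain nf :: "'v \<Rightarrow> 'v \<Rightarrow> real" where
    nf: "\<And>a. linear (nf a)" "\<And>a v. \<bar>nf a v\<bar> \<le> norm v" "\<And>a. nf a a = norm a"
    by (rule norming_functional_choice) blast
  \<comment> \<open>Of the \<open>c * d x y / 2\<close> found by the detecting functional, \<eta>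
    uses at most a quarter and the later term \<open>2 * M * \<eta>\<close> another quarter,
    distances being at least 1; half is left.\<close>
  define \<eta> where "\<eta> = min (c / 8) (c / (16 * M))"
  have \<eta>: "0 < \<eta>" "\<eta> \<le> c / 8" "\<eta> \<le> c / (16 * M)" using c_pos M by (auto simp: \<eta>_def)
  \<comment> \<open>A block has coefficient mass at most \<open>C * 2 ^ (n + 2)\<close>, so with
    this tolerance its error is at most \<open>\<eta> * (1 / 2) ^ Suc n\<close>, and all errors add
    up to at most \<eta>.\<close>
  define \<tau> where "\<tau> n = \<eta> / (C * 2 ^ (n + 2)) * (1 / 2) ^ Suc n" for n
  have \<tau>_pos: "0 < \<tau> n" for n using \<eta> C_pos by (simp add: \<tau>_def)
  have \<tau>_mass: "C * 2 ^ (n + 2) * \<tau> n = \<eta> * (1 / 2) ^ Suc n" for n using C_pos by (simp add: \<tau>_def)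
  \<comment> \<open>Functionals norming all differences of earlier prefixes; finitely many, since a
    prefix vanishes far out and balls are finite.\<close>
  define \<Phi> where "\<Phi> e n = nf ` (\<Union>m<n. (\<lambda>(a, b). a - b) ` (partial e m ` A \<times> partial e m ` A))" for e :: "nat \<Rightarrow> 'i \<Rightarrow> 'v" and n
  have \<Phi>_finite: "finite (\<Phi> e n)" for e n
  proof -
    have fin: "finite (partial e m ` A)" for m
    proof (rule finite_subset)
      show "partial e m ` A \<subseteq> insert 0 (partial e m ` {x \<in> A. len x \<le> 2 ^ (m + 1)})"
      proof
        fix v assume "v \<in> partial e m ` A"
        then obtain x where x: "x \<in> A" "v = partial e m x" by blast
        show "v \<in> insert 0 (partial e m ` {x \<in> A. len x \<le> 2 ^ (m + 1)})"
        proof (cases "len x \<le> 2 ^ (m + 1)")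
          case False
          have "block e n x = 0" if "n \<le> m" for n
          proof (rule block_eq_0, rule ccontr)
            assume "scale_weight n (len x) \<noteq> 0"
            then have "len x < 2 ^ (n + 1)" by (rule scale_weight_less_power)
            also have "\<dots> \<le> 2 ^ (m + 1)" using that by (intro power_increasing) auto
            finally show False using False by simp
          qed
          then show ?thesis by (simp add: x partial_def)
        qed (use x in blast)
      qed
      show "finite (insert 0 (partial e m ` {x \<in> A. len x \<le> 2 ^ (m + 1)}))" using finite_ball by simp
    qed
    then show ?thesis unfolding \<Phi>_def by (intro fin finite_cartesian_product finite_UN_I finite_imageI) auto
  qed
  \<comment> \<open>Recursion over the scales: \<open>\<Phi> e n\<close> reads only the blocks below
    \<open>n\<close>.\<close>
  have "\<exists>e. \<forall>n. laminar_system M (V n) \<L> (\<tau> n) (\<Phi> e n) (e n)"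
  proof (rule dependent_wellorder_choice)
    fix r :: "'i \<Rightarrow> 'v" and f g :: "nat \<Rightarrow> 'i \<Rightarrow> 'v" and n :: nat
    assume fg: "\<And>m. m < n \<Longrightarrow> f m = g m"
    have "partial f m = partial g m" if "m < n" for m
      unfolding partial_def[abs_def] block_def using fg that by (auto intro!: ext sum.cong)
    then have "\<Phi> f n = \<Phi> g n" by (simp add: \<Phi>_def)
    then show "laminar_system M (V n) \<L> (\<tau> n) (\<Phi> f n) r = laminar_system M (V n) \<L> (\<tau> n) (\<Phi> g n) r" by simp
  next
    fix n :: nat and f :: "nat \<Rightarrow> 'i \<Rightarrow> 'v"
    show "\<exists>r. laminar_system M (V n) \<L> (\<tau> n) (\<Phi> f n) r"
      by (rule system[rule_format, OF finite_V laminar \<tau>_pos \<Phi>_finite]) (auto simp: \<Phi>_def nf)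
  qed
  then obtain e where e: "\<And>n. laminar_system M (V n) \<L> (\<tau> n) (\<Phi> e n) (e n)" by blast
  have e_norm: "norm (e n i) \<le> 2" if "i \<in> V n" for n i
    using e that by (simp add: laminar_system_def)
  have e_\<Phi>: "\<bar>\<phi> (e n i)\<bar> \<le> \<tau> n" if "i \<in> V n" "\<phi> \<in> \<Phi> e n" for n i \<phi>
    using e that by (simp add: laminar_system_def)
  define f where "f x = partial e (len x) x" for x
  define z where "z n x y = block e n x - block e n y" for n x y
  have f_diff: "f x - f y = (\<Sum>n\<le>K. z n x y)" if "len x \<le> K" "len y \<le> K" for x y K
    using partial_eq[OF that(1), of e] partial_eq[OF that(2), of e]
    by (simp add: f_def z_def partial_def sum_subtractf)
  have upper: "norm (f x - f y) \<le> 20 * C * d x y" if "x \<in> A" "y \<in> A" "len y \<le> len x" for x y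
  proof -
    have "norm (z n x y) \<le> 2 * (\<Sum>i\<in>V n. \<bar>coeff n x y i\<bar>)" for n
      unfolding z_def block_diff sum_distrib_left
    proof (rule sum_norm_le)
      fix i assume "i \<in> V n"
      then show "norm (coeff n x y i *\<^sub>R e n i) \<le> 2 * \<bar>coeff n x y i\<bar>"
        using e_norm mult_left_mono[of "norm (e n i)" 2 "\<bar>coeff n x y i\<bar>"] by simp
    qed
    then have "norm (f x - f y) \<le> (\<Sum>n\<le>len x. 2 * (\<Sum>i\<in>V n. \<bar>coeff n x y i\<bar>))"
      unfolding f_diff[OF order_refl that(3)] by (intro sum_norm_le)
    also have "\<dots> \<le> 2 * (10 * C * d x y)"
      unfolding sum_distrib_left[symmetric] by (intro mult_left_mono sum_coeff_lipschitz that) auto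
    finally show ?thesis by simp
  qed
  \<comment> \<open>The functional norming the prefix lies in \<open>\<Phi> e n\<close> for every
    later scale \<open>n\<close>, so the later blocks change its value by at most \<eta>.\<close>
  have prefix: "norm (partial e m x - partial e m y) \<le> norm (f x - f y) + \<eta>" if xy: "x \<in> A" "y \<in> A" for m x y
  proof -
    define K where "K = max m (max (len x) (len y))"
    have K: "len x \<le> K" "len y \<le> K" "m \<le> K" by (auto simp: K_def)
    define \<phi> where "\<phi> = nf (partial e m x - partial e m y)"
    have \<phi>: "linear \<phi>" by (simp add: \<phi>_def nf)
    have "f x - f y = (\<Sum>n\<in>{..m} \<union> {m<..K}. z n x y)"
      using f_diff[OF K(1,2)] ivl_disj_un_one(3)[OF K(3)] by simp
    also have "\<dots> = (partial e m x - partial e m y) + (\<Sum>n\<in>{m<..K}. z n x y)"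
      by (subst sum.union_disjoint) (auto simp: partial_def z_def sum_subtractf)
    finally have "\<phi> (f x - f y) = norm (partial e m x - partial e m y) + (\<Sum>n\<in>{m<..K}. \<phi> (z n x y))"
      by (simp add: linear_add[OF \<phi>] linear_sum[OF \<phi>]) (simp add: \<phi>_def nf)
    moreover have "\<bar>\<phi> (f x - f y)\<bar> \<le> norm (f x - f y)" by (simp add: \<phi>_def nf)
    moreover have "\<bar>\<Sum>n\<in>{m<..K}. \<phi> (z n x y)\<bar> \<le> \<eta>"
    proof -
      have "\<bar>\<Sum>n\<in>{m<..K}. \<phi> (z n x y)\<bar> \<le> (\<Sum>n\<in>{m<..K}. \<eta> * (1 / 2) ^ Suc n)"
      proof (rule order_trans[OF sum_abs sum_mono])
        fix n assume "n \<in> {m<..K}"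
        then have mem: "\<phi> \<in> \<Phi> e n" using xy by (auto simp: \<Phi>_def \<phi>_def)
        have "\<bar>\<phi> (z n x y)\<bar> \<le> (\<Sum>i\<in>V n. \<bar>coeff n x y i\<bar> * \<tau> n)"
          unfolding z_def block_diff linear_sum[OF \<phi>] linear_scale[OF \<phi>]
        proof (rule order_trans[OF sum_abs sum_mono])
          fix i assume "i \<in> V n"
          then show "\<bar>coeff n x y i *\<^sub>R \<phi> (e n i)\<bar> \<le> \<bar>coeff n x y i\<bar> * \<tau> n"
            using e_\<Phi>[OF _ mem] by (simp add: abs_mult mult_left_mono)
        qed
        also have "\<dots> \<le> C * 2 ^ (n + 2) * \<tau> n"
          unfolding sum_distrib_right[symmetric]
          using \<tau>_pos[of n] by (intro mult_right_mono sum_coeff_le xy) auto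
        finally show "\<bar>\<phi> (z n x y)\<bar> \<le> \<eta> * (1 / 2) ^ Suc n" unfolding \<tau>_mass .
      qed
      also have "\<dots> = \<eta> * (\<Sum>n\<in>{m<..K}. (1 / 2) ^ Suc n)" by (rule sum_distrib_left[symmetric])
      also have "\<dots> \<le> \<eta> * 1"
      proof (rule mult_left_mono)
        have "(\<Sum>n\<in>{m<..K}. (1 / 2) ^ Suc n) \<le> (suminf (\<lambda>n. (1 / 2) ^ Suc n) :: real)"
          by (rule sum_le_suminf[OF sums_summable[OF power_half_series]]) auto
        then show "(\<Sum>n\<in>{m<..K}. (1 / 2) ^ Suc n) \<le> (1 :: real)" using sums_unique[OF power_half_series] by simp
      qed (use \<eta> in simp)
      finally show ?thesis by simp
    qed
    ultimately show ?thesis by linarith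
  qed
  have lower: "c / (8 * M) * d x y \<le> norm (f x - f y)" if xy: "x \<in> A" "y \<in> A" "len y \<le> len x" "x \<noteq> y" for x y
  proof -
    obtain n where n: "1 / 2 \<le> scale_weight n (len x)" using scale_weight_large by blast
    then have "len x < 2 ^ (n + 1)" by (intro scale_weight_less_power) auto
    then have supp: "F x i = 0" if "i \<notin> V n" for i using support[OF xy(1), of "2 ^ (n + 1)"] that by (simp add: V_def)
    obtain L where L: "L \<in> \<L>" "\<And>i. i \<in> L \<Longrightarrow> F y i = 0" "c * d x y \<le> (\<Sum>i\<in>V n \<inter> L. F x i)"
      using detect[OF xy(1,2,4,3)] finite_V supp by blast
    obtain h where h: "linear h" "\<And>v. \<bar>h v\<bar> \<le> M * norm v" "\<And>i. i \<in> V n \<Longrightarrow> \<bar>h (e n i) - of_bool (i \<in> L)\<bar> \<le> \<tau> n"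
      using e[of n] L(1) unfolding laminar_system_def by blast
    have dist1: "1 \<le> d x y" using d_discrete xy by simp
    have "c * d x y / 2 - \<eta> \<le> h (z n x y)"
    proof -
      have "h (z n x y) = (\<Sum>i\<in>V n. coeff n x y i * of_bool (i \<in> L)) + (\<Sum>i\<in>V n. coeff n x y i * (h (e n i) - of_bool (i \<in> L)))"
        unfolding z_def block_diff linear_sum[OF h(1)] linear_scale[OF h(1)] sum.distrib[symmetric]
        by (simp add: algebra_simps)
      \<comment> \<open>The weights of \<open>x\<close> and \<open>y\<close> at scale
        \<open>n\<close> may differ, so a mere excess of mass of \<open>x\<close> over
        \<open>y\<close> on \<open>L\<close> could be cancelled; with \<open>F y\<close> zero there,
        only \<open>x\<close> is seen.\<close>
      moreover have "(\<Sum>i\<in>V n. coeff n x y i * of_bool (i \<in> L)) = scale_weight n (len x) * (\<Sum>i\<in>V n \<inter> L. F x i)"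
      proof -
        have "(\<Sum>i\<in>V n. coeff n x y i * of_bool (i \<in> L)) = (\<Sum>i\<in>V n \<inter> L. coeff n x y i)"
          by (rule sum.mono_neutral_cong_right) (use finite_V in auto)
        also have "\<dots> = (\<Sum>i\<in>V n \<inter> L. scale_weight n (len x) * F x i)"
          by (rule sum.cong) (auto simp: coeff_def L(2))
        finally show ?thesis by (simp add: sum_distrib_left)
      qed
      moreover have "1 / 2 * (c * d x y) \<le> scale_weight n (len x) * (\<Sum>i\<in>V n \<inter> L. F x i)"
        using n L(3) c_pos dist1 by (intro mult_mono) auto
      moreover have "\<bar>\<Sum>i\<in>V n. coeff n x y i * (h (e n i) - of_bool (i \<in> L))\<bar> \<le> \<eta>"
      proof -
        have "\<bar>\<Sum>i\<in>V n. coeff n x y i * (h (e n i) - of_bool (i \<in> L))\<bar> \<le> (\<Sum>i\<in>V n. \<bar>coeff n x y i\<bar> * \<tau> n)"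
        proof (rule order_trans[OF sum_abs sum_mono])
          fix i assume "i \<in> V n"
          then show "\<bar>coeff n x y i * (h (e n i) - of_bool (i \<in> L))\<bar> \<le> \<bar>coeff n x y i\<bar> * \<tau> n"
            unfolding abs_mult by (intro mult_left_mono h(3)) auto
        qed
        also have "\<dots> \<le> C * 2 ^ (n + 2) * \<tau> n"
          unfolding sum_distrib_right[symmetric]
          using \<tau>_pos[of n] by (intro mult_right_mono sum_coeff_le xy) auto
        also have "\<dots> \<le> \<eta>" unfolding \<tau>_mass using \<eta> by (simp add: mult_left_le power_le_one del: power_Suc)
        finally show ?thesis .
      qed
      ultimately show ?thesis by linarith
    qed
    moreover have "\<eta> \<le> c * d x y / 8"
    proof -
      have "c * 1 \<le> c * d x y" using c_pos dist1 by (intro mult_left_mono) auto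
      then show ?thesis using \<eta>(2) by simp
    qed
    moreover have "h (z n x y) \<le> M * norm (z n x y)" using h(2)[of "z n x y"] by simp
    \<comment> \<open>A block is the difference of two consecutive prefixes; scale 0 is itself a
      prefix.\<close>
    moreover have "norm (z n x y) \<le> 2 * (norm (f x - f y) + \<eta>)"
    proof (cases n)
      case 0
      then have "norm (z n x y) = norm (partial e 0 x - partial e 0 y)" by (simp add: z_def partial_def)
      also have "\<dots> \<le> norm (f x - f y) + \<eta>" by (rule prefix[OF xy(1,2)])
      also have "\<dots> \<le> 2 * (norm (f x - f y) + \<eta>)" using \<eta>(1) by simp
      finally show ?thesis .
    next
      case (Suc m)
      have "z n x y = (partial e (Suc m) x - partial e (Suc m) y) - (partial e m x - partial e m y)"
        by (simp add: z_def partial_def Suc)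
      then show ?thesis
        using prefix[OF xy(1,2), of m] prefix[OF xy(1,2), of "Suc m"]
          norm_triangle_ineq4[of "partial e (Suc m) x - partial e (Suc m) y" "partial e m x - partial e m y"] by simp
    qed
    moreover have "M * norm (z n x y) \<le> M * (2 * (norm (f x - f y) + \<eta>))"
      using calculation(4) M by (intro mult_left_mono) auto
    moreover have "M * \<eta> \<le> c * d x y / 16"
    proof -
      have "M * \<eta> \<le> M * (c / (16 * M))" using \<eta>(3) M by (intro mult_left_mono) auto
      also have "\<dots> = c / 16" using M by simp
      also have "\<dots> \<le> c * d x y / 16" using c_pos dist1 by simp
      finally show ?thesis .
    qed
    ultimately have "c * d x y / 4 \<le> 2 * (M * norm (f x - f y))" by (simp add: algebra_simps)
    then show ?thesis using M by (simp add: field_simps)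
  qed
  show thesis
  proof (rule that[of "c / (8 * M)" f "20 * C"])
    show "0 < c / (8 * M)" using c_pos M by simp
    fix x y assume xy: "x \<in> A" "y \<in> A"
    show "c / (8 * M) * d x y \<le> norm (f x - f y)"
      using lower[OF xy] lower[OF xy(2,1)] d_sym[OF xy] d_refl[OF xy(1)] norm_minus_commute[of "f x" "f y"]
      by (cases "x = y"; cases "len y \<le> len x") auto
    show "norm (f x - f y) \<le> 20 * C * d x y"
      using upper[OF xy] upper[OF xy(2,1)] d_sym[OF xy] norm_minus_commute[of "f x" "f y"]
      by (cases "len y \<le> len x") auto
  qed
qed

end

section \<open>Random walks towards the base point of a hyperbolic graph\<close>

definition uniform :: "'a set \<Rightarrow> 'a \<Rightarrow> real" where
  "uniform S u = of_bool (u \<in> S) / real (card S)"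

lemma uniform_nonneg: "0 \<le> uniform S u" by (simp add: uniform_def)

lemma sum_uniform:
  assumes "finite T" "S \<subseteq> T" "S \<noteq> {}" shows "(\<Sum>u\<in>T. uniform S u) = 1"
proof -
  have "finite S" using assms finite_subset by blast
  have "(\<Sum>u\<in>T. uniform S u) = (\<Sum>u\<in>S. 1 / real (card S))"
    by (rule sum.mono_neutral_cong_right) (use assms in \<open>auto simp: uniform_def\<close>)
  then show ?thesis using assms(3) \<open>finite S\<close> by simp
qed

text \<open>The common point carries mass at least \<open>1 / N\<close> under both measures, and the
  l1 distance is 2 minus twice the common mass.\<close>

lemma uniform_overlap:
  assumes T: "finite T" "P \<subseteq> T" "Q \<subseteq> T" and u: "u \<in> P" "u \<in> Q"
    and card: "card P \<le> N" "card Q \<le> N"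
  shows "(\<Sum>w\<in>T. \<bar>uniform P w - uniform Q w\<bar>) \<le> 2 * (1 - 1 / real N)"
proof -
  have fin: "finite P" "finite Q" using T finite_subset by blast+
  then have pos: "0 < card P" "0 < card Q" using u card_gt_0_iff by blast+
  have "1 / real N \<le> min (uniform P u) (uniform Q u)"
    using u pos card by (auto simp: uniform_def intro!: divide_left_mono mult_pos_pos)
  also have "\<dots> \<le> (\<Sum>w\<in>T. min (uniform P w) (uniform Q w))"
    by (rule member_le_sum[where f = "\<lambda>w. min (uniform P w) (uniform Q w)"]) (use T u in \<open>auto simp: uniform_nonneg\<close>)
  finally have low: "1 / real N \<le> (\<Sum>w\<in>T. min (uniform P w) (uniform Q w))" .
  have "(\<Sum>w\<in>T. \<bar>uniform P w - uniform Q w\<bar>) = (\<Sum>w\<in>T. uniform P w + uniform Q w - 2 * min (uniform P w) (uniform Q w))"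
    by (rule sum.cong) (auto simp: min_def)
  also have "\<dots> = 2 - 2 * (\<Sum>w\<in>T. min (uniform P w) (uniform Q w))"
  proof -
    have "P \<noteq> {}" "Q \<noteq> {}" using u by auto
    then show ?thesis using sum_uniform[OF T(1,2)] sum_uniform[OF T(1,3)]
      by (simp add: sum.distrib sum_subtractf sum_distrib_left)
  qed
  finally show ?thesis using low by simp
qed

text \<open>Dobrushin's contraction: write the difference of two laws as the transport of its positive
  part onto its negative part.\<close>

lemma kernel_contraction:
  fixes \<mu> \<nu> :: "'a \<Rightarrow> real" and K :: "'a \<Rightarrow> 'b \<Rightarrow> real"
  assumes fin: "finite S" and nonneg: "\<And>v. 0 \<le> \<mu> v" "\<And>v. 0 \<le> \<nu> v"
    and sum: "(\<Sum>v\<in>S. \<mu> v) = (\<Sum>v\<in>S. \<nu> v)"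
    and overlap: "\<And>v w. v \<in> S \<Longrightarrow> w \<in> S \<Longrightarrow> \<mu> v \<noteq> 0 \<Longrightarrow> \<nu> w \<noteq> 0 \<Longrightarrow> (\<Sum>u\<in>T. \<bar>K v u - K w u\<bar>) \<le> 2 * \<kappa>"
  shows "(\<Sum>u\<in>T. \<bar>(\<Sum>v\<in>S. \<mu> v * K v u) - (\<Sum>v\<in>S. \<nu> v * K v u)\<bar>) \<le> \<kappa> * (\<Sum>v\<in>S. \<bar>\<mu> v - \<nu> v\<bar>)"
proof -
  define p where "p v = max 0 (\<mu> v - \<nu> v)" for v
  define q where "q v = max 0 (\<nu> v - \<mu> v)" for v
  have pq: "0 \<le> p v" "0 \<le> q v" "\<mu> v - \<nu> v = p v - q v" "\<bar>\<mu> v - \<nu> v\<bar> = p v + q v" for v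
    by (auto simp: p_def q_def)
  define s where "s = sum p S"
  have "sum p S - sum q S = sum \<mu> S - sum \<nu> S" by (simp add: pq(3)[symmetric] flip: sum_subtractf)
  then have s: "sum q S = s" using sum by (simp add: s_def)
  have total: "(\<Sum>v\<in>S. \<bar>\<mu> v - \<nu> v\<bar>) = 2 * s" by (simp add: pq(4) sum.distrib s s_def[symmetric])
  have s0: "0 \<le> s" unfolding s_def by (rule sum_nonneg) (simp add: pq)
  have diff: "(\<Sum>v\<in>S. \<mu> v * K v u) - (\<Sum>v\<in>S. \<nu> v * K v u) = (\<Sum>v\<in>S. p v * K v u) - (\<Sum>w\<in>S. q w * K w u)" for u
    by (simp add: left_diff_distrib[symmetric] pq(3) flip: sum_subtractf)
  \<comment> \<open>The transport plan is \<open>p v * q w\<close>, which has marginals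
    \<open>s * p v\<close> and \<open>s * q w\<close>; the factor \<open>s\<close> on the left
    avoids dividing before \<open>s = 0\<close> is excluded.\<close>
  have swap: "s * ((\<Sum>v\<in>S. p v * K v u) - (\<Sum>w\<in>S. q w * K w u)) = (\<Sum>v\<in>S. \<Sum>w\<in>S. p v * q w * (K v u - K w u))" for u
  proof -
    have "(\<Sum>v\<in>S. \<Sum>w\<in>S. p v * q w * (K v u - K w u)) =
        (\<Sum>v\<in>S. \<Sum>w\<in>S. (p v * K v u) * q w) - (\<Sum>v\<in>S. \<Sum>w\<in>S. p v * (q w * K w u))"
      by (simp add: right_diff_distrib sum_subtractf mult_ac)
    also have "\<dots> = (\<Sum>v\<in>S. p v * K v u) * sum q S - sum p S * (\<Sum>w\<in>S. q w * K w u)"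
      by (simp only: sum_product)
    finally show ?thesis by (simp add: s s_def[symmetric] algebra_simps)
  qed
  show ?thesis
  proof (cases "s = 0")
    case True
    then have "p v = 0" "q v = 0" if "v \<in> S" for v
      using that s sum_nonneg_eq_0_iff[OF fin, of p] sum_nonneg_eq_0_iff[OF fin, of q] pq by (auto simp: s_def)
    then show ?thesis unfolding diff total using True by simp
  next
    case False
    then have s1: "0 < s" using s0 by simp
    have "s * (\<Sum>u\<in>T. \<bar>(\<Sum>v\<in>S. p v * K v u) - (\<Sum>w\<in>S. q w * K w u)\<bar>)
        = (\<Sum>u\<in>T. \<bar>\<Sum>v\<in>S. \<Sum>w\<in>S. p v * q w * (K v u - K w u)\<bar>)"
      unfolding swap[symmetric] abs_mult using s1 by (simp add: sum_distrib_left)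
    also have "\<dots> \<le> (\<Sum>u\<in>T. \<Sum>v\<in>S. \<Sum>w\<in>S. p v * q w * \<bar>K v u - K w u\<bar>)"
    proof (rule sum_mono)
      fix u
      have "\<bar>\<Sum>v\<in>S. \<Sum>w\<in>S. p v * q w * (K v u - K w u)\<bar> \<le> (\<Sum>v\<in>S. \<Sum>w\<in>S. \<bar>p v * q w * (K v u - K w u)\<bar>)"
        by (intro order_trans[OF sum_abs] sum_mono) auto
      then show "\<bar>\<Sum>v\<in>S. \<Sum>w\<in>S. p v * q w * (K v u - K w u)\<bar> \<le> (\<Sum>v\<in>S. \<Sum>w\<in>S. p v * q w * \<bar>K v u - K w u\<bar>)"
        using pq(1,2) by (simp add: abs_mult)
    qed
    also have "\<dots> = (\<Sum>v\<in>S. \<Sum>w\<in>S. p v * q w * (\<Sum>u\<in>T. \<bar>K v u - K w u\<bar>))"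
      unfolding sum_distrib_left by (subst sum.swap, rule sum.cong[OF refl], rule sum.swap)
    also have "\<dots> \<le> (\<Sum>v\<in>S. \<Sum>w\<in>S. p v * q w * (2 * \<kappa>))"
    proof (intro sum_mono)
      fix v w assume vw: "v \<in> S" "w \<in> S"
      show "p v * q w * (\<Sum>u\<in>T. \<bar>K v u - K w u\<bar>) \<le> p v * q w * (2 * \<kappa>)"
      proof (cases "p v = 0 \<or> q w = 0")
        case False
        then have "\<mu> v \<noteq> 0" "\<nu> w \<noteq> 0" using nonneg[of v] nonneg[of w] by (auto simp: p_def q_def max_def split: if_splits)
        then show ?thesis using overlap[OF vw] pq by (intro mult_left_mono) auto
      qed auto
    qed
    also have "\<dots> = s * (\<kappa> * (2 * s))"
      using sum_product[of p S q S] by (simp add: s s_def[symmetric] sum_distrib_right[symmetric])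
    finally show ?thesis unfolding diff total using s1 by simp
  qed
qed

text \<open>Greedy colouring: a new vertex has fewer than \<open>K\<close> neighbours, so one of the
  \<open>K\<close> colours is free.\<close>

lemma bounded_degree_coloring:
  fixes S :: "'a set"
  assumes "finite S" "\<And>x. x \<in> S \<Longrightarrow> card {y \<in> S. y \<noteq> x \<and> R x y} < K" "\<And>x y. R x y \<Longrightarrow> R y x"
  shows "\<exists>col :: 'a \<Rightarrow> nat. (\<forall>x\<in>S. col x < K) \<and> (\<forall>x\<in>S. \<forall>y\<in>S. x \<noteq> y \<longrightarrow> R x y \<longrightarrow> col x \<noteq> col y)"
  using assms(1,2)
proof (induction S rule: finite_induct)
  case (insert a S)
  have deg: "card {y \<in> S. y \<noteq> x \<and> R x y} < K" if "x \<in> S" for x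
  proof -
    have "card {y \<in> S. y \<noteq> x \<and> R x y} \<le> card {y \<in> insert a S. y \<noteq> x \<and> R x y}"
      by (rule card_mono) (use insert.hyps in auto)
    then show ?thesis using insert.prems[of x] that by simp
  qed
  have "\<exists>col :: 'a \<Rightarrow> nat. (\<forall>x\<in>S. col x < K) \<and> (\<forall>x\<in>S. \<forall>y\<in>S. x \<noteq> y \<longrightarrow> R x y \<longrightarrow> col x \<noteq> col y)"
    by (rule insert.IH) (rule deg)
  then obtain col :: "'a \<Rightarrow> nat" where col: "\<forall>x\<in>S. col x < K" "\<forall>x\<in>S. \<forall>y\<in>S. x \<noteq> y \<longrightarrow> R x y \<longrightarrow> col x \<noteq> col y"
    by (elim exE conjE) (rule that)
  define B where "B = {y \<in> S. R a y}"
  have "card (col ` B) < card {..<K}"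
  proof -
    have "B = {y \<in> insert a S. y \<noteq> a \<and> R a y}" using insert.hyps by (auto simp: B_def)
    then have "card B < K" using insert.prems[of a] by simp
    moreover have "card (col ` B) \<le> card B" using insert.hyps by (intro card_image_le) (auto simp: B_def)
    ultimately show ?thesis by simp
  qed
  moreover have "col ` B \<subseteq> {..<K}" using col(1) by (auto simp: B_def)
  ultimately obtain c where c: "c < K" "c \<notin> col ` B" using card_mono[of "col ` B" "{..<K}"] insert.hyps(1) by (auto simp: B_def)
  have "a \<notin> S" using insert.hyps by simp
  show ?case
  proof (intro exI[of _ "col(a := c)"] conjI ballI impI)
    fix x assume "x \<in> insert a S"
    then show "(col(a := c)) x < K" using col(1) c(1) by auto
  next
    fix x y assume xy: "x \<in> insert a S" "y \<in> insert a S" "x \<noteq> y" "R x y"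
    show "(col(a := c)) x \<noteq> (col(a := c)) y"
    proof (cases "x = a \<or> y = a")
      case True
      then show ?thesis using xy c(2) assms(3)[OF xy(4)] by (auto simp: B_def)
    next
      case False
      then show ?thesis using xy col(2) by auto
    qed
  qed
qed auto

locale hyperbolic_graph =
  fixes A :: "'a set" and d :: "'a \<Rightarrow> 'a \<Rightarrow> nat" and b :: 'a and \<delta> :: real
  assumes base: "b \<in> A"
    and d_refl: "x \<in> A \<Longrightarrow> d x x = 0"
    and d_eq: "x \<in> A \<Longrightarrow> y \<in> A \<Longrightarrow> d x y = 0 \<Longrightarrow> x = y"
    and d_sym: "x \<in> A \<Longrightarrow> y \<in> A \<Longrightarrow> d x y = d y x"
    and d_triangle: "x \<in> A \<Longrightarrow> y \<in> A \<Longrightarrow> z \<in> A \<Longrightarrow> d x z \<le> d x y + d y z"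
    and geodesic: "x \<in> A \<Longrightarrow> y \<in> A \<Longrightarrow> k \<le> d x y \<Longrightarrow> \<exists>z\<in>A. d x z = k \<and> d z y = d x y - k"
    and growth: "\<exists>N. \<forall>x\<in>A. finite {y \<in> A. d x y \<le> R} \<and> card {y \<in> A. d x y \<le> R} \<le> N"
    and \<delta>_nonneg: "0 \<le> \<delta>"
    and hyperbolic: "x \<in> A \<Longrightarrow> y \<in> A \<Longrightarrow> z \<in> A \<Longrightarrow>
      min (gromov_product (\<lambda>x y. real (d x y)) b x y) (gromov_product (\<lambda>x y. real (d x y)) b y z) - \<delta>
        \<le> gromov_product (\<lambda>x y. real (d x y)) b x z"
begin

definition h :: "'a \<Rightarrow> nat" where "h x = d b x"

definition gp :: "'a \<Rightarrow> 'a \<Rightarrow> real" where "gp x y = (real (h x) + real (h y) - real (d x y)) / 2"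

text \<open>The spacing of the levels outweighs the losses caused by hyperbolicity: descending one
  level regains more than the drift of \<open>2 * \<delta>\<close>, and it covers the
  \<open>4 * \<delta> + 1\<close> by which walks from adjacent points may diverge.\<close>

definition r :: nat where "r = nat \<lceil>4 * \<delta>\<rceil> + 1"

definition level :: "nat \<Rightarrow> 'a set" where "level k = {v \<in> A. h v = k * r}"

text \<open>Points of level \<open>k\<close> that almost lie on a geodesic from the base to
  \<open>x\<close>. The slack \<delta> lets an exact geodesic point for one vertex count as a
  predecessor of another vertex nearby.\<close>

definition preds :: "nat \<Rightarrow> 'a \<Rightarrow> 'a set" where "preds k x = {u \<in> level k. real (k * r) - \<delta> \<le> gp u x}"

lemma r: "4 * \<delta> + 1 \<le> real r" "0 < r" by (simp_all add: r_def) linarith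

lemma gp_eq: "x \<in> A \<Longrightarrow> y \<in> A \<Longrightarrow> gromov_product (\<lambda>x y. real (d x y)) b x y = gp x y"
  by (simp add: gromov_product_def gp_def h_def d_sym[of _ b] base)

lemma gp_sym: "x \<in> A \<Longrightarrow> y \<in> A \<Longrightarrow> gp x y = gp y x"
  by (simp add: gp_def d_sym)

lemma gp_triangle: "x \<in> A \<Longrightarrow> y \<in> A \<Longrightarrow> z \<in> A \<Longrightarrow> m \<le> gp x y \<Longrightarrow> m \<le> gp y z \<Longrightarrow> m - \<delta> \<le> gp x z"
  using hyperbolic[of x y z] by (simp add: gp_eq)

lemma gp_self: "x \<in> A \<Longrightarrow> gp x x = real (h x)" by (simp add: gp_def d_refl)

lemma h_lipschitz: "x \<in> A \<Longrightarrow> y \<in> A \<Longrightarrow> \<bar>real (h x) - real (h y)\<bar> \<le> real (d x y)"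
  using d_triangle[of b x y] d_triangle[of b y x] base d_sym[of x y] by (simp add: h_def)

lemma gp_nonneg: "x \<in> A \<Longrightarrow> y \<in> A \<Longrightarrow> 0 \<le> gp x y"
  using d_triangle[of x b y] base d_sym[of x b] by (simp add: gp_def h_def)

lemma level_A: "v \<in> level k \<Longrightarrow> v \<in> A" and level_h: "v \<in> level k \<Longrightarrow> h v = k * r" by (auto simp: level_def)

lemma level_div: "v \<in> level k \<Longrightarrow> h v div r = k" using r(2) by (simp add: level_def)

lemma finite_ball: "finite {x \<in> A. h x \<le> R}"
  using growth[of R] base unfolding h_def by blast

lemma finite_level: "finite (level k)"
  by (rule finite_subset[OF _ finite_ball[of "k * r"]]) (auto simp: level_def)

lemma ray_point:
  assumes "x \<in> A" "k * r \<le> h x" obtains u where "u \<in> level k" "gp u x = real (k * r)"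
proof -
  obtain u where u: "u \<in> A" "d b u = k * r" "d u x = d b x - k * r"
    using geodesic[OF base assms(1), of "k * r"] assms(2) by (auto simp: h_def)
  then have "gp u x = real (k * r)" using assms(2) by (simp add: gp_def h_def of_nat_diff)
  then show thesis using that u by (simp add: level_def h_def)
qed

lemma preds_subset: "preds k x \<subseteq> level k" by (auto simp: preds_def)

lemma preds_nonempty: "x \<in> A \<Longrightarrow> k * r \<le> h x \<Longrightarrow> preds k x \<noteq> {}"
proof -
  assume "x \<in> A" "k * r \<le> h x"
  then obtain u where "u \<in> level k" "gp u x = real (k * r)" by (rule ray_point)
  then have "u \<in> preds k x" using \<delta>_nonneg by (simp add: preds_def)
  then show ?thesis by blast
qed

definition N :: nat where "N = (SOME N. \<forall>x\<in>A. card {y \<in> A. d x y \<le> 2 * r} \<le> N)"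

lemma N: "x \<in> A \<Longrightarrow> card {y \<in> A. d x y \<le> 2 * r} \<le> N"
  using someI_ex[of "\<lambda>N. \<forall>x\<in>A. card {y \<in> A. d x y \<le> 2 * r} \<le> N"] growth[of "2 * r"] unfolding N_def by blast

lemma finite_metric_ball: "x \<in> A \<Longrightarrow> finite {y \<in> A. d x y \<le> R}" using growth[of R] by blast

text \<open>The distance to such a predecessor is at most \<open>r + 2 * \<delta>\<close>, which
  explains the radius \<open>2 * r\<close> in the definition of \<open>N\<close>.\<close>

lemma card_preds:
  assumes x: "x \<in> A" "h x \<le> Suc k * r" shows "card (preds k x) \<le> N"
proof -
  have "preds k x \<subseteq> {y \<in> A. d x y \<le> 2 * r}"
  proof
    fix u assume u: "u \<in> preds k x"
    then have uA: "u \<in> A" and hu: "h u = k * r" and g: "real (k * r) - \<delta> \<le> gp u x" by (auto simp: preds_def level_def)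
    have "real (h x) \<le> real (k * r) + real r" using of_nat_mono[OF x(2), where 'a = real] by simp
    then have "real (d u x) \<le> 2 * real r" using g r(1) \<delta>_nonneg by (simp add: gp_def hu)
    then have "d x u \<le> 2 * r" using d_sym[OF x(1) uA] by linarith
    then show "u \<in> {y \<in> A. d x y \<le> 2 * r}" using uA by simp
  qed
  then show ?thesis by (rule order_trans[OF card_mono[OF finite_metric_ball[OF x(1)]] N[OF x(1)]])
qed

text \<open>The second argument counts the steps of the walk, starting at the highest level not
  above \<open>x\<close>. The function \<open>law\<close> reindexes by levels, which makes walks
  from different points comparable.\<close>

primrec chain :: "'a \<Rightarrow> nat \<Rightarrow> 'a \<Rightarrow> real" where
  "chain x 0 = uniform (preds (h x div r) x)"
| "chain x (Suc j) = (\<lambda>u. \<Sum>v\<in>level (h x div r - j). chain x j v * uniform (preds (h x div r - Suc j) v) u)"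

definition law :: "'a \<Rightarrow> nat \<Rightarrow> 'a \<Rightarrow> real" where "law x k = chain x (h x div r - k)"

lemma law_top: "law x (h x div r) = uniform (preds (h x div r) x)" by (simp add: law_def)

lemma law_step:
  assumes "k < h x div r"
  shows "law x k = (\<lambda>u. \<Sum>v\<in>level (Suc k). law x (Suc k) v * uniform (preds k v) u)"
proof -
  have "h x div r - k = Suc (h x div r - Suc k)" using assms by simp
  then show ?thesis using assms by (simp add: law_def)
qed

lemma law_nonneg: "0 \<le> law x k u"
proof -
  have "0 \<le> chain x j u" for j by (induction j arbitrary: u) (auto intro!: sum_nonneg mult_nonneg_nonneg uniform_nonneg)
  then show ?thesis by (simp add: law_def)
qed

lemma div_level: "h x div r * r \<le> h x" "h x \<le> Suc (h x div r) * r"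
  using r(2) dividend_less_div_times[of r "h x"] by (auto simp: less_imp_le add.commute)

lemma level_le: "k \<le> h x div r \<Longrightarrow> k * r \<le> h x"
  using div_level(1)[of x] mult_le_mono1[of k "h x div r" r] by linarith

text \<open>The error does not accumulate: at level \<open>k + 1\<close> the Gromov product with
  \<open>x\<close> is at least \<open>(k + 1) * r - 2 * \<delta>\<close>, which exceeds
  \<open>k * r - \<delta>\<close>, so that each step starts afresh and uses hyperbolicity
  once.\<close>

lemma law_support:
  assumes x: "x \<in> A" and k: "k \<le> h x div r" and nz: "law x k u \<noteq> 0"
  shows "u \<in> level k \<and> real (k * r) - 2 * \<delta> \<le> gp u x"
  using k nz
proof (induction k arbitrary: u rule: inc_induct)
  case base
  then have "u \<in> preds (h x div r) x" by (auto simp: law_top uniform_def)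
  then show ?case using \<delta>_nonneg by (simp add: preds_def)
next
  case (step k)
  then have "(\<Sum>v\<in>level (Suc k). law x (Suc k) v * uniform (preds k v) u) \<noteq> 0" using law_step[OF step.hyps(2)] by simp
  then obtain v where "v \<in> level (Suc k)" "law x (Suc k) v * uniform (preds k v) u \<noteq> 0"
    by (rule sum.not_neutral_contains_not_neutral)
  then have v: "v \<in> level (Suc k)" "law x (Suc k) v \<noteq> 0" "uniform (preds k v) u \<noteq> 0" by simp_all
  then have u: "u \<in> level k" "real (k * r) - \<delta> \<le> gp u v" by (auto simp: uniform_def preds_def)
  have "real (Suc k * r) - 2 * \<delta> \<le> gp v x" using step.IH[OF v(2)] by simp
  then have "real (k * r) - \<delta> \<le> gp v x" using r(1) \<delta>_nonneg by simp
  then have "real (k * r) - \<delta> - \<delta> \<le> gp u x" using gp_triangle[OF level_A[OF u(1)] level_A[OF v(1)] x u(2)] by simp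
  then show ?case using u(1) by simp
qed

lemma sum_law:
  assumes x: "x \<in> A" and k: "k \<le> h x div r" shows "(\<Sum>u\<in>level k. law x k u) = 1"
  using k
proof (induction k rule: inc_induct)
  case base
  show ?case unfolding law_top
    by (rule sum_uniform[OF finite_level preds_subset preds_nonempty[OF x div_level(1)]])
next
  case (step k)
  have "(\<Sum>u\<in>level k. law x k u) = (\<Sum>v\<in>level (Suc k). law x (Suc k) v * (\<Sum>u\<in>level k. uniform (preds k v) u))"
    unfolding law_step[OF step.hyps(2)] sum_distrib_left by (rule sum.swap)
  also have "\<dots> = (\<Sum>v\<in>level (Suc k). law x (Suc k) v)"
  proof (rule sum.cong[OF refl])
    fix v assume v: "v \<in> level (Suc k)"
    then have "(\<Sum>u\<in>level k. uniform (preds k v) u) = 1"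
      using sum_uniform[OF finite_level preds_subset preds_nonempty[OF level_A[OF v]]] by (simp add: level_h)
    then show "law x (Suc k) v * (\<Sum>u\<in>level k. uniform (preds k v) u) = law x (Suc k) v" by simp
  qed
  finally show ?case using step.IH by simp
qed

lemma sum_mu_le:
  assumes x: "x \<in> A" and k: "k \<le> h x div r" and V: "finite V" shows "(\<Sum>u\<in>V. law x k u) \<le> 1"
proof -
  have "(\<Sum>u\<in>V. law x k u) \<le> (\<Sum>u\<in>V \<union> level k. law x k u)"
    by (rule sum_mono2) (use V finite_level law_nonneg in auto)
  also have "\<dots> = (\<Sum>u\<in>level k. law x k u)"
    by (rule sum.mono_neutral_right) (use V finite_level law_support[OF x k] in auto)
  finally show ?thesis using sum_law[OF x k] by simp
qed

text \<open>A point of level \<open>k\<close> on a geodesic to \<open>v\<close> is almost geodesic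
  for \<open>w\<close> too, because the loss \<open>4 * \<delta> + 1\<close> is at most one
  level.\<close>

lemma preds_overlap:
  assumes "v \<in> level (Suc k)" "w \<in> level (Suc k)" "real (Suc k * r) - 4 * \<delta> - 1 \<le> gp v w"
  obtains u where "u \<in> preds k v" "u \<in> preds k w"
proof -
  obtain u where u: "u \<in> level k" "gp u v = real (k * r)"
    using ray_point[OF level_A[OF assms(1)], of k] level_h[OF assms(1)] by auto
  have "real (k * r) \<le> gp v w" using assms(3) r(1) by simp
  then have "real (k * r) - \<delta> \<le> gp u w" using gp_triangle[OF level_A[OF u(1)] level_A[OF assms(1)] level_A[OF assms(2)], of "real (k * r)"] u(2) by simp
  moreover have "real (k * r) - \<delta> \<le> gp u v" using u(2) \<delta>_nonneg by simp
  ultimately show thesis using that u(1) by (auto simp: preds_def)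
qed

section \<open>Coupling of the walks from adjacent points\<close>

context
  fixes x y assumes xy: "x \<in> A" "y \<in> A" "d x y \<le> 1"
begin

text \<open>The estimate passes through \<open>x\<close> and \<open>y\<close>: each walk may be off
  by \<open>2 * \<delta>\<close>, adjacency costs at most 1, and two uses of hyperbolicity cost
  \<delta> each.\<close>

lemma neighbour_supports:
  assumes k: "k \<le> h x div r" "k \<le> h y div r" and nz: "law x k v \<noteq> 0" "law y k w \<noteq> 0"
  shows "real (k * r) - 4 * \<delta> - 1 \<le> gp v w"
proof -
  have v: "v \<in> A" "real (k * r) - 2 * \<delta> \<le> gp v x" using law_support[OF xy(1) k(1) nz(1)] level_A by auto
  have w: "w \<in> A" "real (k * r) - 2 * \<delta> \<le> gp y w"
    using law_support[OF xy(2) k(2) nz(2)] level_A gp_sym[OF xy(2), of w] by auto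
  have "real (k * r) \<le> real (h x)" "real (k * r) \<le> real (h y)" by (intro of_nat_mono level_le k)+
  then have "real (k * r) - 1 \<le> gp x y" using xy(3) by (simp add: gp_def)
  then have "real (k * r) - 2 * \<delta> - 1 - \<delta> \<le> gp x w"
    using gp_triangle[OF xy(1,2) w(1), of "real (k * r) - 2 * \<delta> - 1"] w(2) \<delta>_nonneg by simp
  then have "real (k * r) - 3 * \<delta> - 1 - \<delta> \<le> gp v w"
    using gp_triangle[OF v(1) xy(1) w(1), of "real (k * r) - 3 * \<delta> - 1"] v(2) \<delta>_nonneg by simp
  then show ?thesis by simp
qed

definition gap :: "nat \<Rightarrow> real" where "gap k = (\<Sum>u\<in>level k. \<bar>law x k u - law y k u\<bar>)"

lemma gap_le_2:
  assumes k: "k \<le> h x div r" "k \<le> h y div r" shows "gap k \<le> 2"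
proof -
  have "gap k \<le> (\<Sum>u\<in>level k. law x k u + law y k u)"
    unfolding gap_def
  proof (rule sum_mono)
    fix u show "\<bar>law x k u - law y k u\<bar> \<le> law x k u + law y k u"
      using law_nonneg[of x k u] law_nonneg[of y k u] by linarith
  qed
  then show ?thesis using sum_law[OF xy(1) k(1)] sum_law[OF xy(2) k(2)] by (simp add: sum.distrib)
qed

text \<open>Any two points in the supports share a predecessor one level down, so their transition
  laws overlap by at least \<open>1 / N\<close> and Dobrushin's contraction applies.\<close>

lemma gap_contract:
  assumes k: "k < h x div r" "k < h y div r" shows "gap k \<le> (1 - 1 / real N) * gap (Suc k)"
  unfolding gap_def law_step[OF k(1)] law_step[OF k(2)]
proof (rule kernel_contraction[OF finite_level law_nonneg law_nonneg])
  show "sum (law x (Suc k)) (level (Suc k)) = sum (law y (Suc k)) (level (Suc k))"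
    using sum_law[OF xy(1), of "Suc k"] sum_law[OF xy(2), of "Suc k"] k by simp
  fix v w assume vw: "v \<in> level (Suc k)" "w \<in> level (Suc k)" "law x (Suc k) v \<noteq> 0" "law y (Suc k) w \<noteq> 0"
  obtain u where "u \<in> preds k v" "u \<in> preds k w"
    using preds_overlap[OF vw(1,2) neighbour_supports[OF _ _ vw(3,4)]] k by auto
  then show "(\<Sum>u\<in>level k. \<bar>uniform (preds k v) u - uniform (preds k w) u\<bar>) \<le> 2 * (1 - 1 / real N)"
    using vw by (intro uniform_overlap[OF finite_level preds_subset preds_subset] card_preds) (auto simp: level_A level_h)
qed

lemma N_pos: "0 < N"
proof -
  have "{y \<in> A. d x y \<le> 2 * r} \<noteq> {}" using xy(1) d_refl by auto
  then have "0 < card {y \<in> A. d x y \<le> 2 * r}" using finite_metric_ball[OF xy(1)] by (simp add: card_gt_0_iff)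
  then show ?thesis using N[OF xy(1)] by linarith
qed

text \<open>A geometric series summed without division: the extra term
  \<open>(real N - 1) * gap k\<close> is a reserve that pays for the next lower level, as
  \<open>N * gap k\<close> is at most \<open>N - 1\<close> times the gap one level up.\<close>

lemma sum_gap:
  assumes m: "m \<le> h x div r" "m \<le> h y div r" and "k \<le> m"
  shows "(\<Sum>i\<in>{k..m}. gap i) + (real N - 1) * gap k \<le> 2 * real N"
  using assms(3)
proof (induction k rule: inc_induct)
  case base
  have "real N * gap m \<le> real N * 2" using gap_le_2[OF m] by (intro mult_left_mono) auto
  then show ?case by (simp add: algebra_simps)
next
  case (step k)
  have "real N * gap k \<le> real N * ((1 - 1 / real N) * gap (Suc k))"
    using step m by (intro mult_left_mono gap_contract) auto
  also have "\<dots> = (real N - 1) * gap (Suc k)" using N_pos by (simp add: field_simps)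
  finally have "real N * gap k \<le> (real N - 1) * gap (Suc k)" .
  moreover have "(\<Sum>i\<in>{k..m}. gap i) = gap k + (\<Sum>i\<in>{Suc k..m}. gap i)"
    using step by (intro sum.atLeast_Suc_atMost) auto
  ultimately show ?case using step.IH by (simp add: algebra_simps)
qed

end

definition occupation :: "'a \<Rightarrow> 'a \<Rightarrow> real" where "occupation x v = (\<Sum>k\<le>h x div r. law x k v)"

lemma occupation_nonneg: "0 \<le> occupation x v" unfolding occupation_def by (intro sum_nonneg law_nonneg)

lemma sum_occupation:
  assumes "x \<in> A" "finite V" shows "(\<Sum>v\<in>V. occupation x v) \<le> real (h x) + 1"
proof -
  have "(\<Sum>v\<in>V. occupation x v) = (\<Sum>k\<le>h x div r. \<Sum>v\<in>V. law x k v)" unfolding occupation_def by (rule sum.swap)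
  also have "\<dots> \<le> (\<Sum>k\<le>h x div r. 1)" by (intro sum_mono sum_mu_le assms) auto
  also have "\<dots> \<le> real (h x) + 1" by simp
  finally show ?thesis .
qed

text \<open>The levels common to both walks contribute \<open>2 * N\<close>; the farther point may
  have one more level, of mass at most 1.\<close>

lemma occupation_neighbour:
  assumes xy: "x \<in> A" "y \<in> A" "d x y \<le> 1" and V: "finite V" and le: "h x \<le> h y"
  shows "(\<Sum>v\<in>V. \<bar>occupation x v - occupation y v\<bar>) \<le> 2 * real N + 1"
proof -
  define m where "m = h x div r"
  have m: "m \<le> h x div r" "m \<le> h y div r" using le by (auto simp: m_def div_le_mono)
  have "h y \<le> h x + r" using h_lipschitz[OF xy(1,2)] xy(3) r(2) by linarith
  then have "h y div r \<le> (h x + r) div r" by (rule div_le_mono)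
  then have "h y div r \<le> Suc m" using r(2) by (simp add: m_def)
  then have ny: "{..h y div r} \<subseteq> {..m} \<union> {Suc m..h y div r}" "card {Suc m..h y div r} \<le> 1" by auto
  have split: "occupation y v = (\<Sum>k\<le>m. law y k v) + (\<Sum>k\<in>{Suc m..h y div r}. law y k v)" for v
  proof -
    have "{..h y div r} = {..m} \<union> {Suc m..h y div r}" using m by auto
    then show ?thesis unfolding occupation_def by (simp add: sum.union_disjoint)
  qed
  have "(\<Sum>v\<in>V. \<bar>occupation x v - occupation y v\<bar>) \<le> (\<Sum>v\<in>V. (\<Sum>k\<le>m. \<bar>law x k v - law y k v\<bar>) + (\<Sum>k\<in>{Suc m..h y div r}. law y k v))"
  proof (rule sum_mono)
    fix v
    have "occupation x v - occupation y v = (\<Sum>k\<le>m. law x k v - law y k v) - (\<Sum>k\<in>{Suc m..h y div r}. law y k v)"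
      unfolding split by (simp add: occupation_def m_def sum_subtractf)
    moreover have "0 \<le> (\<Sum>k\<in>{Suc m..h y div r}. law y k v)" by (intro sum_nonneg law_nonneg)
    moreover have "\<bar>\<Sum>k\<le>m. law x k v - law y k v\<bar> \<le> (\<Sum>k\<le>m. \<bar>law x k v - law y k v\<bar>)" by (rule sum_abs)
    ultimately show "\<bar>occupation x v - occupation y v\<bar> \<le> (\<Sum>k\<le>m. \<bar>law x k v - law y k v\<bar>) + (\<Sum>k\<in>{Suc m..h y div r}. law y k v)"
      by linarith
  qed
  also have "\<dots> = (\<Sum>k\<le>m. \<Sum>v\<in>V. \<bar>law x k v - law y k v\<bar>) + (\<Sum>k\<in>{Suc m..h y div r}. \<Sum>v\<in>V. law y k v)"
    unfolding sum.distrib by (subst (1 2) sum.swap) simp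
  also have "\<dots> \<le> (\<Sum>k\<le>m. gap x y k) + (\<Sum>k\<in>{Suc m..h y div r}. 1)"
  proof (intro add_mono sum_mono sum_mu_le V xy(2))
    fix k assume "k \<in> {..m}"
    then have k: "k \<le> h x div r" "k \<le> h y div r" using m by auto
    have "(\<Sum>v\<in>V. \<bar>law x k v - law y k v\<bar>) \<le> (\<Sum>v\<in>V \<union> level k. \<bar>law x k v - law y k v\<bar>)"
      by (rule sum_mono2) (use V finite_level in auto)
    also have "\<dots> = (\<Sum>v\<in>level k. \<bar>law x k v - law y k v\<bar>)"
    proof (rule sum.mono_neutral_right)
      show "\<forall>v\<in>V \<union> level k - level k. \<bar>law x k v - law y k v\<bar> = 0"
      proof
        fix v assume "v \<in> V \<union> level k - level k"
        then have "law x k v = 0" "law y k v = 0"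
          using law_support[OF xy(1) k(1), of v] law_support[OF xy(2) k(2), of v] by blast+
        then show "\<bar>law x k v - law y k v\<bar> = 0" by simp
      qed
    qed (use V finite_level in auto)
    finally show "(\<Sum>v\<in>V. \<bar>law x k v - law y k v\<bar>) \<le> gap x y k" by (simp add: gap_def[OF xy])
  qed auto
  also have "(\<Sum>k\<in>{Suc m..h y div r}. 1) \<le> (1 :: real)" using ny(2) by simp
  also have "(\<Sum>k\<le>m. gap x y k) \<le> 2 * real N"
  proof -
    have "0 \<le> (real N - 1) * gap x y 0"
      using N_pos[OF xy] by (intro mult_nonneg_nonneg) (auto simp: gap_def[OF xy] sum_nonneg)
    then show ?thesis using sum_gap[OF xy m, of 0] by (simp add: atMost_atLeast0)
  qed
  finally show ?thesis by simp
qed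

lemma occupation_lipschitz:
  assumes "x \<in> A" "y \<in> A" "finite V"
  shows "(\<Sum>v\<in>V. \<bar>occupation x v - occupation y v\<bar>) \<le> (2 * real N + 1) * real (d x y)"
  using assms(1)
proof (induction "d x y" arbitrary: x)
  case 0
  then have "x = y" using d_eq assms(2) by simp
  then show ?case by simp
next
  case (Suc n)
  obtain z where z: "z \<in> A" "d x z = 1" "d z y = n"
    using geodesic[OF Suc.prems assms(2), of 1] Suc.hyps(2)[symmetric] by auto
  have "(\<Sum>v\<in>V. \<bar>occupation x v - occupation z v\<bar>) \<le> 2 * real N + 1"
  proof (cases "h x \<le> h z")
    case True
    then show ?thesis using occupation_neighbour[OF Suc.prems z(1) _ assms(3)] z(2) by simp
  next
    case False
    then have "(\<Sum>v\<in>V. \<bar>occupation z v - occupation x v\<bar>) \<le> 2 * real N + 1"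
      using occupation_neighbour[OF z(1) Suc.prems _ assms(3)] z(2) d_sym[OF z(1) Suc.prems] by simp
    then show ?thesis by (simp add: abs_minus_commute)
  qed
  moreover have "(\<Sum>v\<in>V. \<bar>occupation z v - occupation y v\<bar>) \<le> (2 * real N + 1) * real n"
    using Suc.hyps(1)[of z] z by simp
  moreover have "(\<Sum>v\<in>V. \<bar>occupation x v - occupation y v\<bar>) \<le> (\<Sum>v\<in>V. \<bar>occupation x v - occupation z v\<bar> + \<bar>occupation z v - occupation y v\<bar>)"
    by (rule sum_mono) simp
  ultimately show ?case unfolding Suc.hyps(2)[symmetric] by (simp add: sum.distrib algebra_simps)
qed

end

section \<open>Finitely many trees capturing all shadows\<close>

context hyperbolic_graph
begin

text \<open>Each level is coloured separately, and \<open>h v div r\<close> tells which colouring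
  applies to \<open>v\<close>.\<close>

lemma coloring_exists: "\<exists>col :: 'a \<Rightarrow> nat. (\<forall>v\<in>A. col v < Suc N) \<and>
    (\<forall>k. \<forall>v\<in>level k. \<forall>w\<in>level k. v \<noteq> w \<longrightarrow> d v w \<le> r \<longrightarrow> col v \<noteq> col w)"
proof -
  have "\<forall>k. \<exists>col :: 'a \<Rightarrow> nat. (\<forall>v\<in>level k. col v < Suc N) \<and>
      (\<forall>v\<in>level k. \<forall>w\<in>level k. v \<noteq> w \<longrightarrow> v \<in> A \<and> w \<in> A \<and> d v w \<le> r \<longrightarrow> col v \<noteq> col w)"
  proof
    fix k
    show "\<exists>col :: 'a \<Rightarrow> nat. (\<forall>v\<in>level k. col v < Suc N) \<and>
      (\<forall>v\<in>level k. \<forall>w\<in>level k. v \<noteq> w \<longrightarrow> v \<in> A \<and> w \<in> A \<and> d v w \<le> r \<longrightarrow> col v \<noteq> col w)"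
    proof (rule bounded_degree_coloring[OF finite_level])
      fix v assume v: "v \<in> level k"
      have "card {w \<in> level k. w \<noteq> v \<and> v \<in> A \<and> w \<in> A \<and> d v w \<le> r} \<le> card {w \<in> A. d v w \<le> 2 * r}"
        by (rule card_mono[OF finite_metric_ball[OF level_A[OF v]]]) auto
      then show "card {w \<in> level k. w \<noteq> v \<and> v \<in> A \<and> w \<in> A \<and> d v w \<le> r} < Suc N"
        using N[OF level_A[OF v]] by linarith
    qed (auto simp: d_sym)
  qed
  then obtain col :: "nat \<Rightarrow> 'a \<Rightarrow> nat" where cols: "\<forall>k. (\<forall>v\<in>level k. col k v < Suc N) \<and>
      (\<forall>v\<in>level k. \<forall>w\<in>level k. v \<noteq> w \<longrightarrow> v \<in> A \<and> w \<in> A \<and> d v w \<le> r \<longrightarrow> col k v \<noteq> col k w)"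
    by (rule choice[THEN exE])
  have col: "v \<in> level k \<Longrightarrow> col k v < Suc N"
    "v \<in> level k \<Longrightarrow> w \<in> level k \<Longrightarrow> v \<noteq> w \<Longrightarrow> v \<in> A \<Longrightarrow> w \<in> A \<Longrightarrow> d v w \<le> r \<Longrightarrow> col k v \<noteq> col k w" for k v w
    using cols by blast+
  define c where "c v = (if v \<in> level (h v div r) then col (h v div r) v else 0)" for v
  have c: "c v = col k v" if "v \<in> level k" for k v using that by (simp add: c_def level_div)
  have "c v < Suc N" for v using col(1) by (simp add: c_def)
  moreover have "c v \<noteq> c w" if "v \<in> level k" "w \<in> level k" "v \<noteq> w" "d v w \<le> r" for k v w
    using col(2)[OF that(1-3)] that level_A c by simp
  ultimately show ?thesis by blast
qed

definition col :: "'a \<Rightarrow> nat" where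
  "col = (SOME col. (\<forall>v\<in>A. col v < Suc N) \<and>
    (\<forall>k. \<forall>v\<in>level k. \<forall>w\<in>level k. v \<noteq> w \<longrightarrow> d v w \<le> r \<longrightarrow> col v \<noteq> col w))"

lemma col: "v \<in> A \<Longrightarrow> col v < Suc N" "v \<in> level k \<Longrightarrow> w \<in> level k \<Longrightarrow> v \<noteq> w \<Longrightarrow> d v w \<le> r \<Longrightarrow> col v \<noteq> col w"
  using someI_ex[OF coloring_exists] unfolding col_def[symmetric] by blast+

definition captures :: "nat \<Rightarrow> nat \<Rightarrow> 'a \<Rightarrow> 'a \<Rightarrow> bool" where
  "captures t k v q \<longleftrightarrow> q \<in> level k \<and> col q = t \<and> real (k * r) - \<delta> \<le> gp v q"

text \<open>Two capturing points of one level would be within \<open>4 * \<delta>\<close> of each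
  other, hence within \<open>r\<close>, and so would differ in colour.\<close>

lemma captures_unique:
  assumes "v \<in> A" "captures t k v q" "captures t k v q'" shows "q = q'"
proof (rule ccontr)
  assume ne: "q \<noteq> q'"
  have q: "q \<in> level k" "q' \<in> level k" "col q = col q'" using assms by (auto simp: captures_def)
  have "real (k * r) - \<delta> \<le> gp q v" using assms level_A[OF q(1)] by (simp add: captures_def gp_sym)
  then have "real (k * r) - \<delta> - \<delta> \<le> gp q q'"
    by (rule gp_triangle[OF level_A[OF q(1)] assms(1) level_A[OF q(2)]]) (use assms(3) in \<open>simp add: captures_def\<close>)
  then have "real (d q q') \<le> 4 * \<delta>" using q by (simp add: gp_def level_h)
  then have "d q q' \<le> r" using r(1) by linarith
  then show False using col(2)[OF q(1,2) ne] q(3) by simp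
qed

text \<open>Where no point of colour \<open>t\<close> claims \<open>v\<close>, any geodesic point
  will do: it only has to keep ancestors close to geodesics.\<close>

definition parent :: "nat \<Rightarrow> nat \<Rightarrow> 'a \<Rightarrow> 'a" where
  "parent t k v = (if \<exists>q. captures t k v q then SOME q. captures t k v q
    else SOME u. u \<in> level k \<and> gp u v = real (k * r))"

lemma parent_captured:
  assumes "v \<in> A" "captures t k v q" shows "parent t k v = q"
proof -
  have "captures t k v (SOME q. captures t k v q)" using assms(2) by (rule someI)
  then have "(SOME q. captures t k v q) = q" by (rule captures_unique[OF assms(1) _ assms(2)])
  then show ?thesis using assms(2) by (auto simp: parent_def)
qed

lemma parent:
  assumes v: "v \<in> level (Suc k)"
  shows "parent t k v \<in> level k" "real (k * r) - \<delta> \<le> gp v (parent t k v)"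
proof -
  have "parent t k v \<in> level k \<and> real (k * r) - \<delta> \<le> gp v (parent t k v)"
  proof (cases "\<exists>q. captures t k v q")
    case True
    then obtain q where q: "captures t k v q" ..
    then show ?thesis using parent_captured[OF level_A[OF v] q] by (simp add: captures_def)
  next
    case False
    have "\<exists>u. u \<in> level k \<and> gp u v = real (k * r)" using ray_point[OF level_A[OF v], of k] level_h[OF v] by auto
    from someI_ex[OF this] have "parent t k v \<in> level k \<and> gp (parent t k v) v = real (k * r)"
      using False by (simp add: parent_def)
    then show ?thesis using gp_sym[OF level_A level_A[OF v], of "parent t k v" k] \<delta>_nonneg by simp
  qed
  then show "parent t k v \<in> level k" "real (k * r) - \<delta> \<le> gp v (parent t k v)" by auto
qed

primrec climb :: "nat \<Rightarrow> nat \<Rightarrow> nat \<Rightarrow> 'a \<Rightarrow> 'a" where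
  "climb t l 0 v = v"
| "climb t l (Suc j) v = parent t (l - Suc j) (climb t l j v)"

definition anc :: "nat \<Rightarrow> nat \<Rightarrow> 'a \<Rightarrow> 'a" where "anc t k v = climb t (h v div r) (h v div r - k) v"

lemma anc_self: "v \<in> level l \<Longrightarrow> anc t l v = v" by (simp add: anc_def level_div)

lemma anc_step:
  assumes "v \<in> level l" "k < l" shows "anc t k v = parent t k (anc t (Suc k) v)"
proof -
  have "l - k = Suc (l - Suc k)" using assms by simp
  then show ?thesis using assms by (simp add: anc_def level_div)
qed

text \<open>As for the walk, the spacing of the levels resets the error at every step, so the loss
  stays at \<open>2 * \<delta>\<close> however remote the ancestor.\<close>

lemma anc:
  assumes v: "v \<in> level l" and k: "k \<le> l"
  shows "anc t k v \<in> level k \<and> real (k * r) - 2 * \<delta> \<le> gp v (anc t k v)"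
  using k
proof (induction k rule: inc_induct)
  case base
  then show ?case using v \<delta>_nonneg by (simp add: anc_self gp_self level_A level_h)
next
  case (step k)
  let ?a = "anc t (Suc k) v"
  have a: "?a \<in> level (Suc k)" "real (Suc k * r) - 2 * \<delta> \<le> gp v ?a" using step.IH by auto
  have "real (k * r) - \<delta> \<le> gp v ?a" using a(2) r(1) \<delta>_nonneg by simp
  then have "real (k * r) - \<delta> - \<delta> \<le> gp v (parent t k ?a)"
    by (rule gp_triangle[OF level_A[OF v] level_A[OF a(1)] level_A[OF parent(1)[OF a(1)]] _ parent(2)[OF a(1)]])
  then show ?case using parent(1)[OF a(1)] anc_step[OF v step.hyps(2)] by simp
qed

lemma anc_anc:
  assumes v: "v \<in> level l" and k: "k \<le> k'" "k' \<le> l" shows "anc t k (anc t k' v) = anc t k v"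
  using k(1)
proof (induction k rule: inc_induct)
  case base
  show ?case using anc[OF v k(2)] by (simp add: anc_self)
next
  case (step k)
  have "anc t k' v \<in> level k'" using anc[OF v k(2)] by simp
  then show ?case using anc_step[of "anc t k' v" k' k t] anc_step[OF v, of k t] step k(2) by simp
qed

definition Desc :: "nat \<Rightarrow> nat \<Rightarrow> 'a \<Rightarrow> 'a set" where
  "Desc t k z = {v. \<exists>l\<ge>k. v \<in> level l \<and> anc t k v = z}"

lemma Desc_nested:
  assumes "k \<le> k'" shows "Desc t k z \<inter> Desc t k' z' = {} \<or> Desc t k' z' \<subseteq> Desc t k z"
proof (rule disjCI)
  assume "\<not> Desc t k' z' \<subseteq> Desc t k z"
  then obtain w l where w: "w \<in> level l" "k' \<le> l" "anc t k' w = z'" "w \<notin> Desc t k z" by (auto simp: Desc_def)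
  have ne: "anc t k z' \<noteq> z" using w assms anc_anc[OF w(1) assms w(2), of t] by (auto simp: Desc_def)
  show "Desc t k z \<inter> Desc t k' z' = {}"
  proof (rule ccontr)
    assume "Desc t k z \<inter> Desc t k' z' \<noteq> {}"
    then obtain v l l' where v: "v \<in> level l" "anc t k v = z" "k' \<le> l'" "v \<in> level l'" "anc t k' v = z'"
      by (auto simp: Desc_def)
    then show False using anc_anc[OF v(4) assms v(3), of t] ne by simp
  qed
qed

text \<open>The first component of the index is a colour, i.e. one of the trees, or \<open>Suc N\<close> for a star with centre
  outside \<open>A\<close>, which separates points that are too close for the trees.\<close>

definition coord :: "'a \<Rightarrow> nat \<times> 'a \<Rightarrow> real" where
  "coord x = (\<lambda>(t, v). if t \<le> N then occupation x v else if t = Suc N then of_bool (v = x) else 0)"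

definition descendant_sets :: "(nat \<times> 'a) set set" where
  "descendant_sets = {{t} \<times> Desc t k z | t k z. t \<le> N} \<union> {{(Suc N, x)} | x. True}"

lemma laminar_descendant_sets: "laminar descendant_sets"
  unfolding laminar_def
proof (intro ballI)
  fix B1 B2 assume B: "B1 \<in> descendant_sets" "B2 \<in> descendant_sets"
  have tree: "{t} \<times> Desc t k z \<inter> {t'} \<times> Desc t' k' z' = {} \<or> {t} \<times> Desc t k z \<subseteq> {t'} \<times> Desc t' k' z' \<or>
      {t'} \<times> Desc t' k' z' \<subseteq> {t} \<times> Desc t k z" for t k z t' k' z'
  proof (cases "t = t'")
    case True
    then show ?thesis using Desc_nested[of k k' t z z'] Desc_nested[of k' k t z' z] nat_le_linear[of k k'] by blast
  qed auto
  consider p where "B1 = {p}" | p where "B2 = {p}"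
    | t k z t' k' z' where "B1 = {t} \<times> Desc t k z" "B2 = {t'} \<times> Desc t' k' z'"
    using B unfolding descendant_sets_def by blast
  then show "B1 \<inter> B2 = {} \<or> B1 \<subseteq> B2 \<or> B2 \<subseteq> B1"
  proof cases
    case 3
    then show ?thesis using tree by simp
  qed auto
qed

section \<open>Estimates for the coordinates and the detecting sets\<close>

lemma occupation_support:
  assumes x: "x \<in> A" and nz: "occupation x v \<noteq> 0"
  obtains k where "k \<le> h x div r" "v \<in> level k" "real (k * r) - 2 * \<delta> \<le> gp v x"
proof -
  obtain k where k: "k \<le> h x div r" "law x k v \<noteq> 0"
    using nz unfolding occupation_def by (rule sum.not_neutral_contains_not_neutral) auto
  then show thesis using that law_support[OF x k] by blast
qed

text \<open>The index set is enlarged to a rectangle and summed row by row: one row for each of the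
  \<open>N + 1\<close> colours, and one for the star.\<close>

lemma sum_Fc_le:
  fixes V :: "(nat \<times> 'a) set" and G :: "nat \<times> 'a \<Rightarrow> real"
  assumes V: "finite V" and nonneg: "\<And>i. 0 \<le> G i" and zero: "\<And>t v. Suc N < t \<Longrightarrow> G (t, v) = 0"
    and trees: "\<And>t W. t \<le> N \<Longrightarrow> finite W \<Longrightarrow> (\<Sum>v\<in>W. G (t, v)) \<le> a"
    and star: "\<And>W. finite W \<Longrightarrow> (\<Sum>v\<in>W. G (Suc N, v)) \<le> c"
  shows "(\<Sum>i\<in>V. G i) \<le> (real N + 1) * a + c"
proof -
  define W where "W = snd ` V"
  have W: "finite W" using V by (simp add: W_def)
  have "(\<Sum>i\<in>V. G i) \<le> (\<Sum>i\<in>V \<union> {..Suc N} \<times> W. G i)"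
    by (rule sum_mono2) (use V W nonneg in auto)
  also have "\<dots> = (\<Sum>i\<in>{..Suc N} \<times> W. G i)"
  proof (rule sum.mono_neutral_right)
    show "\<forall>i\<in>V \<union> {..Suc N} \<times> W - {..Suc N} \<times> W. G i = 0"
    proof
      fix i assume i: "i \<in> V \<union> {..Suc N} \<times> W - {..Suc N} \<times> W"
      obtain t v where tv: "i = (t, v)" by (cases i)
      then have "v \<in> W" using i by (force simp: W_def)
      then have "Suc N < t" using i tv by auto
      then show "G i = 0" using zero tv by simp
    qed
  qed (use V W in auto)
  also have "\<dots> = (\<Sum>t\<le>Suc N. \<Sum>v\<in>W. G (t, v))" by (rule sum_Times)
  also have "\<dots> = (\<Sum>t\<le>N. \<Sum>v\<in>W. G (t, v)) + (\<Sum>v\<in>W. G (Suc N, v))" by simp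
  also have "\<dots> \<le> (\<Sum>t\<le>N. a) + c" by (intro add_mono sum_mono trees star W) auto
  finally show ?thesis by (simp add: algebra_simps)
qed

lemma coord_lipschitz:
  assumes xy: "x \<in> A" "y \<in> A" and V: "finite V"
  shows "(\<Sum>i\<in>V. \<bar>coord x i - coord y i\<bar>) \<le> ((real N + 1) * (2 * real N + 1) + 2) * real (d x y)"
proof -
  have "(\<Sum>i\<in>V. \<bar>coord x i - coord y i\<bar>) \<le> (real N + 1) * ((2 * real N + 1) * real (d x y)) + 2 * real (d x y)"
  proof (rule sum_Fc_le[OF V])
    fix W :: "'a set" assume W: "finite W"
    show "(\<Sum>v\<in>W. \<bar>coord x (t, v) - coord y (t, v)\<bar>) \<le> (2 * real N + 1) * real (d x y)" if "t \<le> N" for t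
      using occupation_lipschitz[OF xy W] that by (simp add: coord_def)
    show "(\<Sum>v\<in>W. \<bar>coord x (Suc N, v) - coord y (Suc N, v)\<bar>) \<le> 2 * real (d x y)"
    proof (cases "x = y")
      case False
      then have "1 \<le> real (d x y)" using d_eq[OF xy] by (cases "d x y") auto
      moreover have "(\<Sum>v\<in>W. \<bar>coord x (Suc N, v) - coord y (Suc N, v)\<bar>) \<le> (\<Sum>v\<in>W. of_bool (v = x) + of_bool (v = y))"
        by (intro sum_mono) (auto simp: coord_def)
      moreover have "(\<Sum>v\<in>W. of_bool (v = x) + of_bool (v = y)) \<le> (2 :: real)"
        using W by (simp add: of_bool_def sum.distrib)
      ultimately show ?thesis by linarith
    qed (simp add: coord_def)
  qed (auto simp: coord_def)
  then show ?thesis by (simp add: algebra_simps)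
qed

lemma coord_nonneg: "0 \<le> coord x i"
  by (cases i) (auto simp: coord_def occupation_nonneg)

lemma coord_mass:
  assumes x: "x \<in> A" and V: "finite V"
  shows "(\<Sum>i\<in>V. \<bar>coord x i\<bar>) \<le> (real N + 2) * (real (h x) + 1)"
proof -
  have "(\<Sum>i\<in>V. coord x i) \<le> (real N + 1) * (real (h x) + 1) + 1"
  proof (rule sum_Fc_le[OF V coord_nonneg])
    fix W :: "'a set" assume W: "finite W"
    show "(\<Sum>v\<in>W. coord x (t, v)) \<le> real (h x) + 1" if "t \<le> N" for t
      using sum_occupation[OF x W] that by (simp add: coord_def)
    show "(\<Sum>v\<in>W. coord x (Suc N, v)) \<le> 1" using W by (simp add: coord_def of_bool_def)
  qed (auto simp: coord_def)
  then show ?thesis using coord_nonneg by (simp add: algebra_simps)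
qed

text \<open>For distant points the detecting set consists of the descendants of a point
  \<open>z\<close> on a geodesic to \<open>x\<close>, just beyond the place where the geodesics to
  \<open>x\<close> and \<open>y\<close> part, in the tree of the colour of \<open>z\<close>. The
  walk from \<open>x\<close> lies in it at all levels beyond \<open>z\<close>, and the walk from
  \<open>y\<close> never visits it.\<close>

lemma coord_detect:
  assumes xy: "x \<in> A" "y \<in> A" "x \<noteq> y" "h y \<le> h x"
  shows "\<exists>L\<in>descendant_sets. (\<forall>i\<in>L. coord y i = 0) \<and>
    (\<forall>V. finite V \<longrightarrow> (\<forall>i. i \<notin> V \<longrightarrow> coord x i = 0) \<longrightarrow> 1 / (8 * real r) * real (d x y) \<le> (\<Sum>i\<in>V \<inter> L. coord x i))"
proof (cases "d x y \<le> 8 * r")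
  case True
  have "1 / (8 * real r) * real (d x y) \<le> (\<Sum>i\<in>V \<inter> {(Suc N, x)}. coord x i)" if V: "\<forall>i. i \<notin> V \<longrightarrow> coord x i = 0" for V
  proof -
    have one: "coord x (Suc N, x) = 1" by (simp add: coord_def)
    then have "V \<inter> {(Suc N, x)} = {(Suc N, x)}" using V by (metis Int_insert_right_if1 inf_bot_right zero_neq_one)
    moreover have "real (d x y) \<le> 8 * real r" using of_nat_mono[OF True, where 'a = real] by simp
    ultimately show ?thesis using r(2) one by (simp add: field_simps)
  qed
  moreover have "\<forall>i\<in>{(Suc N, x)}. coord y i = 0" using xy(3) by (simp add: coord_def)
  moreover have "{(Suc N, x)} \<in> descendant_sets" by (auto simp: descendant_sets_def)
  ultimately show ?thesis by blast
next
  case False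
  define g where "g = gp x y"
  define n where "n = h x div r"
  have g0: "0 \<le> g" unfolding g_def by (rule gp_nonneg[OF xy(1,2)])
  have r0: "0 < real r" using r(2) by simp
  have far: "8 * real r < real (d x y)" using False of_nat_less_iff[of "8 * r" "d x y", where 'a = real] by simp
  have hg: "real (d x y) / 2 \<le> real (h x) - g" using xy(4) by (simp add: g_def gp_def field_simps)
  \<comment> \<open>The least level with \<open>k * r > g + 4 * \<delta>\<close>. Going from
    \<open>x\<close> over \<open>z\<close> and a common point \<open>v\<close> to \<open>y\<close>
    loses \<open>4 * \<delta>\<close>: two from the drift of walk and tree, two from
    hyperbolicity.\<close>
  define k where "k = nat \<lfloor>(g + 4 * \<delta>) / real r\<rfloor> + 1"
  have "0 \<le> (g + 4 * \<delta>) / real r" using g0 \<delta>_nonneg r0 by simp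
  then have "real k - 1 \<le> (g + 4 * \<delta>) / real r" "(g + 4 * \<delta>) / real r < real k" unfolding k_def by (simp_all) linarith+
  then have k: "real k * real r \<le> g + 4 * \<delta> + real r" "g + 4 * \<delta> < real k * real r"
    using r0 by (simp_all add: field_simps)
  have "real (k * r) \<le> real (h x)" using k(1) hg far r(1) by simp
  then have kh: "k * r \<le> h x" by (simp only: of_nat_le_iff)
  then have kn: "k \<le> n" using r(2) by (simp add: n_def less_eq_div_iff_mult_less_eq)
  obtain z where z: "z \<in> level k" "gp z x = real (k * r)" using ray_point[OF xy(1) kh] by blast
  define t where "t = col z"
  have t: "t \<le> N" using col(1)[OF level_A[OF z(1)]] by (simp add: t_def)
  \<comment> \<open>The ancestor \<open>a\<close> of \<open>v\<close> at level \<open>k + 1\<close>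
    lies in the shadow of \<open>z\<close>, so in the tree of its own colour \<open>z\<close>
    captures \<open>a\<close>, whatever other geodesic points \<open>a\<close> has.\<close>
  have inside: "v \<in> Desc t k z" if l: "k < l" "l \<le> n" and nz: "law x l v \<noteq> 0" for l v
  proof -
    have v: "v \<in> level l" "real (l * r) - 2 * \<delta> \<le> gp v x"
      using law_support[OF xy(1) _ nz] l by (auto simp: n_def)
    define a where "a = anc t (Suc k) v"
    have a: "a \<in> level (Suc k)" "real (Suc k * r) - 2 * \<delta> \<le> gp v a"
      using anc[OF v(1), of "Suc k" t] l by (auto simp: a_def)
    have aA: "a \<in> A" and vA: "v \<in> A" and zA: "z \<in> A" using a v z level_A by auto
    have "Suc k * r \<le> l * r" using l by (intro mult_le_mono1) simp
    then have "real (Suc k * r) \<le> real (l * r)" by (rule of_nat_mono)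
    then have "real (Suc k * r) - 2 * \<delta> \<le> gp v x" using v(2) by simp
    then have "real (Suc k * r) - 2 * \<delta> - \<delta> \<le> gp a x"
      using a(2) gp_sym[OF aA vA] by (intro gp_triangle[OF aA vA xy(1)]) auto
    then have "real (k * r) \<le> gp a x" using r(1) \<delta>_nonneg by simp
    then have "real (k * r) - \<delta> \<le> gp a z"
      using z(2) gp_sym[OF zA xy(1)] by (intro gp_triangle[OF aA xy(1) zA]) auto
    then have "captures t k a z" using z(1) by (simp add: captures_def t_def)
    then have "anc t k v = z" using parent_captured[OF aA] anc_step[OF v(1) l(1)] by (simp add: a_def)
    then show ?thesis unfolding Desc_def using v(1) l(1) by (intro CollectI exI[of _ l]) simp
  qed
  \<comment> \<open>A point visited from \<open>y\<close> and descending from \<open>z\<close> would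
    force \<open>gp x y\<close> to be at least \<open>k * r - 4 * \<delta>\<close>, which is more
    than \<open>g\<close>.\<close>
  have outside: "occupation y v = 0" if "v \<in> Desc t k z" for v
  proof (rule ccontr)
    assume "occupation y v \<noteq> 0"
    then obtain l where l: "v \<in> level l" "real (l * r) - 2 * \<delta> \<le> gp v y" by (rule occupation_support[OF xy(2)]) 
    from that obtain l' where l': "k \<le> l'" "v \<in> level l'" "anc t k v = z" by (auto simp: Desc_def)
    have "l' = l" using level_div[OF l(1)] level_div[OF l'(2)] by simp
    have vA: "v \<in> A" and zA: "z \<in> A" using l z level_A by auto
    have "k * r \<le> l * r" using l'(1) \<open>l' = l\<close> by (intro mult_le_mono1) simp
    then have "real (k * r) \<le> real (l * r)" by (rule of_nat_mono)
    then have "real (k * r) - 2 * \<delta> \<le> gp v y" using l(2) by simp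
    moreover have "real (k * r) - 2 * \<delta> \<le> gp z v"
      using anc[OF l'(2,1), of t] l'(3) gp_sym[OF vA zA] by simp
    ultimately have "real (k * r) - 2 * \<delta> - \<delta> \<le> gp z y" by (intro gp_triangle[OF zA vA xy(2)])
    moreover have "real (k * r) - 2 * \<delta> - \<delta> \<le> gp x z" using z(2) gp_sym[OF zA xy(1)] \<delta>_nonneg by simp
    ultimately have "real (k * r) - 2 * \<delta> - \<delta> - \<delta> \<le> gp x y" by (intro gp_triangle[OF xy(1) zA xy(2)])
    then show False using k(2) by (simp add: g_def)
  qed
  have "1 / (8 * real r) * real (d x y) \<le> (\<Sum>i\<in>V \<inter> {t} \<times> Desc t k z. coord x i)"
    if V: "finite V" "\<forall>i. i \<notin> V \<longrightarrow> coord x i = 0" for V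
  proof -
    define W where "W = {v. (t, v) \<in> V \<inter> {t} \<times> Desc t k z}"
    have "W \<subseteq> snd ` V" by (force simp: W_def)
    then have W: "finite W" using V(1) finite_subset by blast
    have "V \<inter> {t} \<times> Desc t k z = Pair t ` W" by (auto simp: W_def)
    then have "(\<Sum>i\<in>V \<inter> {t} \<times> Desc t k z. coord x i) = (\<Sum>v\<in>W. occupation x v)"
      using t by (simp add: sum.reindex inj_on_def coord_def)
    also have "\<dots> = (\<Sum>l\<le>n. \<Sum>v\<in>W. law x l v)" unfolding occupation_def n_def by (rule sum.swap)
    also have "\<dots> \<ge> (\<Sum>l\<in>{Suc k..n}. \<Sum>v\<in>W. law x l v)"
      by (rule sum_mono2) (auto intro!: sum_nonneg law_nonneg)
    moreover have "(\<Sum>v\<in>W. law x l v) = 1" if l: "l \<in> {Suc k..n}" for l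
    proof -
      have l': "k < l" "l \<le> n" "l \<le> h x div r" using l by (auto simp: n_def)
      have mem: "v \<in> W" if nz: "law x l v \<noteq> 0" for v
      proof -
        have "law x l v \<le> occupation x v" unfolding occupation_def by (rule member_le_sum) (use l' in \<open>auto simp: law_nonneg\<close>)
        then have "occupation x v \<noteq> 0" using nz law_nonneg[of x l v] by simp
        then have "(t, v) \<in> V" using V(2)[rule_format, of "(t, v)"] t by (auto simp: coord_def)
        then show ?thesis using inside[OF l'(1,2) nz] by (simp add: W_def)
      qed
      have "(\<Sum>v\<in>W. law x l v) = (\<Sum>v\<in>W \<union> level l. law x l v)"
        by (rule sum.mono_neutral_left) (use W finite_level mem in auto)
      also have "\<dots> = (\<Sum>v\<in>level l. law x l v)"
        by (rule sum.mono_neutral_right) (use W finite_level law_support[OF xy(1) l'(3)] in auto)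
      finally show ?thesis using sum_law[OF xy(1) l'(3)] by simp
    qed
    ultimately have "real n - real k \<le> (\<Sum>i\<in>V \<inter> {t} \<times> Desc t k z. coord x i)"
      using kn by (simp add: of_nat_diff)
    \<comment> \<open>Rounding to levels and the \<open>4 * \<delta>\<close> cost at most
      \<open>3 * r\<close> out of \<open>d x y / 2\<close>; as the distance exceeds
      \<open>8 * r\<close>, at least a quarter of that half remains.\<close>
    moreover have "1 / (8 * real r) * real (d x y) \<le> real n - real k"
    proof -
      have "h x \<le> Suc n * r" using div_level(2) by (simp add: n_def)
      then have "real (h x) \<le> real (Suc n * r)" by (rule of_nat_mono)
      then have "real (h x) \<le> real n * real r + real r" by (simp add: algebra_simps)
      then have "real (d x y) / 2 \<le> (real n - real k) * real r + 3 * real r"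
        using hg k(1) r(1) by (simp add: algebra_simps)
      then have "real (d x y) / 8 \<le> (real n - real k) * real r" using far by simp
      then show ?thesis using r0 by (simp add: field_simps)
    qed
    ultimately show ?thesis by simp
  qed
  moreover have "\<forall>i\<in>{t} \<times> Desc t k z. coord y i = 0" using outside t by (auto simp: coord_def)
  moreover have "{t} \<times> Desc t k z \<in> descendant_sets" using t by (auto simp: descendant_sets_def)
  ultimately show ?thesis by blast
qed

theorem interval_coordinates_coord:
  "interval_coordinates A h (\<lambda>x y. real (d x y)) coord (\<lambda>R. {..Suc N} \<times> {v \<in> A. h v \<le> R}) descendant_sets
    ((real N + 1) * (2 * real N + 1) + 2) (1 / (8 * real r))"
proof
  show "finite ({..Suc N} \<times> {v \<in> A. h v \<le> R})" for R using finite_ball by simp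
  show "finite {x \<in> A. h x \<le> R}" for R by (rule finite_ball)
  show "0 < (real N + 1) * (2 * real N + 1) + 2" by (intro add_nonneg_pos) auto
  show "0 < 1 / (8 * real r)" using r(2) by simp
  show "laminar descendant_sets" by (rule laminar_descendant_sets)
  fix x assume x: "x \<in> A"
  show "real (d x x) = 0" by (simp add: d_refl[OF x])
  show "coord x i = 0" if hR: "h x \<le> R" and i: "i \<notin> {..Suc N} \<times> {v \<in> A. h v \<le> R}" for R i
  proof (cases i)
    case (Pair t v)
    show ?thesis
    proof (rule ccontr)
      assume nz: "coord x i \<noteq> 0"
      then have "t \<le> Suc N" by (auto simp: coord_def Pair split: if_splits)
      moreover have "v \<in> A \<and> h v \<le> R"
      proof (cases "t \<le> N")
        case True
        then have "occupation x v \<noteq> 0" using nz by (simp add: coord_def Pair)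
        then obtain k where "k \<le> h x div r" "v \<in> level k" by (rule occupation_support[OF x])
        then show ?thesis using level_le[of k x] hR by (simp add: level_def)
      next
        case False
        then have "v = x" using nz by (auto simp: coord_def Pair split: if_splits)
        then show ?thesis using x hR by simp
      qed
      ultimately show False using i Pair by simp
    qed
  qed
  show "(\<Sum>i\<in>V. \<bar>coord x i\<bar>) \<le> ((real N + 1) * (2 * real N + 1) + 2) * (real (h x) + 1)" if "finite V" for V
  proof -
    have "real N + 2 \<le> (real N + 1) * (2 * real N + 1) + 2" by (simp add: algebra_simps)
    then have "(real N + 2) * (real (h x) + 1) \<le> ((real N + 1) * (2 * real N + 1) + 2) * (real (h x) + 1)"
      by (rule mult_right_mono) simp
    then show ?thesis using coord_mass[OF x that] by linarith
  qed
  fix y assume y: "y \<in> A"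
  show "(\<Sum>i\<in>V. \<bar>coord x i - coord y i\<bar>) \<le> ((real N + 1) * (2 * real N + 1) + 2) * real (d x y)" if "finite V" for V
    by (rule coord_lipschitz[OF x y that])
  show "\<bar>real (h x) - real (h y)\<bar> \<le> real (d x y)" by (rule h_lipschitz[OF x y])
  show "real (d x y) = real (d y x)" by (simp add: d_sym[OF x y])
  assume ne: "x \<noteq> y"
  show "1 \<le> real (d x y)" using d_eq[OF x y] ne by (cases "d x y") auto
  assume "h y \<le> h x"
  then show "\<exists>L\<in>descendant_sets. (\<forall>i\<in>L. coord y i = 0) \<and>
    (\<forall>V. finite V \<longrightarrow> (\<forall>i. i \<notin> V \<longrightarrow> coord x i = 0) \<longrightarrow> 1 / (8 * real r) * real (d x y) \<le> (\<Sum>i\<in>V \<inter> L. coord x i))"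
    by (rule coord_detect[OF x y ne])
qed

end

section \<open>Word metrics\<close>

definition letters :: "('a, 'm) monoid_scheme \<Rightarrow> 'a set \<Rightarrow> 'a set" where
  "letters G S = S \<union> m_inv G ` S"

context group
begin

lemma word_prod_Nil [simp]: "word_prod G [] = \<one>" by (simp add: word_prod_def)

lemma word_prod_Cons [simp]: "word_prod G (a # w) = a \<otimes> word_prod G w" by (simp add: word_prod_def)

lemma word_prod_closed [simp]: "set w \<subseteq> carrier G \<Longrightarrow> word_prod G w \<in> carrier G"
  by (induction w) auto

lemma word_prod_append:
  "set u \<subseteq> carrier G \<Longrightarrow> set v \<subseteq> carrier G \<Longrightarrow> word_prod G (u @ v) = word_prod G u \<otimes> word_prod G v"
  by (induction u) (auto simp: m_assoc)

lemma word_prod_inverse: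
  "set w \<subseteq> carrier G \<Longrightarrow> word_prod G (rev (map (m_inv G) w)) = inv (word_prod G w)"
proof (induction w)
  case (Cons a w)
  have "set (rev (map (m_inv G) w)) \<subseteq> carrier G" using Cons.prems by auto
  then show ?case using Cons by (simp add: word_prod_append inv_mult_group)
qed simp

context
  fixes S assumes S: "finite_generating_set G S"
begin

lemma finite_letters: "finite (letters G S)"
  using S by (simp add: finite_generating_set_def letters_def)

lemma letters_carrier: "letters G S \<subseteq> carrier G"
  using S by (auto simp: finite_generating_set_def letters_def)

lemma letters_inv: "a \<in> letters G S \<Longrightarrow> inv a \<in> letters G S"
  using S by (auto simp: finite_generating_set_def letters_def)

lemma word_exists: "g \<in> carrier G \<Longrightarrow> \<exists>w. set w \<subseteq> letters G S \<and> word_prod G w = g"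
proof -
  assume "g \<in> carrier G"
  then have "g \<in> generate G S" using S by (simp add: finite_generating_set_def)
  then show ?thesis
  proof (induction g rule: generate.induct)
    case one
    show ?case by (intro exI[of _ "[]"]) simp
  next
    case (incl s)
    then show ?case using letters_carrier by (intro exI[of _ "[s]"]) (auto simp: letters_def)
  next
    case (inv s)
    then show ?case using letters_carrier by (intro exI[of _ "[inv s]"]) (auto simp: letters_def)
  next
    case (eng g1 g2)
    then obtain u v where "set u \<subseteq> letters G S" "word_prod G u = g1" "set v \<subseteq> letters G S" "word_prod G v = g2" by blast
    then show ?case using letters_carrier by (intro exI[of _ "u @ v"]) (auto simp: word_prod_append)
  qed
qed

lemma word_length_le: "set w \<subseteq> letters G S \<Longrightarrow> word_length G S (word_prod G w) \<le> length w"
  unfolding word_length_def letters_def by (rule Least_le) auto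

lemma shortest_word:
  assumes "g \<in> carrier G"
  obtains w where "set w \<subseteq> letters G S" "word_prod G w = g" "length w = word_length G S g"
proof -
  have "\<exists>n w. length w = n \<and> set w \<subseteq> S \<union> m_inv G ` S \<and> word_prod G w = g"
    using word_exists[OF assms] by (auto simp: letters_def)
  from LeastI_ex[OF this] show thesis using that unfolding word_length_def letters_def by blast
qed

lemma word_length_one: "word_length G S \<one> = 0"
  using word_length_le[of "[]"] by simp

lemma word_length_eq_0: "g \<in> carrier G \<Longrightarrow> word_length G S g = 0 \<Longrightarrow> g = \<one>"
  by (erule shortest_word) auto

lemma word_length_mult:
  assumes "g \<in> carrier G" "h \<in> carrier G"
  shows "word_length G S (g \<otimes> h) \<le> word_length G S g + word_length G S h"
proof -
  obtain u where u: "set u \<subseteq> letters G S" "word_prod G u = g" "length u = word_length G S g"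
    using shortest_word[OF assms(1)] .
  obtain v where v: "set v \<subseteq> letters G S" "word_prod G v = h" "length v = word_length G S h"
    using shortest_word[OF assms(2)] .
  have "set u \<subseteq> carrier G" "set v \<subseteq> carrier G" using u v letters_carrier by auto
  then have "word_prod G (u @ v) = g \<otimes> h" using u v by (simp add: word_prod_append)
  then show ?thesis using word_length_le[of "u @ v"] u v by simp
qed

lemma word_length_inv_le:
  assumes "g \<in> carrier G" shows "word_length G S (inv g) \<le> word_length G S g"
proof -
  obtain u where u: "set u \<subseteq> letters G S" "word_prod G u = g" "length u = word_length G S g"
    using shortest_word[OF assms] .
  have "set u \<subseteq> carrier G" using u letters_carrier by auto
  then have "word_prod G (rev (map (m_inv G) u)) = inv g" using u by (simp add: word_prod_inverse)
  moreover have "set (rev (map (m_inv G) u)) \<subseteq> letters G S" using u letters_inv by auto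
  ultimately show ?thesis using word_length_le[of "rev (map (m_inv G) u)"] u by simp
qed

lemma word_length_inv: "g \<in> carrier G \<Longrightarrow> word_length G S (inv g) = word_length G S g"
  using word_length_inv_le[of g] word_length_inv_le[of "inv g"] by simp

text \<open>Prefix and suffix of a shortest word are themselves shortest; this provides the
  geodesics of the Cayley graph.\<close>

lemma word_length_split:
  assumes "g \<in> carrier G" "k \<le> word_length G S g"
  obtains p where "p \<in> carrier G" "word_length G S p = k" "word_length G S (inv p \<otimes> g) = word_length G S g - k"
proof -
  obtain w where w: "set w \<subseteq> letters G S" "word_prod G w = g" "length w = word_length G S g"
    using shortest_word[OF assms(1)] .
  define p q where "p = word_prod G (take k w)" and "q = word_prod G (drop k w)"
  have sets: "set (take k w) \<subseteq> letters G S" "set (drop k w) \<subseteq> letters G S"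
    using w(1) set_take_subset set_drop_subset by fastforce+
  then have sets': "set (take k w) \<subseteq> carrier G" "set (drop k w) \<subseteq> carrier G" using letters_carrier by auto
  have pq: "p \<in> carrier G" "q \<in> carrier G" using sets' by (simp_all add: p_def q_def)
  have "g = p \<otimes> q" using word_prod_append[OF sets'] w(2) by (simp add: p_def q_def)
  then have "inv p \<otimes> g = q" using pq by (simp add: m_assoc[symmetric])
  moreover have "word_length G S p \<le> k" using word_length_le[OF sets(1)] by (simp add: p_def)
  moreover have "word_length G S q \<le> word_length G S g - k" using word_length_le[OF sets(2)] w(3) by (simp add: q_def)
  moreover have "word_length G S g \<le> word_length G S p + word_length G S q"
    using word_length_mult[OF pq] \<open>g = p \<otimes> q\<close> by simp
  ultimately show thesis using that[of p] pq assms(2) by simp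
qed

lemma finite_word_ball: "finite {g \<in> carrier G. word_length G S g \<le> R}"
proof (rule finite_subset)
  show "{g \<in> carrier G. word_length G S g \<le> R} \<subseteq> word_prod G ` {w. set w \<subseteq> letters G S \<and> length w \<le> R}"
  proof
    fix g assume "g \<in> {g \<in> carrier G. word_length G S g \<le> R}"
    then have g: "g \<in> carrier G" "word_length G S g \<le> R" by auto
    obtain w where "set w \<subseteq> letters G S" "word_prod G w = g" "length w = word_length G S g"
      using shortest_word[OF g(1)] .
    then show "g \<in> word_prod G ` {w. set w \<subseteq> letters G S \<and> length w \<le> R}" using g(2) by force
  qed
  show "finite (word_prod G ` {w. set w \<subseteq> letters G S \<and> length w \<le> R})"
    by (intro finite_imageI finite_lists_length_le finite_letters)
qed

end

text \<open>The sum serves as a crude maximum of the \<open>T\<close>-lengths of the letters of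
  \<open>S\<close>; \<open>Suc\<close> keeps \<open>K\<close> positive even when there are no
  letters.\<close>

lemma word_length_change_generators:
  assumes S: "finite_generating_set G S" and T: "finite_generating_set G T"
  obtains K :: nat where "0 < K" "\<And>g. g \<in> carrier G \<Longrightarrow> word_length G T g \<le> K * word_length G S g"
proof -
  define K where "K = Suc (\<Sum>a\<in>letters G S. word_length G T a)"
  have K: "word_length G T a \<le> K" if "a \<in> letters G S" for a
    using member_le_sum[OF that, of "word_length G T"] finite_letters[OF S] by (simp add: K_def)
  have word: "word_length G T (word_prod G w) \<le> K * length w" if "set w \<subseteq> letters G S" for w
    using that
  proof (induction w)
    case Nil
    then show ?case by (simp add: word_length_one[OF T])
  next
    case (Cons a w)
    have "a \<in> carrier G" "set w \<subseteq> carrier G" using Cons.prems letters_carrier[OF S] by auto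
    then have "word_length G T (a \<otimes> word_prod G w) \<le> word_length G T a + word_length G T (word_prod G w)"
      by (intro word_length_mult[OF T]) simp_all
    then show ?case using Cons K[of a] by simp
  qed
  show thesis
  proof (rule that[of K])
    fix g assume "g \<in> carrier G"
    then obtain w where "set w \<subseteq> letters G S" "word_prod G w = g" "length w = word_length G S g"
      by (rule shortest_word[OF S])
    then show "word_length G T g \<le> K * word_length G S g" using word by metis
  qed (simp add: K_def)
qed

text \<open>Left translations carry the ball at the identity onto the others, so the growth bound is
  uniform in the centre; geodesics come from splitting words.\<close>

lemma hyperbolic_graph_word_metric:
  assumes T: "finite_generating_set G T" and hyp: "gromov_hyperbolic (carrier G) (word_dist G T)"
  obtains \<delta> where "hyperbolic_graph (carrier G) (\<lambda>x y. word_length G T (inv x \<otimes> y)) \<one> \<delta>"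
proof -
  have wd: "word_dist G T = (\<lambda>x y. real (word_length G T (inv x \<otimes> y)))"
    by (intro ext) (simp add: word_dist_def)
  obtain \<delta> where \<delta>: "0 \<le> \<delta>" and four: "\<forall>x\<in>carrier G. \<forall>y\<in>carrier G. \<forall>z\<in>carrier G. \<forall>w\<in>carrier G.
      min (gromov_product (word_dist G T) w x y) (gromov_product (word_dist G T) w y z) - \<delta>
        \<le> gromov_product (word_dist G T) w x z"
    using hyp unfolding gromov_hyperbolic_def by blast
  have "hyperbolic_graph (carrier G) (\<lambda>x y. word_length G T (inv x \<otimes> y)) \<one> \<delta>"
  proof
    show "\<one> \<in> carrier G" by simp
    show "0 \<le> \<delta>" by fact
    show "word_length G T (inv x \<otimes> x) = 0" if "x \<in> carrier G" for x
      using that by (simp add: word_length_one[OF T])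
    show "x = y" if "x \<in> carrier G" "y \<in> carrier G" "word_length G T (inv x \<otimes> y) = 0" for x y
    proof -
      have "inv x \<otimes> y = \<one>" using that by (intro word_length_eq_0[OF T]) auto
      then have "x \<otimes> (inv x \<otimes> y) = x" using that by simp
      then show ?thesis using that by (simp add: m_assoc[symmetric])
    qed
    show "word_length G T (inv x \<otimes> y) = word_length G T (inv y \<otimes> x)" if "x \<in> carrier G" "y \<in> carrier G" for x y
    proof -
      have "inv (inv x \<otimes> y) = inv y \<otimes> x" using that by (simp add: inv_mult_group)
      then show ?thesis using word_length_inv[OF T, of "inv x \<otimes> y"] that by simp
    qed
    show "word_length G T (inv x \<otimes> z) \<le> word_length G T (inv x \<otimes> y) + word_length G T (inv y \<otimes> z)"
      if "x \<in> carrier G" "y \<in> carrier G" "z \<in> carrier G" for x y z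
    proof -
      have "y \<otimes> (inv y \<otimes> z) = z" using that by (simp add: m_assoc[symmetric])
      then have "(inv x \<otimes> y) \<otimes> (inv y \<otimes> z) = inv x \<otimes> z" using that by (simp add: m_assoc)
      then show ?thesis using word_length_mult[OF T, of "inv x \<otimes> y" "inv y \<otimes> z"] that by simp
    qed
    show "\<exists>z\<in>carrier G. word_length G T (inv x \<otimes> z) = k \<and> word_length G T (inv z \<otimes> y) = word_length G T (inv x \<otimes> y) - k"
      if xy: "x \<in> carrier G" "y \<in> carrier G" and k: "k \<le> word_length G T (inv x \<otimes> y)" for x y k
    proof -
      obtain p where p: "p \<in> carrier G" "word_length G T p = k"
        "word_length G T (inv p \<otimes> (inv x \<otimes> y)) = word_length G T (inv x \<otimes> y) - k"
        using word_length_split[OF T _ k] xy by auto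
      have "inv x \<otimes> (x \<otimes> p) = p" using xy p by (simp add: m_assoc[symmetric])
      moreover have "inv (x \<otimes> p) \<otimes> y = inv p \<otimes> (inv x \<otimes> y)" using xy p by (simp add: inv_mult_group m_assoc)
      ultimately show ?thesis using p xy by (intro bexI[of _ "x \<otimes> p"]) auto
    qed
    show "\<exists>N. \<forall>x\<in>carrier G. finite {y \<in> carrier G. word_length G T (inv x \<otimes> y) \<le> R} \<and>
        card {y \<in> carrier G. word_length G T (inv x \<otimes> y) \<le> R} \<le> N" for R
    proof (intro exI ballI)
      fix x assume x: "x \<in> carrier G"
      let ?B = "{g \<in> carrier G. word_length G T g \<le> R}"
      have sub: "{y \<in> carrier G. word_length G T (inv x \<otimes> y) \<le> R} \<subseteq> (\<lambda>g. x \<otimes> g) ` ?B"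
      proof
        fix y assume y: "y \<in> {y \<in> carrier G. word_length G T (inv x \<otimes> y) \<le> R}"
        then have "y = x \<otimes> (inv x \<otimes> y)" using x by (simp add: m_assoc[symmetric])
        then show "y \<in> (\<lambda>g. x \<otimes> g) ` ?B" using x y by (intro image_eqI[of _ _ "inv x \<otimes> y"]) auto
      qed
      have fin: "finite ?B" by (rule finite_word_ball[OF T])
      then have "finite {y \<in> carrier G. word_length G T (inv x \<otimes> y) \<le> R}" using sub finite_subset by blast
      moreover have "card {y \<in> carrier G. word_length G T (inv x \<otimes> y) \<le> R} \<le> card ?B"
        using card_mono[OF finite_imageI[OF fin] sub] card_image_le[OF fin, of "\<lambda>g. x \<otimes> g"] by linarith
      ultimately show "finite {y \<in> carrier G. word_length G T (inv x \<otimes> y) \<le> R} \<and>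
        card {y \<in> carrier G. word_length G T (inv x \<otimes> y) \<le> R} \<le> card ?B" by blast
    qed
    show "min (gromov_product (\<lambda>x y. real (word_length G T (inv x \<otimes> y))) \<one> x y)
        (gromov_product (\<lambda>x y. real (word_length G T (inv x \<otimes> y))) \<one> y z) - \<delta>
      \<le> gromov_product (\<lambda>x y. real (word_length G T (inv x \<otimes> y))) \<one> x z"
      if "x \<in> carrier G" "y \<in> carrier G" "z \<in> carrier G" for x y z
      using four[unfolded wd] that one_closed by blast
  qed
  then show thesis by (rule that)
qed

end

text \<open>Hyperbolicity is given for some generating set \<open>T\<close>, so the embedding is
  built for its word metric and then transferred to \<open>S\<close> by comparing word lengths in
  both directions.\<close>

theorem theoremT:
  fixes G :: "('a, 'm) monoid_scheme" and S :: "'a set"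
  assumes "word_hyperbolic G"
    and "finite_generating_set G S"
    and "\<not> superreflexive TYPE('v::banach)"
  shows "\<exists>f :: 'a \<Rightarrow> 'v. bilipschitz_embedding (carrier G) (word_dist G S) f"
proof -
  interpret group G using assms(1) by (simp add: word_hyperbolic_def)
  obtain T where T: "finite_generating_set G T" and hyp: "gromov_hyperbolic (carrier G) (word_dist G T)"
    using assms(1) by (auto simp: word_hyperbolic_def)
  obtain \<delta> where "hyperbolic_graph (carrier G) (\<lambda>x y. word_length G T (inv\<^bsub>G\<^esub> x \<otimes>\<^bsub>G\<^esub> y)) \<one>\<^bsub>G\<^esub> \<delta>"
    using hyperbolic_graph_word_metric[OF T hyp] .
  then interpret hyperbolic_graph "carrier G" "\<lambda>x y. word_length G T (inv\<^bsub>G\<^esub> x \<otimes>\<^bsub>G\<^esub> y)" "\<one>\<^bsub>G\<^esub>" \<delta> .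
  obtain f :: "'a \<Rightarrow> 'v" and c C where c: "0 < c"
    and low: "\<And>x y. x \<in> carrier G \<Longrightarrow> y \<in> carrier G \<Longrightarrow> c * real (word_length G T (inv\<^bsub>G\<^esub> x \<otimes>\<^bsub>G\<^esub> y)) \<le> norm (f x - f y)"
    and up: "\<And>x y. x \<in> carrier G \<Longrightarrow> y \<in> carrier G \<Longrightarrow> norm (f x - f y) \<le> C * real (word_length G T (inv\<^bsub>G\<^esub> x \<otimes>\<^bsub>G\<^esub> y))"
    using interval_coordinates.embedding[OF interval_coordinates_coord assms(3)] by metis
  obtain K where K: "0 < K" "\<And>g. g \<in> carrier G \<Longrightarrow> word_length G T g \<le> K * word_length G S g"
    using word_length_change_generators[OF assms(2) T] by metis
  obtain K' where K': "0 < K'" "\<And>g. g \<in> carrier G \<Longrightarrow> word_length G S g \<le> K' * word_length G T g"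
    using word_length_change_generators[OF T assms(2)] by metis
  define c' where "c' = c / real K'"
  \<comment> \<open>The maximum secures \<open>c' \<le> C'\<close>, also for the trivial group, and
    the absolute value is there because \<open>embedding\<close> does not state the sign of its
    upper constant.\<close>
  define C' where "C' = max c' (\<bar>C\<bar> * real K)"
  have "bilipschitz_embedding (carrier G) (word_dist G S) f"
    unfolding bilipschitz_embedding_def
  proof (rule exI[of _ c'], rule exI[of _ C'], intro conjI ballI)
    show "0 < c'" using c K' by (simp add: c'_def)
    show "c' \<le> C'" by (simp add: C'_def)
    fix x y assume xy: "x \<in> carrier G" "y \<in> carrier G"
    define g where "g = inv\<^bsub>G\<^esub> x \<otimes>\<^bsub>G\<^esub> y"
    have g: "g \<in> carrier G" using xy by (simp add: g_def)
    have S: "word_dist G S x y = real (word_length G S g)" by (simp add: word_dist_def g_def)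
    have KT: "real (word_length G T g) \<le> real K * real (word_length G S g)"
      using of_nat_mono[OF K(2)[OF g], where 'a = real] by simp
    have KS: "real (word_length G S g) \<le> real K' * real (word_length G T g)"
      using of_nat_mono[OF K'(2)[OF g], where 'a = real] by simp
    have "c' * real (word_length G S g) \<le> c' * (real K' * real (word_length G T g))"
      using KS c by (intro mult_left_mono) (auto simp: c'_def)
    also have "\<dots> = c * real (word_length G T g)" using K'(1) by (simp add: c'_def)
    also have "\<dots> \<le> norm (f x - f y)" using low[OF xy] by (simp add: g_def)
    finally show "c' * word_dist G S x y \<le> dist (f x) (f y)" by (simp add: S dist_norm)
    have "norm (f x - f y) \<le> C * real (word_length G T g)" using up[OF xy] by (simp add: g_def)
    also have "\<dots> \<le> \<bar>C\<bar> * real (word_length G T g)" by (intro mult_right_mono) auto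
    also have "\<dots> \<le> \<bar>C\<bar> * (real K * real (word_length G S g))" using KT by (intro mult_left_mono) auto
    also have "\<dots> \<le> C' * real (word_length G S g)"
      unfolding mult.assoc[symmetric] C'_def by (intro mult_right_mono) auto
    finally show "dist (f x) (f y) \<le> C' * word_dist G S x y" by (simp add: S dist_norm)
  qed
  then show ?thesis by blast
qed

end
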